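(* Let $[a,b]\subset[0,\infty)$ be a finite closed interval and let $\varphi=(\varphi_1,\varphi_2)$ be a pair of real-valued functions in $C^1[a,b]$ such that $\varphi_1,\varphi_2$ are increasing, $\varphi_1+\varphi_2$ is strictly increasing, and $\varphi_1'(x)+\varphi_2'(x)>0$ for all $x\in[a,b]\setminus\{0\}$. Let $T\in\mathbb{M}_n[a,b]$ be diagonalizable. Then the flow $\{F^\varphi_t(T)\}_{t\ge 0}$ converges, exponentially fast as $t\to\infty$, to a normal matrix in the similarity orbit $\mathcal{O}(T)$ of $T$; that is, there exist a normal matrix $N\in\mathcal{O}(T)$ and constants $C,c>0$ with $\|F^\varphi_t(T)-N\|\le Ce^{-ct}$ for all $t\ge 0$.
   Context: $\mathbb{M}_n$ is the algebra of $n\times n$ complex matrices, $|X|=(X^*X)^{1/2}$, $\sigma(\cdot)$ is the spectrum, $[A,B]=AB-BA$. $\mathbb{M}_n[a,b]=\{X\in\mathbb{M}_n: \sigma(|X|)\subset[a,b]\}$. For $X\in\mathbb{M}_n[a,b]$, $\varphi(X):=\varphi_1(|X|)-\varphi_2(|X^*|)$. "Increasing" means non-decreasing. $F^\varphi_t(T):=X(t)$, where $X:[0,\infty)\to\mathbb{M}_n[a,b]$ is the unique global solution of $\frac{dX(t)}{dt}=[\varphi(X(t)),X(t)]$, $X(0)=T$ (it exists and is unique whenever $\varphi_1,\varphi_2$ are increasing Lipschitz functions with $\varphi_1+\varphi_2$ strictly increasing). $\mathcal{O}(T)=\{gTg^{-1}: g\in GL(n,\mathbb{C})\}$. *)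

theory Defs
  imports "HOL-Analysis.Analysis"
begin

type_synonym 'n cmat = "complex ^ 'n ^ 'n"

definition adj :: "'n::finite cmat \<Rightarrow> 'n cmat" where
  "adj A = (\<chi> i j. cnj (A $ j $ i))"

definition unitary :: "'n::finite cmat \<Rightarrow> bool" where
  "unitary U \<longleftrightarrow> adj U ** U = mat 1 \<and> U ** adj U = mat 1"

definition normal_matrix :: "'n::finite cmat \<Rightarrow> bool" where
  "normal_matrix A \<longleftrightarrow> adj A ** A = A ** adj A"

definition diag :: "('n::finite \<Rightarrow> complex) \<Rightarrow> 'n cmat" where
  "diag d = (\<chi> i j. if i = j then d i else 0)"

definition similarity_orbit :: "'n::finite cmat \<Rightarrow> 'n cmat set" where
  "similarity_orbit T = {g ** T ** matrix_inv g | g. invertible g}"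

definition diagonalizable :: "'n::finite cmat \<Rightarrow> bool" where
  "diagonalizable T \<longleftrightarrow> (\<exists>d. diag d \<in> similarity_orbit T)"

definition spectrum :: "'n::finite cmat \<Rightarrow> complex set" where
  "spectrum A = {l. \<not> invertible (mat l - A)}"

definition commutator :: "'n::finite cmat \<Rightarrow> 'n cmat \<Rightarrow> 'n cmat" where
  "commutator A B = A ** B - B ** A"

text \<open>Functional calculus \<open>f(A)\<close> for a Hermitian matrix \<open>A\<close>, through a unitary diagonalization
  with real eigenvalues. The result does not depend on the diagonalization; see
  \<open>hermitian_fun_diagonalized\<close> below. Nothing is claimed for \<open>A\<close> not Hermitian.\<close>

definition hermitian_fun :: "(real \<Rightarrow> real) \<Rightarrow> 'n::finite cmat \<Rightarrow> 'n cmat" where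
  "hermitian_fun f A = (THE B. \<exists>U (d :: 'n \<Rightarrow> real). unitary U \<and>
     A = U ** diag (\<lambda>i. of_real (d i)) ** adj U \<and>
     B = U ** diag (\<lambda>i. of_real (f (d i))) ** adj U)"

lemma matrix_mult_diag: "(A ** diag d) $ i $ j = A $ i $ j * d j"
  by (simp add: matrix_matrix_mult_def diag_def if_distrib cong: if_cong)

lemma diag_mult_matrix: "(diag d ** A) $ i $ j = d i * A $ i $ j"
  by (simp add: matrix_matrix_mult_def diag_def if_distrib if_distribR cong: if_cong)

lemma hermitian_fun_independent:
  assumes U: "unitary U" and V: "unitary V"
    and eq: "U ** diag (\<lambda>i. of_real (d i)) ** adj U = V ** diag (\<lambda>i. of_real (e i)) ** adj V"
  shows "U ** diag (\<lambda>i. of_real (f (d i))) ** adj U = V ** diag (\<lambda>i. of_real (f (e i))) ** adj V"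
proof -
  define W where "W = adj V ** U"
  have [simp]: "adj U ** U = mat 1" "adj V ** V = mat 1" "U ** adj U = mat 1" "V ** adj V = mat 1"
    using U V by (auto simp: unitary_def)
  have "adj V ** (U ** diag (\<lambda>i. of_real (d i)) ** adj U) ** U
      = adj V ** (V ** diag (\<lambda>i. of_real (e i)) ** adj V) ** U"
    by (simp only: eq)
  moreover have "adj V ** (U ** D ** adj U) ** U = W ** D" for D
    by (metis W_def \<open>adj U ** U = mat 1\<close> matrix_mul_assoc matrix_mul_rid)
  moreover have "adj V ** (V ** D ** adj V) ** U = D ** W" for D
    by (metis W_def \<open>adj V ** V = mat 1\<close> matrix_mul_assoc matrix_mul_lid)
  ultimately have WD: "W ** diag (\<lambda>i. of_real (d i)) = diag (\<lambda>i. of_real (e i)) ** W"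
    by simp
  have "W ** diag (\<lambda>i. of_real (f (d i))) = diag (\<lambda>i. of_real (f (e i))) ** W"
  proof -
    have "W $ i $ j * of_real (f (d j)) = of_real (f (e i)) * W $ i $ j" for i j
      using arg_cong[OF WD, of "\<lambda>M. M $ i $ j"]
      by (cases "W $ i $ j = 0") (auto simp: matrix_mult_diag diag_mult_matrix)
    then show ?thesis
      by (simp add: vec_eq_iff matrix_mult_diag diag_mult_matrix)
  qed
  then have "V ** (W ** diag (\<lambda>i. of_real (f (d i)))) ** adj U
      = V ** (diag (\<lambda>i. of_real (f (e i))) ** W) ** adj U"
    by simp
  moreover have "V ** (W ** D) ** adj U = U ** D ** adj U" for D
    by (metis W_def \<open>V ** adj V = mat 1\<close> matrix_mul_assoc matrix_mul_lid)
  moreover have "V ** (D ** W) ** adj U = V ** D ** adj V" for D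
    by (metis W_def \<open>U ** adj U = mat 1\<close> matrix_mul_assoc matrix_mul_rid)
  ultimately show ?thesis by simp
qed

lemma hermitian_fun_diagonalized:
  assumes "unitary U"
  shows "hermitian_fun f (U ** diag (\<lambda>i. of_real (d i)) ** adj U)
       = U ** diag (\<lambda>i. of_real (f (d i))) ** adj U"
  unfolding hermitian_fun_def
proof (rule the_equality)
  show "\<exists>U' (d' :: 'a \<Rightarrow> real). unitary U' \<and>
      U ** diag (\<lambda>i. of_real (d i)) ** adj U = U' ** diag (\<lambda>i. of_real (d' i)) ** adj U' \<and>
      U ** diag (\<lambda>i. of_real (f (d i))) ** adj U = U' ** diag (\<lambda>i. of_real (f (d' i))) ** adj U'"
    using assms by blast
qed (use assms hermitian_fun_independent in metis)

definition mat_abs :: "'n::finite cmat \<Rightarrow> 'n cmat" where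
  "mat_abs X = hermitian_fun sqrt (adj X ** X)"

definition mat_interval :: "real \<Rightarrow> real \<Rightarrow> 'n::finite cmat set" where
  "mat_interval a b = {X. spectrum (mat_abs X) \<subseteq> complex_of_real ` {a..b}}"

definition phi_mat :: "(real \<Rightarrow> real) \<Rightarrow> (real \<Rightarrow> real) \<Rightarrow> 'n::finite cmat \<Rightarrow> 'n cmat" where
  "phi_mat \<phi>1 \<phi>2 X = hermitian_fun \<phi>1 (mat_abs X) - hermitian_fun \<phi>2 (mat_abs (adj X))"

text \<open>Global solutions live on \<open>[0,\<infinity>)\<close> (one-sided derivative at 0) and stay in the set
  \<open>mat_interval a b\<close>; values at negative times are irrelevant.\<close>

definition flow_solution ::
    "real \<Rightarrow> real \<Rightarrow> (real \<Rightarrow> real) \<Rightarrow> (real \<Rightarrow> real) \<Rightarrow> 'n::finite cmat \<Rightarrow> (real \<Rightarrow> 'n cmat) \<Rightarrow> bool"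
  where
  "flow_solution a b \<phi>1 \<phi>2 T X \<longleftrightarrow>
     X 0 = T \<and> (\<forall>t\<ge>0. X t \<in> mat_interval a b) \<and>
     (\<forall>t\<ge>0. (X has_vector_derivative commutator (phi_mat \<phi>1 \<phi>2 (X t)) (X t)) (at t within {0..}))"

text \<open>The value at time \<open>t\<close> of the global solution starting at \<open>T\<close>. The description is applied
  to the value instead of the function, because a solution is only determined on \<open>[0,\<infinity>)\<close>.\<close>

definition phi_flow ::
    "real \<Rightarrow> real \<Rightarrow> (real \<Rightarrow> real) \<Rightarrow> (real \<Rightarrow> real) \<Rightarrow> real \<Rightarrow> 'n::finite cmat \<Rightarrow> 'n cmat" where
  "phi_flow a b \<phi>1 \<phi>2 t T = (THE Y. \<exists>X. flow_solution a b \<phi>1 \<phi>2 T X \<and> Y = X t)"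

end

theory Submission
  imports Defs
begin

text \<open>
Two facts about the flow carry the proof: it stays in one similarity orbit, and the energy
\<open>\<parallel>X\<parallel>\<^sup>2\<close> (Frobenius norm) decreases along it at a rate controlled by the defect of normality
\<open>D = X\<^sup>*X - XX\<^sup>*\<close>.

Existence. By a singular value decomposition \<open>X = U S V\<^sup>*\<close> one has
\<open>\<phi>(X) = V \<phi>\<^sub>1(S) V\<^sup>* - U \<phi>\<^sub>2(S) U\<^sup>*\<close>, and \<open>\<phi>\<close> is Lipschitz in the Frobenius norm. After extending
\<open>\<phi>\<^sub>1, \<phi>\<^sub>2\<close> by constants and retracting \<open>X\<close> to a ball, the vector field is globally Lipschitz, so
\<open>global_lipschitz_ode\<close> and \<open>ode_unique\<close> apply. The set \<open>mat_interval a b\<close> is invariant because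
the field points towards it: the distance to this set is attained by clamping the singular values,
and monotonicity of \<open>\<phi>\<^sub>1, \<phi>\<^sub>2\<close> gives the inner product with the field a sign
(\<open>flow_inward\<close>). Hence \<open>phi_flow\<close> really is a trajectory (\<open>phi_flow_solution\<close>). Solving the linear
equation \<open>g' = \<phi>(X) g\<close> shows \<open>X = g T g\<^sup>-\<^sup>1\<close> (\<open>isospectral_flow\<close>).

Dissipation. In the singular frame,
\<open>\<langle>X, [\<phi>(X), X]\<rangle>\<close> is a sum over pairs \<open>(s\<^sub>i, s\<^sub>j)\<close> of singular values with the doubly stochastic
weights \<open>\<bar>(V\<^sup>*U)\<^sub>i\<^sub>j\<bar>\<^sup>2\<close>. Every function of the form \<open>H(s\<^sub>i) - H(s\<^sub>j)\<close> sums to zero against these weights, and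
for a suitable potential \<open>H\<close> each summand is at most
\<open>H(s\<^sub>i) - H(s\<^sub>j) - \<kappa> (s\<^sub>i\<^sup>2 - s\<^sub>j\<^sup>2)\<^sup>2\<close> (\<open>pair_ineq\<close>), whence the energy decays at rate
\<open>2\<kappa> \<parallel>D\<parallel>\<^sup>2\<close>. The constant \<open>\<kappa>\<close> is uniform although \<open>\<phi>\<^sub>1' + \<phi>\<^sub>2'\<close> may vanish at \<open>0\<close>: on a bounded part
of the orbit of a diagonalizable matrix the nonzero singular values are bounded away from \<open>0\<close>
(\<open>singular_value_gap\<close>).

Rate. For diagonalizable \<open>T\<close> with eigenvalues \<open>\<lambda>\<^sub>i\<close> the energy gap
\<open>\<parallel>X\<parallel>\<^sup>2 - \<Sum>\<bar>\<lambda>\<^sub>i\<bar>\<^sup>2\<close> is bounded by a multiple of \<open>\<parallel>D\<parallel>\<^sup>2\<close> on bounded parts of the orbit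
(\<open>energy_gap\<close>): the spectral projections are polynomials in \<open>X\<close>, so they commute with their adjoints up
to \<open>O(\<parallel>D\<parallel>)\<close>, and an idempotent that almost commutes with its adjoint is almost Hermitian. Dissipation
and this inequality of Lojasiewicz type make the energy gap decay exponentially. As the
speed is at most a multiple of \<open>\<parallel>D\<parallel>\<close>, the trajectory converges exponentially
(\<open>gradient_like_convergence\<close>) to a limit with \<open>D = 0\<close>. The limit is in the orbit because the orbit of a
diagonalizable matrix is closed (\<open>diagonalizable_orbit_closed\<close>).
\<close>

section \<open>Frobenius geometry of complex matrices\<close>

lemma inner_complex_cnj: "x \<bullet> y = Re (cnj x * y)"
  by (simp add: inner_complex_def)

lemma matrix_inner_entries:
  "(A :: 'n::finite cmat) \<bullet> B = (\<Sum>i\<in>UNIV. \<Sum>j\<in>UNIV. Re (cnj (A $ i $ j) * B $ i $ j))"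
  by (simp add: inner_vec_def inner_complex_cnj)

lemma matrix_norm_sq:
  "(norm (A :: 'n::finite cmat))\<^sup>2 = (\<Sum>i\<in>UNIV. \<Sum>j\<in>UNIV. (cmod (A $ i $ j))\<^sup>2)"
  by (subst power2_norm_eq_inner, subst matrix_inner_entries) (simp add: cmod_power2 flip: power2_eq_square)

lemma adj_entry [simp]: "adj A $ i $ j = cnj (A $ j $ i)"
  by (simp add: adj_def)

lemma adj_adj [simp]: "adj (adj A) = A"
  by (simp add: vec_eq_iff)

lemma adj_mult: "adj (A ** B) = adj B ** adj A"
  by (simp add: vec_eq_iff matrix_matrix_mult_def mult.commute)

lemma adj_add: "adj (A + B) = adj A + adj B"
  and adj_diff: "adj (A - B) = adj A - adj B"
  and adj_scaleR: "adj (r *\<^sub>R A) = r *\<^sub>R adj A"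
  by (simp_all add: vec_eq_iff)

lemma adj_diag: "adj (diag d) = diag (\<lambda>i. cnj (d i))"
  by (simp add: vec_eq_iff diag_def)

lemma norm_adj [simp]: "norm (adj A) = norm A"
proof -
  have "(norm (adj A))\<^sup>2 = (norm A)\<^sup>2"
    unfolding matrix_norm_sq by (subst sum.swap) simp
  then show ?thesis by (simp add: power2_eq_iff_nonneg)
qed

lemma inner_mult_left_adj: "(A ** B) \<bullet> (C :: 'n::finite cmat) = B \<bullet> (adj A ** C)"
proof -
  have "(A ** B) \<bullet> C = (\<Sum>i\<in>UNIV. \<Sum>j\<in>UNIV. \<Sum>k\<in>UNIV. Re (cnj (A $ i $ k * B $ k $ j) * C $ i $ j))"
    unfolding matrix_inner_entries
    by (simp add: matrix_matrix_mult_def sum_distrib_right sum_subtractf)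
  also have "\<dots> = (\<Sum>i\<in>UNIV. \<Sum>k\<in>UNIV. \<Sum>j\<in>UNIV. Re (cnj (A $ i $ k * B $ k $ j) * C $ i $ j))"
    by (intro sum.cong refl sum.swap)
  also have "\<dots> = (\<Sum>k\<in>UNIV. \<Sum>i\<in>UNIV. \<Sum>j\<in>UNIV. Re (cnj (A $ i $ k * B $ k $ j) * C $ i $ j))"
    by (rule sum.swap)
  also have "\<dots> = (\<Sum>k\<in>UNIV. \<Sum>j\<in>UNIV. \<Sum>i\<in>UNIV. Re (cnj (A $ i $ k * B $ k $ j) * C $ i $ j))"
    by (intro sum.cong refl sum.swap)
  also have "\<dots> = (\<Sum>k\<in>UNIV. \<Sum>j\<in>UNIV. Re (cnj (B $ k $ j) * (\<Sum>i\<in>UNIV. cnj (A $ i $ k) * C $ i $ j)))"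
    by (intro sum.cong refl) (simp only: sum_distrib_left complex_cnj_mult Re_sum mult.assoc mult.left_commute)
  also have "\<dots> = B \<bullet> (adj A ** C)"
    unfolding matrix_inner_entries by (simp add: matrix_matrix_mult_def)
  finally show ?thesis .
qed

lemma inner_adj_adj: "adj A \<bullet> adj B = (A :: 'n::finite cmat) \<bullet> B"
proof -
  have "adj A \<bullet> adj B = (\<Sum>i\<in>UNIV. \<Sum>j\<in>UNIV. Re (cnj (A $ j $ i) * B $ j $ i))"
    unfolding matrix_inner_entries by simp
  also have "\<dots> = A \<bullet> B" unfolding matrix_inner_entries by (rule sum.swap)
  finally show ?thesis .
qed

lemma inner_mult_right_adj: "(A ** B) \<bullet> (C :: 'n::finite cmat) = A \<bullet> (C ** adj B)"
proof -
  have "(A ** B) \<bullet> C = (adj B ** adj A) \<bullet> adj C"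
    by (metis inner_adj_adj adj_mult)
  also have "\<dots> = adj A \<bullet> (B ** adj C)" by (simp add: inner_mult_left_adj)
  also have "\<dots> = A \<bullet> (C ** adj B)" by (metis inner_adj_adj adj_mult adj_adj)
  finally show ?thesis .
qed

lemma matrix_add_rdistrib: "((B :: 'n::finite cmat) + C) ** A = B ** A + C ** A"
  and matrix_diff_ldistrib: "(A :: 'n::finite cmat) ** (B - C) = A ** B - A ** C"
  and matrix_diff_rdistrib: "((B :: 'n::finite cmat) - C) ** A = B ** A - C ** A"
  and matrix_mult_scaleR_left: "(r *\<^sub>R (A :: 'n::finite cmat)) ** B = r *\<^sub>R (A ** B)"
  and matrix_mult_scaleR_right: "(A :: 'n::finite cmat) ** (r *\<^sub>R B) = r *\<^sub>R (A ** B)"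
  by (simp_all add: vec_eq_iff matrix_matrix_mult_def sum_subtractf sum.distrib algebra_simps scaleR_sum_right)

lemma norm_matrix_mult_le: "norm ((A :: 'n::finite cmat) ** (B :: 'n cmat)) \<le> norm A * norm B"
proof -
  have "(norm (A ** B))\<^sup>2 \<le> (\<Sum>i\<in>UNIV. \<Sum>j\<in>UNIV. (\<Sum>k\<in>UNIV. (cmod (A $ i $ k))\<^sup>2) * (\<Sum>k\<in>UNIV. (cmod (B $ k $ j))\<^sup>2))"
    unfolding matrix_norm_sq
  proof (intro sum_mono)
    fix i j
    have "cmod ((A ** B) $ i $ j) \<le> (\<Sum>k\<in>UNIV. cmod (A $ i $ k) * cmod (B $ k $ j))"
      unfolding matrix_matrix_mult_def by (simp add: norm_mult flip: norm_mult) (rule norm_sum)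
    then have "(cmod ((A ** B) $ i $ j))\<^sup>2 \<le> (\<Sum>k\<in>UNIV. cmod (A $ i $ k) * cmod (B $ k $ j))\<^sup>2"
      by (intro power_mono) auto
    also have "\<dots> \<le> (\<Sum>k\<in>UNIV. (cmod (A $ i $ k))\<^sup>2) * (\<Sum>k\<in>UNIV. (cmod (B $ k $ j))\<^sup>2)"
      by (rule Cauchy_Schwarz_ineq_sum)
    finally show "(cmod ((A ** B) $ i $ j))\<^sup>2 \<le> (\<Sum>k\<in>UNIV. (cmod (A $ i $ k))\<^sup>2) * (\<Sum>k\<in>UNIV. (cmod (B $ k $ j))\<^sup>2)" .
  qed
  also have "\<dots> = (norm A)\<^sup>2 * (\<Sum>j\<in>UNIV. \<Sum>k\<in>UNIV. (cmod (B $ k $ j))\<^sup>2)"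
    unfolding matrix_norm_sq by (simp add: sum_product)
  also have "\<dots> = (norm A * norm B)\<^sup>2"
    unfolding matrix_norm_sq power_mult_distrib by (subst sum.swap) simp
  finally show ?thesis
    by (rule power2_le_imp_le) simp
qed

text \<open>This puts limits, continuity, derivatives and finite sums of matrix products under the general theory of bounded bilinear maps.\<close>

lemma bounded_bilinear_matrix_mult: "bounded_bilinear ((**) :: 'n::finite cmat \<Rightarrow> 'n cmat \<Rightarrow> 'n cmat)"
  by (rule bounded_bilinear.intro)
     (auto simp: matrix_add_ldistrib matrix_add_rdistrib matrix_mult_scaleR_left matrix_mult_scaleR_right
        intro!: exI[of _ 1] norm_matrix_mult_le)

lemmas matrix_mult_tendsto = bounded_bilinear.tendsto[OF bounded_bilinear_matrix_mult]

lemmas matrix_mult_continuous_on = bounded_bilinear.continuous_on[OF bounded_bilinear_matrix_mult]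

lemmas matrix_mult_has_vector_derivative =
  bounded_bilinear.has_vector_derivative[OF bounded_bilinear_matrix_mult]

lemma bounded_linear_adj: "bounded_linear (adj :: 'n::finite cmat \<Rightarrow> 'n cmat)"
  by (rule bounded_linear_intro[where K=1]) (auto simp: adj_add adj_scaleR)

lemma norm_unitary_mult_left: "unitary U \<Longrightarrow> norm (U ** (A :: 'n::finite cmat)) = norm A"
  by (simp add: norm_eq_sqrt_inner inner_mult_left_adj matrix_mul_assoc unitary_def)

lemma norm_unitary_mult_right: "unitary U \<Longrightarrow> norm ((A :: 'n::finite cmat) ** U) = norm A"
  by (simp add: norm_eq_sqrt_inner inner_mult_right_adj flip: matrix_mul_assoc) (simp add: unitary_def)

lemma unitary_adj: "unitary U \<Longrightarrow> unitary (adj U)"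
  by (simp add: unitary_def)

lemma unitary_mult: "unitary U \<Longrightarrow> unitary V \<Longrightarrow> unitary (U ** V)"
  unfolding unitary_def adj_mult
  by (metis matrix_mul_assoc matrix_mul_lid)

lemma unitary_cancel:
  assumes "unitary U"
  shows "adj U ** U = mat 1" "U ** adj U = mat 1" "adj U ** (U ** A) = A" "U ** (adj U ** A) = A"
  using assms by (simp_all add: unitary_def matrix_mul_assoc)

lemma unitary_row_sum: "unitary U \<Longrightarrow> (\<Sum>j\<in>UNIV. (cmod (U $ i $ j))\<^sup>2) = 1"
proof -
  assume "unitary U"
  then have "(U ** adj U) $ i $ i = 1" by (simp add: unitary_def mat_def)
  then have "(\<Sum>j\<in>UNIV. U $ i $ j * cnj (U $ i $ j)) = 1" by (simp add: matrix_matrix_mult_def)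
  then have "complex_of_real (\<Sum>j\<in>UNIV. (cmod (U $ i $ j))\<^sup>2) = 1"
    by (simp only: of_real_sum complex_norm_square)
  then show ?thesis by (simp only: of_real_eq_1_iff)
qed

lemma unitary_col_sum: "unitary U \<Longrightarrow> (\<Sum>i\<in>UNIV. (cmod (U $ i $ j))\<^sup>2) = 1"
  using unitary_row_sum[OF unitary_adj, of U j] by simp

lemma diag_mult_diag: "diag c ** diag d = diag (\<lambda>i. c i * d i)"
  by (simp add: vec_eq_iff diag_mult_matrix) (simp add: diag_def)

lemma diag_add: "diag c + diag d = diag (\<lambda>i. c i + d i)"
  and diag_diff: "diag c - diag d = diag (\<lambda>i. c i - d i)"
  by (simp_all add: vec_eq_iff diag_def)

lemma mat_eq_diag: "mat c = diag (\<lambda>i. c)"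
  by (simp add: vec_eq_iff diag_def mat_def)

lemma mat_mult_entry: "(mat c ** (A :: 'n::finite cmat)) $ i $ j = c * A $ i $ j" "((A :: 'n::finite cmat) ** mat c) $ i $ j = A $ i $ j * c"
  unfolding mat_eq_diag by (simp_all add: matrix_mult_diag diag_mult_matrix)

lemma mat_central: "mat c ** (A :: 'n::finite cmat) = A ** mat c"
  by (simp add: vec_eq_iff mat_mult_entry mult.commute)

text \<open>Products of matrices written in matching orthonormal frames are computed on the diagonals.\<close>

lemma diag_frame_mult:
  assumes "unitary V"
  shows "U ** diag c ** adj V ** (V ** diag d ** Z) = U ** diag (\<lambda>i. c i * d i) ** Z"
  using assms
  by (simp add: unitary_cancel diag_mult_diag[symmetric] flip: matrix_mul_assoc)

lemma diag_frame_adj: "adj (U ** diag (\<lambda>i. complex_of_real (c i)) ** adj V) = V ** diag (\<lambda>i. of_real (c i)) ** adj U"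
  by (simp add: adj_mult adj_diag matrix_mul_assoc)

section \<open>Singular value decomposition\<close>

text \<open>The library inner product on \<open>complex ^ 'n\<close> is the real part of this form; complex orthogonality needs the imaginary part as well.\<close>

definition herm_inner :: "complex ^ 'n::finite \<Rightarrow> complex ^ 'n \<Rightarrow> complex" where
  "herm_inner x y = (\<Sum>i\<in>UNIV. cnj (x $ i) * y $ i)"

lemma herm_inner_add_right: "herm_inner x (y + z) = herm_inner x y + herm_inner x z"
  and herm_inner_diff_right: "herm_inner x (y - z) = herm_inner x y - herm_inner x z"
  and herm_inner_smult_left: "herm_inner (c *s x) y = cnj c * herm_inner x y"
  and herm_inner_scaleR_right: "herm_inner x (r *\<^sub>R y) = of_real r * herm_inner x y"
  by (simp_all add: herm_inner_def sum.distrib sum_subtractf sum_distrib_left algebra_simps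
      scaleR_conv_of_real[where 'a=complex])

lemma herm_inner_commute: "herm_inner y x = cnj (herm_inner x y)"
  by (simp add: herm_inner_def mult.commute)

lemma herm_inner_zero_right [simp]: "herm_inner x 0 = 0"
  by (simp add: herm_inner_def)

lemma Re_herm_inner: "Re (herm_inner x y) = x \<bullet> y"
  by (simp add: herm_inner_def inner_vec_def inner_complex_def)

lemma herm_inner_self: "herm_inner x x = of_real ((norm x)\<^sup>2)"
proof -
  have "Im (herm_inner x x) = 0"
    by (simp add: herm_inner_def)
  then show ?thesis
    by (simp add: complex_eq_iff Re_herm_inner power2_norm_eq_inner)
qed

lemma herm_inner_matrix_vector: "herm_inner (A *v x) y = herm_inner x (adj A *v y)"
proof -
  have "herm_inner (A *v x) y = (\<Sum>i\<in>UNIV. \<Sum>j\<in>UNIV. cnj (x $ j) * (cnj (A $ i $ j) * y $ i))"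
    by (simp add: herm_inner_def matrix_vector_mult_def sum_distrib_left sum_distrib_right mult_ac)
  also have "\<dots> = (\<Sum>j\<in>UNIV. \<Sum>i\<in>UNIV. cnj (x $ j) * (cnj (A $ i $ j) * y $ i))"
    by (rule sum.swap)
  also have "\<dots> = herm_inner x (adj A *v y)"
    by (simp add: herm_inner_def matrix_vector_mult_def sum_distrib_left)
  finally show ?thesis .
qed

lemma matrix_vector_scaleR: "(A :: 'n::finite cmat) *v (r *\<^sub>R x) = r *\<^sub>R (A *v x)"
  by (simp add: vec_eq_iff matrix_vector_mult_def scaleR_sum_right)

text \<open>Complex orthogonality to \<open>v\<close> is real orthogonality to \<open>v\<close> and \<open>\<i>v\<close>, so a count of real dimensions gives a common orthogonal vector.\<close>

lemma exists_herm_orthogonal: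
  fixes v :: "'n::finite \<Rightarrow> complex ^ 'n"
  assumes "I \<noteq> UNIV"
  shows "\<exists>x. norm x = 1 \<and> (\<forall>i\<in>I. herm_inner (v i) x = 0)"
proof -
  define S where "S = v ` I \<union> (\<lambda>i. \<i> *s v i) ` I"
  have "dim S \<le> card S" by (rule dim_le_card') (simp add: S_def)
  also have "\<dots> \<le> card I + card I"
    unfolding S_def by (intro order.trans[OF card_Un_le] add_mono card_image_le) auto
  also have "\<dots> < DIM(complex ^ 'n)"
    using psubset_card_mono[of UNIV I] assms by (auto simp: psubset_eq)
  finally obtain x where x: "x \<noteq> 0" "\<And>y. y \<in> span S \<Longrightarrow> orthogonal x y"
    by (rule orthogonal_to_subspace_exists) blast
  have "herm_inner (v i) x = 0" if "i \<in> I" for i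
  proof -
    have "v i \<bullet> x = 0" "(\<i> *s v i) \<bullet> x = 0"
      using x(2)[of "v i"] x(2)[of "\<i> *s v i"] that
      by (auto simp: S_def span_base orthogonal_def inner_commute)
    then show ?thesis
      by (simp add: complex_eq_iff herm_inner_smult_left flip: Re_herm_inner)
  qed
  then have "norm (inverse (norm x) *\<^sub>R x) = 1 \<and> (\<forall>i\<in>I. herm_inner (v i) (inverse (norm x) *\<^sub>R x) = 0)"
    using x(1) by (simp add: herm_inner_scaleR_right)
  then show ?thesis by blast
qed

lemma nonneg_quadratic_slope:
  fixes p c :: real
  assumes "\<And>t. 0 \<le> 2 * t * p + t\<^sup>2 * c" and "p \<ge> 0"
  shows "p = 0"
proof (rule ccontr)
  assume "p \<noteq> 0"
  define d where "d = \<bar>c\<bar> + 1"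
  have d: "d > 0" "c < d" by (auto simp: d_def)
  have "0 \<le> 2 * (- p / d) * p + (- p / d)\<^sup>2 * c" by (rule assms)
  also have "\<dots> = p\<^sup>2 / d * (c / d - 2)"
    using d by (simp add: field_simps power2_eq_square)
  also have "\<dots> < 0"
    using d \<open>p \<noteq> 0\<close> by (intro mult_pos_neg divide_pos_pos) (auto simp: field_simps)
  finally show False by simp
qed

text \<open>The next right singular vector: maximize \<open>\<parallel>Xw\<parallel>\<close> over unit vectors orthogonal to those already found. The orthogonal complement is invariant under \<open>X\<^sup>*X\<close>, so the maximizer is an eigenvector.\<close>

lemma exists_singular_vector:
  fixes X :: "'n::finite cmat" and v :: "'n \<Rightarrow> complex ^ 'n"
  assumes "I \<noteq> UNIV"
    and inv: "\<And>i. i \<in> I \<Longrightarrow> \<exists>c. adj X *v (X *v v i) = c *s v i"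
  shows "\<exists>x s. norm x = 1 \<and> (\<forall>i\<in>I. herm_inner (v i) x = 0) \<and> 0 \<le> s \<and> norm (X *v x) = s \<and>
    adj X *v (X *v x) = s\<^sup>2 *\<^sub>R x \<and>
    (\<forall>w. (\<forall>i\<in>I. herm_inner (v i) w = 0) \<longrightarrow> norm (X *v w) \<le> s * norm w)"
proof -
  define W where "W = {w. \<forall>i\<in>I. herm_inner (v i) w = 0}"
  define K where "K = sphere 0 1 \<inter> W"
  have "closed W"
  proof -
    have "W = (\<Inter>i\<in>I. {w. herm_inner (v i) w = 0})" by (auto simp: W_def)
    moreover have "closed {w. herm_inner (v i) w = 0}" for i
      unfolding herm_inner_def by (intro closed_Collect_eq continuous_intros)
    ultimately show ?thesis by auto
  qed
  then have "compact K" unfolding K_def by (intro compact_Int_closed) auto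
  moreover have "K \<noteq> {}"
    using exists_herm_orthogonal[OF assms(1), of v] by (auto simp: K_def W_def)
  moreover have "continuous_on K (\<lambda>x. norm (X *v x))"
    unfolding matrix_vector_mult_def by (intro continuous_intros)
  ultimately obtain x where x: "x \<in> K" and max: "\<And>y. y \<in> K \<Longrightarrow> norm (X *v y) \<le> norm (X *v x)"
    using continuous_attains_sup by metis
  define s where "s = norm (X *v x)"
  have bound: "norm (X *v w) \<le> s * norm w" if "w \<in> W" for w
  proof (cases "w = 0")
    case False
    then have "inverse (norm w) *\<^sub>R w \<in> K"
      using that by (simp add: K_def W_def herm_inner_scaleR_right)
    from max[OF this] have "inverse (norm w) * norm (X *v w) \<le> s"
      by (simp add: s_def matrix_vector_scaleR)
    then show ?thesis using False by (simp add: field_simps)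
  qed simp
  have xW: "x \<in> W" and nx: "norm x = 1" using x by (auto simp: K_def)
  \<comment> \<open>The form \<open>s\<^sup>2\<parallel>w\<parallel>\<^sup>2 - \<parallel>Xw\<parallel>\<^sup>2\<close> is nonnegative on \<open>W\<close> and vanishes at \<open>x\<close>; its half gradient \<open>z\<close> at \<open>x\<close>
    lies in \<open>W\<close>, so it may serve as a test direction and must be zero.\<close>
  define z where "z = s\<^sup>2 *\<^sub>R x - adj X *v (X *v x)"
  have zW: "z \<in> W"
  proof -
    have "herm_inner (v i) (adj X *v (X *v x)) = 0" if i: "i \<in> I" for i
    proof -
      obtain c where c: "adj X *v (X *v v i) = c *s v i" using inv[OF i] by blast
      have "herm_inner (v i) (adj X *v (X *v x)) = herm_inner (adj X *v (X *v v i)) x"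
        by (metis herm_inner_matrix_vector adj_adj)
      then show ?thesis using xW i by (simp add: c herm_inner_smult_left W_def)
    qed
    then show ?thesis
      using xW by (simp add: z_def W_def herm_inner_diff_right herm_inner_scaleR_right)
  qed
  have "z \<bullet> z = 0"
  proof (rule nonneg_quadratic_slope)
    fix t :: real
    have "x + t *\<^sub>R z \<in> W"
      using xW zW by (simp add: W_def herm_inner_add_right herm_inner_scaleR_right)
    then have "(norm (X *v (x + t *\<^sub>R z)))\<^sup>2 \<le> (s * norm (x + t *\<^sub>R z))\<^sup>2"
      by (intro power_mono bound) auto
    then have 1: "(X *v x) \<bullet> (X *v x) + 2 * t * ((X *v x) \<bullet> (X *v z)) + t\<^sup>2 * ((X *v z) \<bullet> (X *v z))
        \<le> s\<^sup>2 * (x \<bullet> x + 2 * t * (x \<bullet> z) + t\<^sup>2 * (z \<bullet> z))"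
      unfolding power_mult_distrib power2_norm_eq_inner matrix_vector_right_distrib matrix_vector_scaleR
      by (simp add: inner_add_left inner_add_right inner_commute[of z x]
          inner_commute[of "X *v z" "X *v x"] power2_eq_square algebra_simps)
    have 2: "(X *v x) \<bullet> (X *v x) = s\<^sup>2" "x \<bullet> x = 1"
      using nx by (simp_all add: s_def power2_norm_eq_inner norm_eq_1)
    have "(X *v x) \<bullet> (X *v z) = (adj X *v (X *v x)) \<bullet> z"
      by (metis Re_herm_inner herm_inner_matrix_vector adj_adj)
    then have 3: "s\<^sup>2 * (x \<bullet> z) - (X *v x) \<bullet> (X *v z) = z \<bullet> z"
      by (simp add: z_def inner_diff_left)
    have "2 * t * (z \<bullet> z) + t\<^sup>2 * (s\<^sup>2 * (z \<bullet> z) - (X *v z) \<bullet> (X *v z))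
      = s\<^sup>2 * (x \<bullet> x + 2 * t * (x \<bullet> z) + t\<^sup>2 * (z \<bullet> z)) -
        ((X *v x) \<bullet> (X *v x) + 2 * t * ((X *v x) \<bullet> (X *v z)) + t\<^sup>2 * ((X *v z) \<bullet> (X *v z)))"
      unfolding 2 3[symmetric] by (simp add: algebra_simps)
    with 1 show "0 \<le> 2 * t * (z \<bullet> z) + t\<^sup>2 * (s\<^sup>2 * (z \<bullet> z) - (X *v z) \<bullet> (X *v z))"
      by linarith
  qed simp
  then have "adj X *v (X *v x) = s\<^sup>2 *\<^sub>R x" by (simp add: z_def)
  then show ?thesis
    using nx xW bound by (intro exI[of _ x] exI[of _ s]) (auto simp: s_def W_def)
qed

text \<open>Singular vectors are indexed by a subset of the index type of the matrix, so that induction over subsets ends with two full orthonormal bases.\<close>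

lemma partial_svd:
  fixes X :: "'n::finite cmat" and I :: "'n set"
  shows "\<exists>u v :: 'n \<Rightarrow> complex ^ 'n. \<exists>s :: 'n \<Rightarrow> real. 
     (\<forall>i\<in>I. \<forall>j\<in>I. herm_inner (v i) (v j) = (if i = j then 1 else 0)) \<and>
     (\<forall>i\<in>I. \<forall>j\<in>I. herm_inner (u i) (u j) = (if i = j then 1 else 0)) \<and>
     (\<forall>i\<in>I. 0 \<le> s i \<and> X *v v i = s i *\<^sub>R u i \<and> adj X *v u i = s i *\<^sub>R v i)"
  using finite[of I]
proof (induction I rule: finite_induct)
  case (insert k I)
  then obtain u v s where
      v: "\<And>i j. i \<in> I \<Longrightarrow> j \<in> I \<Longrightarrow> herm_inner (v i) (v j) = (if i = j then 1 else 0)"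
    and u: "\<And>i j. i \<in> I \<Longrightarrow> j \<in> I \<Longrightarrow> herm_inner (u i) (u j) = (if i = j then 1 else 0)"
    and s: "\<And>i. i \<in> I \<Longrightarrow> 0 \<le> s i" "\<And>i. i \<in> I \<Longrightarrow> X *v v i = s i *\<^sub>R u i"
      "\<And>i. i \<in> I \<Longrightarrow> adj X *v u i = s i *\<^sub>R v i"
    by blast
  have I: "I \<noteq> UNIV" using insert by auto
  have eigen: "\<exists>c. adj X *v (X *v v i) = c *s v i" if "i \<in> I" for i
    using that by (intro exI[of _ "of_real ((s i)\<^sup>2)"])
      (simp add: s matrix_vector_scaleR vec_eq_iff power2_eq_square scaleR_conv_of_real[where 'a=complex])
  from exists_singular_vector[where v=v, OF I eigen] obtain x r where
    x: "norm x = 1" "\<And>i. i \<in> I \<Longrightarrow> herm_inner (v i) x = 0" and r: "0 \<le> r" "norm (X *v x) = r"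
    and xx: "adj X *v (X *v x) = r\<^sup>2 *\<^sub>R x"
    and bd: "\<And>w. (\<And>i. i\<in>I \<Longrightarrow> herm_inner (v i) w = 0) \<Longrightarrow> norm (X *v w) \<le> r * norm w"
    by blast
  have "\<exists>y. norm y = 1 \<and> (\<forall>i\<in>I. herm_inner (u i) y = 0) \<and> X *v x = r *\<^sub>R y \<and> adj X *v y = r *\<^sub>R x"
  proof (cases "r = 0")
    case False
    define y where "y = inverse r *\<^sub>R (X *v x)"
    have "herm_inner (u i) (X *v x) = 0" if "i \<in> I" for i
    proof -
      have "herm_inner (u i) (X *v x) = herm_inner (adj X *v u i) x"
        by (metis herm_inner_matrix_vector adj_adj)
      also have "\<dots> = cnj (of_real (s i) * herm_inner x (v i))"
        by (subst herm_inner_commute) (simp add: s that herm_inner_scaleR_right)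
      also have "\<dots> = 0" using x(2)[OF that] by (subst herm_inner_commute) simp
      finally show ?thesis .
    qed
    then show ?thesis using False r xx
      by (intro exI[of _ y])
        (auto simp: y_def herm_inner_scaleR_right matrix_vector_scaleR power2_eq_square)
  next
    case True
    \<comment> \<open>Now \<open>X\<close> vanishes on the complement of the \<open>v i\<close>, and any unit vector orthogonal to the \<open>u i\<close> will do.\<close>
    obtain y where y: "norm y = 1" "\<And>i. i \<in> I \<Longrightarrow> herm_inner (u i) y = 0"
      using exists_herm_orthogonal[OF I, of u] by blast
    have "herm_inner (v i) (adj X *v y) = 0" if "i \<in> I" for i
    proof -
      have "herm_inner (v i) (adj X *v y) = herm_inner (X *v v i) y"
        by (simp add: herm_inner_matrix_vector)
      also have "\<dots> = cnj (of_real (s i) * herm_inner y (u i))"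
        by (subst herm_inner_commute) (simp add: s that herm_inner_scaleR_right)
      also have "\<dots> = 0" using y(2)[OF that] by (subst herm_inner_commute) simp
      finally show ?thesis .
    qed
    then have "X *v (adj X *v y) = 0" using bd[of "adj X *v y"] True by simp
    then have "herm_inner (adj X *v y) (adj X *v y) = 0"
      by (simp add: herm_inner_matrix_vector)
    then have "adj X *v y = 0" by (simp add: herm_inner_self)
    then show ?thesis using y True r by auto
  qed
  then obtain y where y: "norm y = 1" "\<And>i. i \<in> I \<Longrightarrow> herm_inner (u i) y = 0"
    "X *v x = r *\<^sub>R y" "adj X *v y = r *\<^sub>R x" by blast
  have x': "herm_inner x (v i) = 0" if "i \<in> I" for i
    using x(2)[OF that] by (subst herm_inner_commute) simp
  have y': "herm_inner y (u i) = 0" if "i \<in> I" for i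
    using y(2)[OF that] by (subst herm_inner_commute) simp
  have xx1: "herm_inner x x = 1" and yy1: "herm_inner y y = 1"
    using x(1) y(1) by (simp_all add: herm_inner_self)
  have "(\<forall>i\<in>insert k I. \<forall>j\<in>insert k I. herm_inner ((v(k := x)) i) ((v(k := x)) j) = (if i = j then 1 else 0)) \<and>
     (\<forall>i\<in>insert k I. \<forall>j\<in>insert k I. herm_inner ((u(k := y)) i) ((u(k := y)) j) = (if i = j then 1 else 0)) \<and>
     (\<forall>i\<in>insert k I. 0 \<le> (s(k := r)) i \<and> X *v (v(k := x)) i = (s(k := r)) i *\<^sub>R (u(k := y)) i \<and>
        adj X *v (u(k := y)) i = (s(k := r)) i *\<^sub>R (v(k := x)) i)"
    using insert(2) u v s x y x' y' r(1) xx1 yy1 by auto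
  then show ?case by (intro exI)
qed auto

abbreviation rdiag :: "('n::finite \<Rightarrow> real) \<Rightarrow> 'n cmat" where
  "rdiag s \<equiv> diag (\<lambda>i. complex_of_real (s i))"

definition svd :: "'n::finite cmat \<Rightarrow> 'n cmat \<Rightarrow> ('n \<Rightarrow> real) \<Rightarrow> 'n cmat \<Rightarrow> bool" where
  "svd X U s V \<longleftrightarrow> unitary U \<and> unitary V \<and> (\<forall>i. 0 \<le> s i) \<and> X = U ** rdiag s ** adj V"

lemma unitary_if_orthonormal_columns:
  fixes u :: "'n::finite \<Rightarrow> complex ^ 'n"
  assumes "\<And>i j. herm_inner (u i) (u j) = (if i = j then 1 else 0)"
  shows "unitary (\<chi> i j. u j $ i)"
proof -
  have "adj (\<chi> i j. u j $ i) ** (\<chi> i j. u j $ i) = mat 1"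
    using assms by (simp add: vec_eq_iff matrix_matrix_mult_def mat_def herm_inner_def)
  then show ?thesis unfolding unitary_def using matrix_left_right_inverse by blast
qed

theorem svd_exists:
  fixes X :: "'n::finite cmat"
  shows "\<exists>U s V. svd X U s V"
proof -
  obtain u v :: "'n \<Rightarrow> complex ^ 'n" and s :: "'n \<Rightarrow> real" where
      v: "\<forall>i j. herm_inner (v i) (v j) = (if i = j then 1 else 0)"
    and u: "\<forall>i j. herm_inner (u i) (u j) = (if i = j then 1 else 0)"
    and s: "\<forall>i. 0 \<le> s i \<and> X *v v i = s i *\<^sub>R u i \<and> adj X *v u i = s i *\<^sub>R v i"
    using partial_svd[of UNIV X] by (simp only: ball_UNIV) blast
  define U V where "U = (\<chi> i j. u j $ i)" and "V = (\<chi> i j. v j $ i)"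
  have UV: "unitary U" "unitary V"
    using u v by (simp_all add: U_def V_def unitary_if_orthonormal_columns)
  have "X ** V = U ** rdiag s"
  proof -
    have "(X ** V) $ i $ j = (X *v v j) $ i" for i j
      by (simp add: V_def matrix_matrix_mult_def matrix_vector_mult_def)
    then show ?thesis
      by (simp add: vec_eq_iff matrix_mult_diag s U_def scaleR_conv_of_real[where 'a=complex] mult.commute)
  qed
  then have "X = U ** rdiag s ** adj V"
    using UV(2) by (metis unitary_def matrix_mul_assoc matrix_mul_rid)
  then have "svd X U s V" using UV s unfolding svd_def by blast
  then show ?thesis by blast
qed

section \<open>Singular values, functional calculus and Lipschitz bounds\<close>

lemma svd_adj: "svd X U s V \<Longrightarrow> svd (adj X) V s U"
  by (simp add: svd_def diag_frame_adj)

lemma svd_adj_mult_self: "svd X U s V \<Longrightarrow> adj X ** X = V ** rdiag (\<lambda>i. (s i)\<^sup>2) ** adj V"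
  using diag_frame_mult[of U V "\<lambda>i. of_real (s i)" "\<lambda>i. of_real (s i)" "adj V"]
  by (auto simp: svd_def diag_frame_adj power2_eq_square)

lemma svd_mat_abs:
  assumes "svd X U s V"
  shows "mat_abs X = V ** rdiag s ** adj V"
proof -
  have "mat_abs X = V ** rdiag (\<lambda>i. sqrt ((s i)\<^sup>2)) ** adj V"
    using assms unfolding mat_abs_def svd_adj_mult_self[OF assms] svd_def
    by (subst hermitian_fun_diagonalized) auto
  then show ?thesis using assms by (simp add: svd_def)
qed

lemma svd_phi_mat:
  assumes "svd X U s V"
  shows "phi_mat f g X = V ** rdiag (\<lambda>i. f (s i)) ** adj V - U ** rdiag (\<lambda>i. g (s i)) ** adj U"
  unfolding phi_mat_def svd_mat_abs[OF assms] svd_mat_abs[OF svd_adj[OF assms]]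
  using assms by (simp add: svd_def hermitian_fun_diagonalized)

lemma invertible_diag_iff: "invertible (diag d) \<longleftrightarrow> (\<forall>i. d i \<noteq> 0)"
proof
  assume "invertible (diag d)"
  then obtain B where B: "diag d ** B = mat 1" unfolding invertible_def by blast
  have "d i * B $ i $ i = 1" for i
    using arg_cong[OF B, of "\<lambda>M. M $ i $ i"] by (simp add: diag_mult_matrix mat_def)
  then show "\<forall>i. d i \<noteq> 0" by (metis mult_zero_left zero_neq_one)
next
  assume "\<forall>i. d i \<noteq> 0"
  then have "diag d ** diag (\<lambda>i. inverse (d i)) = mat 1" "diag (\<lambda>i. inverse (d i)) ** diag d = mat 1"
    by (simp_all add: diag_mult_diag mat_eq_diag)
  then show "invertible (diag d)" unfolding invertible_def by blast
qed

lemma unitary_invertible: "unitary U \<Longrightarrow> invertible U"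
  by (auto simp: unitary_def invertible_def)

lemma invertible_unitary_frame:
  assumes "unitary V"
  shows "invertible (V ** D ** adj V) \<longleftrightarrow> invertible D"
proof
  assume "invertible (V ** D ** adj V)"
  then have "invertible (adj V ** (V ** D ** adj V) ** V)"
    using assms invertible_mult unitary_adj unitary_invertible by blast
  moreover have "adj V ** (V ** D ** adj V) ** V = D"
    using assms by (simp add: unitary_cancel flip: matrix_mul_assoc)
  ultimately show "invertible D" by simp
next
  assume "invertible D"
  then show "invertible (V ** D ** adj V)"
    using assms invertible_mult unitary_adj unitary_invertible by blast
qed

text \<open>The spectrum of \<open>\<bar>X\<bar>\<close> is the set of singular values, for any choice of the decomposition.\<close>

lemma mat_interval_iff:
  assumes "svd X U s V"
  shows "X \<in> mat_interval a b \<longleftrightarrow> (\<forall>i. s i \<in> {a..b})"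
proof -
  have V: "unitary V" using assms by (simp add: svd_def)
  have "mat l - mat_abs X = V ** diag (\<lambda>i. l - of_real (s i)) ** adj V" for l
  proof -
    have "V ** diag (\<lambda>i. l) ** adj V = mat l"
      using V by (simp add: unitary_cancel mat_central flip: mat_eq_diag matrix_mul_assoc)
    then show ?thesis
      unfolding svd_mat_abs[OF assms] diag_diff[symmetric]
      by (simp add: matrix_diff_ldistrib matrix_diff_rdistrib)
  qed
  then have "spectrum (mat_abs X) = complex_of_real ` range s"
    using V by (auto simp: spectrum_def invertible_unitary_frame invertible_diag_iff)
  then show ?thesis
    by (simp only: mat_interval_def mem_Collect_eq inj_image_subset_iff[OF inj_of_real]) (simp add: image_subset_iff)
qed

text \<open>The norm is unchanged when the difference is read in the left frame of the second matrix and the right frame of the first; there it becomes an explicit matrix of overlaps.\<close>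

lemma frame_diff_entries:
  fixes U V U' V' :: "'n::finite cmat"
  assumes "unitary U" "unitary V" "unitary U'" "unitary V'"
  shows "(norm (U ** diag s ** adj V - U' ** diag s' ** adj V'))\<^sup>2 =
    (\<Sum>i\<in>UNIV. \<Sum>j\<in>UNIV. (cmod ((adj U' ** U) $ i $ j * s j - s' i * (adj V' ** V) $ i $ j))\<^sup>2)"
proof -
  define M where "M = U ** diag s ** adj V - U' ** diag s' ** adj V'"
  have "adj U' ** M ** V = adj U' ** U ** diag s - diag s' ** (adj V' ** V)"
    using assms unfolding M_def
    by (simp add: matrix_diff_ldistrib matrix_diff_rdistrib unitary_cancel flip: matrix_mul_assoc)
  moreover have "norm M = norm (adj U' ** M ** V)"
    using assms by (simp add: norm_unitary_mult_left norm_unitary_mult_right unitary_adj)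
  ultimately show ?thesis
    by (simp add: M_def matrix_norm_sq matrix_mult_diag diag_mult_matrix)
qed

lemma frame_diff_same:
  fixes U V :: "'n::finite cmat"
  assumes "unitary U" "unitary V"
  shows "(norm (V ** rdiag f ** adj V - U ** rdiag g ** adj U))\<^sup>2 =
    (\<Sum>i\<in>UNIV. \<Sum>j\<in>UNIV. (cmod ((adj U ** V) $ i $ j))\<^sup>2 * (f j - g i)\<^sup>2)"
  unfolding frame_diff_entries[OF assms(2,2) assms(1,1)]
proof (intro sum.cong refl)
  fix i j
  have "(adj U ** V) $ i $ j * of_real (f j) - of_real (g i) * (adj U ** V) $ i $ j
      = (adj U ** V) $ i $ j * of_real (f j - g i)" by (simp add: algebra_simps)
  then show "(cmod ((adj U ** V) $ i $ j * of_real (f j) - of_real (g i) * (adj U ** V) $ i $ j))\<^sup>2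
     = (cmod ((adj U ** V) $ i $ j))\<^sup>2 * (f j - g i)\<^sup>2"
    by (simp only: norm_mult power_mult_distrib norm_of_real power2_abs)
qed

text \<open>The two sides differ by \<open>2 s t \<bar>p - q\<bar>\<^sup>2\<close>.\<close>

lemma singular_pair_ineq:
  fixes p q :: complex and s t :: real
  assumes "s \<ge> 0" "t \<ge> 0"
  shows "((cmod p)\<^sup>2 + (cmod q)\<^sup>2) * (s - t)\<^sup>2 \<le> (cmod (p * s - t * q))\<^sup>2 + (cmod (q * s - t * p))\<^sup>2"
proof -
  have "(cmod (p * s - t * q))\<^sup>2 + (cmod (q * s - t * p))\<^sup>2 - ((cmod p)\<^sup>2 + (cmod q)\<^sup>2) * (s - t)\<^sup>2
    = 2 * s * t * (cmod (p - q))\<^sup>2"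
    unfolding cmod_power2 by (simp add: power2_eq_square algebra_simps)
  also have "\<dots> \<ge> 0" using assms by simp
  finally show ?thesis by simp
qed

text \<open>Apply the pair inequality entrywise to the overlaps of both frames, writing \<open>\<parallel>X - Y\<parallel>\<close> once directly and once through the adjoints. This bounds distances of singular values by the distance of matrices without any ordering of the singular values; it gives both the Lipschitz bound for the functional calculus and the nearest point in \<open>mat_interval\<close>.\<close>

lemma svd_distance_ineq:
  fixes X Y :: "'n::finite cmat"
  assumes X: "svd X U s V" and Y: "svd Y U' s' V'"
  shows "(\<Sum>i\<in>UNIV. \<Sum>j\<in>UNIV. ((cmod ((adj U' ** U) $ i $ j))\<^sup>2 + (cmod ((adj V' ** V) $ i $ j))\<^sup>2) * (s j - s' i)\<^sup>2)
     \<le> 2 * (norm (X - Y))\<^sup>2"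
proof -
  have u: "unitary U" "unitary V" "unitary U'" "unitary V'" using X Y by (auto simp: svd_def)
  let ?P = "adj U' ** U" and ?Q = "adj V' ** V"
  have 1: "(norm (X - Y))\<^sup>2 = (\<Sum>i\<in>UNIV. \<Sum>j\<in>UNIV. (cmod (?P $ i $ j * s j - s' i * ?Q $ i $ j))\<^sup>2)"
    using X Y frame_diff_entries[OF u] by (simp add: svd_def)
  have 2: "(norm (X - Y))\<^sup>2 = (\<Sum>i\<in>UNIV. \<Sum>j\<in>UNIV. (cmod (?Q $ i $ j * s j - s' i * ?P $ i $ j))\<^sup>2)"
  proof -
    have "norm (X - Y) = norm (adj X - adj Y)" by (metis adj_diff norm_adj)
    then show ?thesis
      using svd_adj[OF X] svd_adj[OF Y] frame_diff_entries[OF u(2,1,4,3)] by (simp add: svd_def)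
  qed
  have "2 * (norm (X - Y))\<^sup>2 = (\<Sum>i\<in>UNIV. \<Sum>j\<in>UNIV. (cmod (?P $ i $ j * s j - s' i * ?Q $ i $ j))\<^sup>2 +
      (cmod (?Q $ i $ j * s j - s' i * ?P $ i $ j))\<^sup>2)"
    unfolding sum.distrib 1[symmetric] 2[symmetric] by simp
  moreover have "0 \<le> s i" "0 \<le> s' i" for i using X Y by (auto simp: svd_def)
  ultimately show ?thesis
    by (simp only:) (intro sum_mono singular_pair_ineq)
qed

lemma hermitian_part_lipschitz:
  fixes X Y :: "'n::finite cmat"
  assumes X: "svd X U s V" and Y: "svd Y U' s' V'"
    and L: "\<And>x y. 0 \<le> x \<Longrightarrow> 0 \<le> y \<Longrightarrow> \<bar>f x - f y\<bar> \<le> L * \<bar>x - y\<bar>" "L \<ge> 0"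
  shows "norm (V ** rdiag (\<lambda>i. f (s i)) ** adj V - V' ** rdiag (\<lambda>i. f (s' i)) ** adj V') \<le> 2 * L * norm (X - Y)"
proof -
  have u: "unitary U" "unitary V" "unitary U'" "unitary V'" using X Y by (auto simp: svd_def)
  have pos: "0 \<le> s i" "0 \<le> s' i" for i using X Y by (auto simp: svd_def)
  have "(norm (V ** rdiag (\<lambda>i. f (s i)) ** adj V - V' ** rdiag (\<lambda>i. f (s' i)) ** adj V'))\<^sup>2
    = (\<Sum>i\<in>UNIV. \<Sum>j\<in>UNIV. (cmod ((adj V' ** V) $ i $ j))\<^sup>2 * (f (s j) - f (s' i))\<^sup>2)"
    by (rule frame_diff_same[OF u(4,2)])
  also have "\<dots> \<le> (\<Sum>i\<in>UNIV. \<Sum>j\<in>UNIV. L\<^sup>2 * (((cmod ((adj U' ** U) $ i $ j))\<^sup>2 + (cmod ((adj V' ** V) $ i $ j))\<^sup>2) * (s j - s' i)\<^sup>2))"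
  proof (intro sum_mono)
    fix i j
    have "\<bar>f (s j) - f (s' i)\<bar>\<^sup>2 \<le> (L * \<bar>s j - s' i\<bar>)\<^sup>2"
      by (intro power_mono L pos) auto
    then have "(f (s j) - f (s' i))\<^sup>2 \<le> L\<^sup>2 * (s j - s' i)\<^sup>2" by (simp add: power_mult_distrib)
    then have "(cmod ((adj V' ** V) $ i $ j))\<^sup>2 * (f (s j) - f (s' i))\<^sup>2
        \<le> ((cmod ((adj U' ** U) $ i $ j))\<^sup>2 + (cmod ((adj V' ** V) $ i $ j))\<^sup>2) * (L\<^sup>2 * (s j - s' i)\<^sup>2)"
      by (intro mult_mono) auto
    then show "(cmod ((adj V' ** V) $ i $ j))\<^sup>2 * (f (s j) - f (s' i))\<^sup>2
        \<le> L\<^sup>2 * (((cmod ((adj U' ** U) $ i $ j))\<^sup>2 + (cmod ((adj V' ** V) $ i $ j))\<^sup>2) * (s j - s' i)\<^sup>2)"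
      by (simp add: mult_ac)
  qed
  also have "\<dots> \<le> L\<^sup>2 * (2 * (norm (X - Y))\<^sup>2)"
    unfolding sum_distrib_left[symmetric] by (intro mult_left_mono svd_distance_ineq[OF X Y]) auto
  also have "\<dots> \<le> (2 * L * norm (X - Y))\<^sup>2"
    using mult_nonneg_nonneg[of "L\<^sup>2" "(norm (X - Y))\<^sup>2"] by (simp add: power_mult_distrib)
  finally show ?thesis
    by (rule power2_le_imp_le) (use L in auto)
qed

lemma phi_mat_lipschitz:
  fixes X Y :: "'n::finite cmat"
  assumes "\<And>x y. 0 \<le> x \<Longrightarrow> 0 \<le> y \<Longrightarrow> \<bar>f x - f y\<bar> \<le> L * \<bar>x - y\<bar>"
    and "\<And>x y. 0 \<le> x \<Longrightarrow> 0 \<le> y \<Longrightarrow> \<bar>g x - g y\<bar> \<le> L * \<bar>x - y\<bar>" and "L \<ge> 0"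
  shows "norm (phi_mat f g X - phi_mat f g Y) \<le> 4 * L * norm (X - Y)"
proof -
  obtain U s V where X: "svd X U s V" using svd_exists by blast
  obtain U' s' V' where Y: "svd Y U' s' V'" using svd_exists by blast
  have "norm (X - Y) = norm (adj X - adj Y)" by (metis adj_diff norm_adj)
  then have "norm (U ** rdiag (\<lambda>i. g (s i)) ** adj U - U' ** rdiag (\<lambda>i. g (s' i)) ** adj U') \<le> 2 * L * norm (X - Y)"
    using hermitian_part_lipschitz[OF svd_adj[OF X] svd_adj[OF Y], of g L] assms by simp
  moreover note hermitian_part_lipschitz[OF X Y assms(1,3)]
  moreover have "phi_mat f g X - phi_mat f g Y =
     (V ** rdiag (\<lambda>i. f (s i)) ** adj V - V' ** rdiag (\<lambda>i. f (s' i)) ** adj V')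
   - (U ** rdiag (\<lambda>i. g (s i)) ** adj U - U' ** rdiag (\<lambda>i. g (s' i)) ** adj U')"
    by (simp add: svd_phi_mat[OF X] svd_phi_mat[OF Y])
  moreover have "norm (A - B) \<le> 4 * L * r" if "norm A \<le> 2 * L * r" "norm B \<le> 2 * L * r" for A B :: "'n cmat" and r
    using norm_triangle_ineq4[of A B] that by linarith
  ultimately show ?thesis by simp
qed

section \<open>Ordinary differential equations on the half-line\<close>

lemma integral_has_vector_derivative_halfline:
  fixes h :: "real \<Rightarrow> 'a::banach"
  assumes "continuous_on {0..} h" "0 \<le> u"
  shows "((\<lambda>u. integral {0..u} h) has_vector_derivative h u) (at u within {0..})"
proof -
  have "((\<lambda>u. integral {0..u} h) has_vector_derivative h u) (at u within {0..u+1})"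
    using assms by (intro integral_has_vector_derivative) (auto intro: continuous_on_subset)
  moreover have "at u within {0..} = at u within {0..u+1}"
    by (rule at_within_nhd[of u "{..<u+1}"]) auto
  ultimately show ?thesis by simp
qed

text \<open>The growth estimate behind the exponentially weighted norm: the weight absorbs the integral up to the factor \<open>1 / c\<close>.\<close>

lemma norm_integral_le_exp:
  fixes h :: "real \<Rightarrow> 'a::banach"
  assumes "continuous_on {0..} h" "0 \<le> u" "0 < c" "0 \<le> K"
    and bound: "\<And>s. 0 \<le> s \<Longrightarrow> norm (h s) \<le> K * exp (c * s)"
  shows "norm (integral {0..u} h) \<le> K / c * exp (c * u)"
proof -
  have "((\<lambda>s. K * exp (c * s)) has_integral K / c * exp (c * u) - K / c * exp (c * 0)) {0..u}"
    using assms(2,3)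
    by (intro fundamental_theorem_of_calculus)
       (auto intro!: derivative_eq_intros simp flip: has_real_derivative_iff_has_vector_derivative)
  moreover have "h integrable_on {0..u}"
    using assms(1) by (intro integrable_continuous_real) (auto intro: continuous_on_subset)
  ultimately have "norm (integral {0..u} h) \<le> K / c * exp (c * u) - K / c * exp (c * 0)"
    using bound by (metis (no_types, lifting) atLeastAtMost_iff has_integral_integrable has_integral_iff
        integral_norm_bound_integral)
  also have "\<dots> \<le> K / c * exp (c * u)" using assms by simp
  finally show ?thesis .
qed

text \<open>Picard iteration in the space of functions \<open>y\<close> with \<open>x(t) = exp(ct) y(t)\<close> and \<open>y\<close> bounded: with weight \<open>c = 2L\<close> the integral operator contracts by \<open>1/2\<close> on the whole half-line at once, so that no gluing of local solutions is needed.\<close>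

theorem global_lipschitz_ode:
  fixes f :: "real \<Rightarrow> 'a::banach \<Rightarrow> 'a" and x0 :: 'a
  assumes cont: "\<And>x. continuous_on {0..} x \<Longrightarrow> continuous_on {0..} (\<lambda>t. f t (x t))"
    and lip: "\<And>t x y. 0 \<le> t \<Longrightarrow> norm (f t x - f t y) \<le> L * norm (x - y)"
    and bound: "\<And>t. 0 \<le> t \<Longrightarrow> norm (f t 0) \<le> B"
    and "0 < L"
  shows "\<exists>x. x 0 = x0 \<and> (\<forall>t\<ge>0. (x has_vector_derivative f t (x t)) (at t within {0..}))"
proof -
  define c where "c = 2 * L"
  have "c > 0" using \<open>0 < L\<close> by (simp add: c_def)
  have "B \<ge> 0" using bound[of 0] norm_ge_zero order_trans by blast
  define h where "h y s = f s (exp (c * s) *\<^sub>R apply_bcontfun y s)" for y s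
  define F where "F y t = exp (- c * max 0 t) *\<^sub>R (x0 + integral {0..max 0 t} (h y))" for y t
  have h_cont: "continuous_on {0..} (h y)" for y
    unfolding h_def by (intro cont continuous_intros continuous_on_apply_bcontfun)
  have h_bound: "norm (h y s) \<le> (B + L * norm y) * exp (c * s)" if "0 \<le> s" for y s
  proof -
    have "norm (h y s) \<le> norm (f s 0) + norm (h y s - f s 0)"
      by (metis add.commute diff_add_cancel norm_triangle_ineq)
    also have "\<dots> \<le> B + L * norm (exp (c * s) *\<^sub>R apply_bcontfun y s - 0)"
      unfolding h_def by (intro add_mono bound lip that)
    also have "\<dots> \<le> B * exp (c * s) + L * (exp (c * s) * norm y)"
    proof (intro add_mono mult_left_mono)
      show "B \<le> B * exp (c * s)"
        using mult_left_mono[of 1 "exp (c * s)" B] \<open>B \<ge> 0\<close> \<open>c > 0\<close> that by simp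
    qed (use \<open>0 < L\<close> norm_bounded in auto)
    finally show ?thesis by (simp add: algebra_simps)
  qed
  have I_cont: "continuous_on {0..} (\<lambda>u. integral {0..u} (h y))" for y
    using integral_has_vector_derivative_halfline[OF h_cont[of y]]
    by (meson atLeast_iff continuous_on_eq_continuous_within has_vector_derivative_continuous)
  have F_bcont: "F y \<in> bcontfun" for y
  proof (rule bcontfun_normI)
    have "continuous_on UNIV (\<lambda>t. integral {0..max 0 t} (h y))"
      by (rule continuous_on_compose2[OF I_cont[of y], of _ "max 0"]) (auto intro!: continuous_intros)
    then show "continuous_on UNIV (F y)"
      unfolding F_def by (intro continuous_intros)
    show "norm (F y t) \<le> norm x0 + (B + L * norm y) / c" for t
    proof -
      let ?u = "max 0 t"
      have "norm (F y t) \<le> exp (- c * ?u) * (norm x0 + norm (integral {0..?u} (h y)))"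
        unfolding F_def by (simp add: norm_triangle_ineq)
      also have "\<dots> \<le> exp (- c * ?u) * (norm x0 + (B + L * norm y) / c * exp (c * ?u))"
        using h_cont h_bound \<open>c > 0\<close> \<open>B \<ge> 0\<close> \<open>L > 0\<close>
        by (intro mult_left_mono add_left_mono norm_integral_le_exp) auto
      also have "\<dots> = exp (- c * ?u) * norm x0 + (B + L * norm y) / c"
        by (simp add: algebra_simps exp_minus)
      also have "\<dots> \<le> 1 * norm x0 + (B + L * norm y) / c"
        using \<open>c > 0\<close> by (intro add_right_mono mult_right_mono) auto
      finally show ?thesis by simp
    qed
  qed
  define G where "G y = Bcontfun (F y)" for y
  have G: "apply_bcontfun (G y) = F y" for y
    unfolding G_def by (rule Bcontfun_inverse) (rule F_bcont)
  have contr: "dist (G y) (G z) \<le> 1/2 * dist y z" for y z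
  proof (rule dist_bound)
    fix t :: real
    let ?u = "max 0 t"
    have int: "h y integrable_on {0..?u}" for y
      by (intro integrable_continuous_real continuous_on_subset[OF h_cont]) auto
    have diff_cont: "continuous_on {0..} (\<lambda>s. h y s - h z s)"
      by (intro continuous_intros h_cont)
    have "dist (G y t) (G z t) = exp (- c * ?u) * norm (integral {0..?u} (\<lambda>s. h y s - h z s))"
      unfolding G F_def dist_norm
      by (simp add: integral_diff[OF int int] flip: scaleR_diff_right)
    also have "\<dots> \<le> exp (- c * ?u) * (L * dist y z / c * exp (c * ?u))"
    proof (intro mult_left_mono norm_integral_le_exp diff_cont)
      fix s :: real assume s: "0 \<le> s"
      have "norm (h y s - h z s) \<le> L * norm (exp (c * s) *\<^sub>R apply_bcontfun y s - exp (c * s) *\<^sub>R apply_bcontfun z s)"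
        unfolding h_def by (rule lip[OF s])
      also have "\<dots> = L * (exp (c * s) * dist (apply_bcontfun y s) (apply_bcontfun z s))"
        by (simp add: dist_norm flip: scaleR_diff_right)
      also have "\<dots> \<le> L * (exp (c * s) * dist y z)"
        using \<open>0 < L\<close> by (intro mult_left_mono dist_bounded) auto
      finally show "norm (h y s - h z s) \<le> L * dist y z * exp (c * s)" by (simp add: mult_ac)
    qed (use \<open>c > 0\<close> \<open>L > 0\<close> in auto)
    also have "\<dots> = 1/2 * dist y z"
      using \<open>L > 0\<close> by (simp add: c_def exp_minus)
    finally show "dist (G y t) (G z t) \<le> 1/2 * dist y z" .
  qed
  obtain y where y: "G y = y"
    using banach_fix_type[of "1/2" G] contr by auto
  define x where "x t = x0 + integral {0..t} (h y)" for t
  have hx: "h y t = f t (x t)" if "t \<ge> 0" for t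
  proof -
    have "apply_bcontfun y t = F y t" by (metis G y)
    then show ?thesis using that
      by (simp add: h_def x_def F_def exp_minus)
  qed
  have "(x has_vector_derivative f t (x t)) (at t within {0..})" if "t \<ge> 0" for t
  proof -
    have "(x has_vector_derivative 0 + h y t) (at t within {0..})"
      unfolding x_def
      by (intro has_vector_derivative_add has_vector_derivative_const
          integral_has_vector_derivative_halfline[OF h_cont that])
    then show ?thesis by (simp add: hx[OF that])
  qed
  moreover have "x 0 = x0" by (simp add: x_def)
  ultimately show ?thesis by blast
qed

lemma antimono_if_deriv_nonpos_halfline:
  fixes f :: "real \<Rightarrow> real"
  assumes deriv: "\<And>t. 0 \<le> t \<Longrightarrow> (f has_real_derivative f' t) (at t within {0..})"
    and nonpos: "\<And>t. t0 \<le> t \<Longrightarrow> f' t \<le> 0" and "0 \<le> t0" "t0 \<le> t1"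
  shows "f t1 \<le> f t0"
proof (rule DERIV_nonpos_imp_decreasing_open[OF \<open>t0 \<le> t1\<close>])
  fix s assume "t0 < s" "s < t1"
  then show "\<exists>d. DERIV f s :> d \<and> d \<le> 0"
    using deriv[of s] nonpos[of s] \<open>0 \<le> t0\<close> at_within_interior[of s "{0..}"]
    by (intro exI[of _ "f' s"]) simp
next
  have "continuous_on {0..} f"
    unfolding continuous_on_eq_continuous_within using deriv by (auto intro: DERIV_continuous)
  then show "continuous_on {t0..t1} f" by (rule continuous_on_subset) (use \<open>0 \<le> t0\<close> in auto)
qed

text \<open>Gronwall's argument: \<open>\<parallel>x - y\<parallel>\<^sup>2 exp(-2Lt)\<close> is nonincreasing.\<close>

lemma ode_unique:
  fixes x y :: "real \<Rightarrow> 'a::real_inner"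
  assumes x: "\<And>t. 0 \<le> t \<Longrightarrow> (x has_vector_derivative f t (x t)) (at t within {0..})"
    and y: "\<And>t. 0 \<le> t \<Longrightarrow> (y has_vector_derivative f t (y t)) (at t within {0..})"
    and lip: "\<And>t x y. 0 \<le> t \<Longrightarrow> norm (f t x - f t y) \<le> L * norm (x - y)"
    and init: "x 0 = y 0" and "0 \<le> t"
  shows "x t = y t"
proof -
  define e where "e s = (x s - y s) \<bullet> (x s - y s) * exp (- 2 * L * s)" for s
  define e' where "e' s = 2 * exp (- 2 * L * s) * ((x s - y s) \<bullet> (f s (x s) - f s (y s)) - L * ((x s - y s) \<bullet> (x s - y s)))" for s
  have e: "(e has_real_derivative e' s) (at s within {0..})" if "0 \<le> s" for s
  proof -
    have "((\<lambda>s. x s - y s) has_derivative (\<lambda>h. h *\<^sub>R (f s (x s) - f s (y s)))) (at s within {0..})"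
      using has_vector_derivative_diff[OF x[OF that] y[OF that]] by (simp add: has_vector_derivative_def)
    from has_derivative_inner[OF this this]
    have "((\<lambda>s. (x s - y s) \<bullet> (x s - y s)) has_real_derivative 2 * ((x s - y s) \<bullet> (f s (x s) - f s (y s)))) (at s within {0..})"
      unfolding has_field_derivative_def
      by (rule has_derivative_eq_rhs) (auto simp: inner_commute)
    moreover have "((\<lambda>s. exp (- 2 * L * s)) has_real_derivative - 2 * L * exp (- 2 * L * s)) (at s within {0..})"
      by (auto intro!: derivative_eq_intros)
    ultimately show ?thesis unfolding e_def e'_def
      by (rule DERIV_cong[OF DERIV_mult]) (simp add: algebra_simps)
  qed
  have "e' s \<le> 0" if "0 \<le> s" for s
  proof -
    have "(x s - y s) \<bullet> (f s (x s) - f s (y s)) \<le> norm (x s - y s) * norm (f s (x s) - f s (y s))"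
      by (rule norm_cauchy_schwarz)
    also have "\<dots> \<le> norm (x s - y s) * (L * norm (x s - y s))"
      by (intro mult_left_mono lip that) auto
    also have "\<dots> = L * ((x s - y s) \<bullet> (x s - y s))" by (simp add: dot_square_norm power2_eq_square)
    finally show ?thesis by (simp add: e'_def mult_le_0_iff)
  qed
  then have "e t \<le> e 0"
    using \<open>0 \<le> t\<close> by (intro antimono_if_deriv_nonpos_halfline[OF e]) auto
  then have "e t \<le> 0" by (simp add: e_def init)
  then have "(x t - y t) \<bullet> (x t - y t) \<le> 0" by (simp add: e_def mult_le_0_iff)
  then show ?thesis by (metis inner_gt_zero_iff not_less eq_iff_diff_eq_0)
qed

text \<open>A comparison principle for functions that are not differentiable, such as distances: it is enough that at every point the function is touched from above by some differentiable function with nonpositive derivative.\<close>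

lemma contact_function_decreasing:
  fixes d :: "real \<Rightarrow> real"
  assumes cont: "continuous_on {0..} d"
    and contact: "\<And>t. 0 \<le> t \<Longrightarrow> \<exists>q D. q t = d t \<and> (\<forall>s\<ge>0. d s \<le> q s) \<and> D \<le> 0 \<and>
          (q has_real_derivative D) (at t within {0..})"
    and "0 \<le> T"
  shows "d T \<le> d 0"
proof (rule ccontr)
  assume "\<not> d T \<le> d 0"
  then have T: "d T > d 0" "T > 0" using \<open>0 \<le> T\<close> by (auto simp: less_eq_real_def)
  \<comment> \<open>The chord of slope \<open>e\<close> from the start stays strictly below the value at \<open>T\<close>.\<close>
  define e where "e = (d T - d 0) / (2 * T)"
  have "e > 0" using T by (simp add: e_def)
  define S where "S = {t \<in> {0..T}. d t - e * t \<le> d 0}"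
  have "closed ({0..T} \<inter> (\<lambda>t. d t - e * t) -` {..d 0})"
    by (intro continuous_closed_preimage continuous_intros continuous_on_subset[OF cont]) auto
  moreover have "{0..T} \<inter> (\<lambda>t. d t - e * t) -` {..d 0} = S" by (auto simp: S_def)
  ultimately have "compact S"
    using compact_Int_closed[of "{0..T}" S] by (auto simp: S_def inf.absorb2 inf_commute Int_absorb1 subset_iff)
  moreover have "0 \<in> S" using T by (simp add: S_def)
  ultimately obtain t where t: "t \<in> S" "\<And>s. s \<in> S \<Longrightarrow> s \<le> t"
    using compact_attains_sup[of S] by blast
  have "T \<notin> S" using T by (auto simp: S_def e_def field_simps)
  then have t0: "0 \<le> t" "t < T" using t(1) by (auto simp: S_def less_eq_real_def)
  obtain q D where q: "q t = d t" "\<And>s. s \<ge> 0 \<Longrightarrow> d s \<le> q s" "D \<le> 0"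
      "(q has_real_derivative D) (at t within {0..})"
    using contact[OF t0(1)] by blast
  have "((\<lambda>s. q s - e * s) has_real_derivative D - e) (at t within {0..})"
    using q(4) by (auto intro!: derivative_eq_intros)
  moreover have "D - e < 0" using q(3) \<open>e > 0\<close> by simp
  ultimately obtain r where r: "r > 0" "\<And>h. 0 < h \<Longrightarrow> t + h \<in> {0..} \<Longrightarrow> h < r \<Longrightarrow> q (t + h) - e * (t + h) < q t - e * t"
    using has_real_derivative_neg_dec_right by blast
  define h where "h = min (r / 2) (T - t)"
  have h: "0 < h" "h < r" "t + h \<le> T" using r t0 by (auto simp: h_def min_def)
  have "d (t + h) - e * (t + h) \<le> q (t + h) - e * (t + h)" using q(2)[of "t + h"] t0 h by simp
  also have "\<dots> < d t - e * t" using r(2)[of h] h t0 q(1) by simp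
  also have "\<dots> \<le> d 0" using t(1) by (simp add: S_def)
  finally have "t + h \<in> S" using h t0 by (simp add: S_def)
  with t(2) h show False by force
qed

section \<open>The vector field in a singular frame\<close>

lemma inner_rdiag: "rdiag y \<bullet> M = (\<Sum>i\<in>UNIV. y i * Re (M $ i $ i))"
proof -
  have "(\<Sum>j\<in>UNIV. Re (cnj (rdiag y $ i $ j) * M $ i $ j)) = (\<Sum>j\<in>UNIV. if i = j then y i * Re (M $ i $ i) else 0)" for i
    by (intro sum.cong refl) (simp add: diag_def)
  then show ?thesis unfolding matrix_inner_entries by simp
qed

lemma inner_frame: "(U ** rdiag y ** adj V) \<bullet> Z = (\<Sum>i\<in>UNIV. y i * Re ((adj U ** Z ** V) $ i $ i))"
proof -
  have "(U ** rdiag y ** adj V) \<bullet> Z = rdiag y \<bullet> (adj U ** Z ** V)"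
    using inner_mult_right_adj[of "U ** rdiag y" "adj V" Z] inner_mult_left_adj[of U "rdiag y" "Z ** V"]
    by (simp add: matrix_mul_assoc)
  then show ?thesis by (simp only: inner_rdiag)
qed

lemma conjugated_diagonal:
  "(adj W ** rdiag f ** W) $ j $ j = of_real (\<Sum>i\<in>UNIV. (cmod (W $ i $ j))\<^sup>2 * f i)"
proof -
  have "(adj W ** rdiag f ** W) $ j $ j = (\<Sum>i\<in>UNIV. (adj W ** rdiag f) $ j $ i * W $ i $ j)"
    by (simp add: matrix_matrix_mult_def)
  also have "\<dots> = (\<Sum>i\<in>UNIV. of_real ((cmod (W $ i $ j))\<^sup>2 * f i))"
    by (intro sum.cong refl) (simp only: matrix_mult_diag adj_entry of_real_mult complex_norm_square mult_ac)
  finally show ?thesis by simp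
qed

text \<open>The pairing of the vector field with any matrix that is diagonal in the singular frame of \<open>X\<close>. The weights \<open>\<bar>(V\<^sup>*U)\<^sub>i\<^sub>j\<bar>\<^sup>2\<close> are doubly stochastic. The case \<open>y = s\<close> gives the energy balance, and \<open>y = s - clamp(s)\<close> the invariance of \<open>mat_interval\<close>.\<close>

lemma commutator_frame_inner:
  fixes U V :: "'n::finite cmat" and y s f g :: "'n \<Rightarrow> real"
  assumes U: "unitary U" and V: "unitary V"
    and \<Phi>: "\<Phi> = V ** rdiag f ** adj V - U ** rdiag g ** adj U"
    and X: "X = U ** rdiag s ** adj V"
  shows "(U ** rdiag y ** adj V) \<bullet> commutator \<Phi> X =
    (\<Sum>i\<in>UNIV. \<Sum>j\<in>UNIV. (cmod ((adj V ** U) $ i $ j))\<^sup>2 *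
       (y j * s j * (f i - f j) + y i * s i * (g j - g i)))"
proof -
  define W where "W = adj V ** U"
  define w where "w i j = (cmod (W $ i $ j))\<^sup>2" for i j
  have W: "unitary W" using U V by (simp add: W_def unitary_adj unitary_mult)
  have adjW: "adj W = adj U ** V" by (simp add: W_def adj_mult)
  have rows: "(\<Sum>j\<in>UNIV. w i j) = 1" for i using unitary_row_sum[OF W] by (simp add: w_def)
  have cols: "(\<Sum>i\<in>UNIV. w i j) = 1" for j using unitary_col_sum[OF W] by (simp add: w_def)
  have "adj U ** commutator \<Phi> X ** V =
     adj W ** rdiag f ** W ** rdiag s - rdiag g ** rdiag s - rdiag s ** rdiag f + rdiag s ** (adj (adj W) ** rdiag g ** adj W)"
    unfolding adjW unfolding \<Phi> X commutator_def W_def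
    using U V by (simp add: matrix_diff_ldistrib matrix_diff_rdistrib unitary_cancel matrix_add_ldistrib matrix_add_rdistrib adj_mult
        flip: matrix_mul_assoc)
  then have entry: "Re ((adj U ** commutator \<Phi> X ** V) $ i $ i)
      = (\<Sum>k\<in>UNIV. w k i * f k) * s i - g i * s i - s i * f i + s i * (\<Sum>k\<in>UNIV. w i k * g k)" for i
    by (simp add: matrix_mult_diag diag_mult_matrix conjugated_diagonal w_def del: adj_adj of_real_sum)
       (simp add: diag_def)
  have "(U ** rdiag y ** adj V) \<bullet> commutator \<Phi> X
     = (\<Sum>i\<in>UNIV. y i * s i * ((\<Sum>k\<in>UNIV. w k i * f k) - f i)) + (\<Sum>i\<in>UNIV. y i * s i * ((\<Sum>k\<in>UNIV. w i k * g k) - g i))"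
    unfolding inner_frame entry by (simp add: sum.distrib[symmetric] algebra_simps)
  also have "(\<Sum>i\<in>UNIV. y i * s i * ((\<Sum>k\<in>UNIV. w k i * f k) - f i)) = (\<Sum>j\<in>UNIV. \<Sum>i\<in>UNIV. w i j * (y j * s j * (f i - f j)))"
  proof (intro sum.cong refl)
    fix j
    have "(\<Sum>i\<in>UNIV. w i j * (y j * s j * (f i - f j))) = y j * s j * (\<Sum>i\<in>UNIV. w i j * f i) - (\<Sum>i\<in>UNIV. w i j) * (y j * s j * f j)"
      by (simp add: sum_distrib_left sum_distrib_right algebra_simps flip: sum_subtractf)
    then show "y j * s j * ((\<Sum>k\<in>UNIV. w k j * f k) - f j) = (\<Sum>i\<in>UNIV. w i j * (y j * s j * (f i - f j)))"
      by (simp add: cols algebra_simps)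
  qed
  also have "\<dots> = (\<Sum>i\<in>UNIV. \<Sum>j\<in>UNIV. w i j * (y j * s j * (f i - f j)))"
    by (rule sum.swap)
  also have "(\<Sum>i\<in>UNIV. y i * s i * ((\<Sum>k\<in>UNIV. w i k * g k) - g i)) = (\<Sum>i\<in>UNIV. \<Sum>j\<in>UNIV. w i j * (y i * s i * (g j - g i)))"
  proof (intro sum.cong refl)
    fix i
    have "(\<Sum>j\<in>UNIV. w i j * (y i * s i * (g j - g i))) = y i * s i * (\<Sum>j\<in>UNIV. w i j * g j) - (\<Sum>j\<in>UNIV. w i j) * (y i * s i * g i)"
      by (simp add: sum_distrib_left sum_distrib_right algebra_simps flip: sum_subtractf)
    then show "y i * s i * ((\<Sum>k\<in>UNIV. w i k * g k) - g i) = (\<Sum>j\<in>UNIV. w i j * (y i * s i * (g j - g i)))"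
      by (simp add: rows algebra_simps)
  qed
  finally show ?thesis
    by (simp add: sum.distrib[symmetric] w_def W_def ring_distribs)
qed

lemma norm_frame_sq:
  assumes "unitary U" "unitary V"
  shows "(norm (U ** rdiag y ** adj V))\<^sup>2 = (\<Sum>i\<in>UNIV. (y i)\<^sup>2)"
proof -
  have "adj U ** (U ** rdiag y ** adj V) ** V = rdiag y"
    using assms by (simp add: unitary_cancel flip: matrix_mul_assoc)
  then show ?thesis
    unfolding power2_norm_eq_inner inner_frame by (simp add: diag_def power2_eq_square)
qed

lemma norm_frame_le:
  fixes U V :: "'n::finite cmat" and B :: real
  assumes "unitary U" "unitary V" and "\<And>i. \<bar>y i\<bar> \<le> B"
  shows "norm (U ** rdiag y ** adj V) \<le> CARD('n) * B"
proof -
  have B: "0 \<le> B" using assms(3)[of undefined] by linarith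
  have "(norm (U ** rdiag y ** adj V))\<^sup>2 \<le> (\<Sum>i\<in>(UNIV :: 'n set). B\<^sup>2)"
    unfolding norm_frame_sq[OF assms(1,2)]
    by (intro sum_mono) (metis abs_ge_zero assms(3) power2_abs power_mono)
  also have "\<dots> = CARD('n) * B\<^sup>2" by simp
  also have "\<dots> \<le> (CARD('n))\<^sup>2 * B\<^sup>2"
    by (intro mult_right_mono) (auto simp: power2_eq_square)
  finally have "(norm (U ** rdiag y ** adj V))\<^sup>2 \<le> (CARD('n) * B)\<^sup>2" by (simp add: power_mult_distrib)
  then show ?thesis by (rule power2_le_imp_le) (use B in simp)
qed

lemma phi_mat_norm_le:
  fixes X :: "'n::finite cmat" and B :: real
  assumes "\<And>x. 0 \<le> x \<Longrightarrow> \<bar>f x\<bar> \<le> B" "\<And>x. 0 \<le> x \<Longrightarrow> \<bar>g x\<bar> \<le> B"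
  shows "norm (phi_mat f g X) \<le> 2 * CARD('n) * B"
proof -
  obtain U s V where X: "svd X U s V" using svd_exists by blast
  then have u: "unitary U" "unitary V" "0 \<le> s i" for i by (auto simp: svd_def)
  have "norm (phi_mat f g X) \<le> norm (V ** rdiag (\<lambda>i. f (s i)) ** adj V) + norm (U ** rdiag (\<lambda>i. g (s i)) ** adj U)"
    unfolding svd_phi_mat[OF X] by (rule norm_triangle_ineq4)
  also have "\<dots> \<le> CARD('n) * B + CARD('n) * B"
    using assms u by (intro add_mono norm_frame_le) auto
  finally show ?thesis by (simp add: mult_ac)
qed

lemma norm_commutator_le: "norm (commutator A B) \<le> 2 * norm A * norm B"
proof -
  have "norm (commutator A B) \<le> norm (A ** B) + norm (B ** A)"
    unfolding commutator_def by (rule norm_triangle_ineq4)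
  also have "\<dots> \<le> norm A * norm B + norm B * norm A"
    by (intro add_mono norm_matrix_mult_le)
  finally show ?thesis by simp
qed

lemma commutator_diff_left: "commutator (A - B) C = commutator A C - commutator B C"
  and commutator_diff_right: "commutator C (A - B) = commutator C A - commutator C B"
  and commutator_scaleR_right: "commutator A (r *\<^sub>R B) = r *\<^sub>R commutator A B"
  by (simp_all add: commutator_def matrix_diff_ldistrib matrix_diff_rdistrib
      matrix_mult_scaleR_left matrix_mult_scaleR_right scaleR_diff_right)

lemma phi_mat_cong:
  assumes "X \<in> mat_interval a b" "\<And>x. x \<in> {a..b} \<Longrightarrow> f x = f' x" "\<And>x. x \<in> {a..b} \<Longrightarrow> g x = g' x"
  shows "phi_mat f g X = phi_mat f' g' X"
proof -
  obtain U s V where X: "svd X U s V" using svd_exists by blast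
  with assms have "s i \<in> {a..b}" for i using mat_interval_iff by blast
  with assms show ?thesis by (simp add: svd_phi_mat[OF X])
qed

lemma mat_interval_norm_le:
  fixes X :: "'n::finite cmat" and a b :: real
  assumes "X \<in> mat_interval a b"
  shows "norm X \<le> CARD('n) * b"
proof -
  obtain U s V where X: "svd X U s V" using svd_exists by blast
  with assms have s: "s i \<in> {a..b}" "0 \<le> s i" for i using mat_interval_iff by (blast, simp add: svd_def)
  show ?thesis using X s norm_frame_le[of U V s b] by (auto simp: svd_def)
qed

text \<open>Multiplying \<open>X\<close> by \<open>R / max R \<parallel>X\<parallel>\<close> retracts to the ball of radius \<open>R\<close>. This truncation only rescales the flow field, and so does not spoil its direction.\<close>

lemma radial_retraction_lipschitz:
  fixes X Y :: "'a::real_normed_vector"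
  assumes "R > 0"
  shows "norm ((R / max R (norm X)) *\<^sub>R X - (R / max R (norm Y)) *\<^sub>R Y) \<le> 2 * norm (X - Y)"
proof -
  define m where "m Z = max R (norm Z)" for Z :: 'a
  have m: "0 < m Z" "R \<le> m Z" "norm Z \<le> m Z" for Z using assms by (auto simp: m_def)
  have "\<bar>m X - m Y\<bar> \<le> norm (X - Y)"
    unfolding m_def using norm_triangle_ineq3[of X Y] by (auto simp: max_def)
  have "(R / m X) *\<^sub>R X - (R / m Y) *\<^sub>R Y = (R / m X) *\<^sub>R (X - Y) + (R / m X - R / m Y) *\<^sub>R Y"
    by (simp add: algebra_simps)
  then have "norm ((R / m X) *\<^sub>R X - (R / m Y) *\<^sub>R Y) \<le> \<bar>R / m X\<bar> * norm (X - Y) + \<bar>R / m X - R / m Y\<bar> * norm Y"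
    by (metis norm_scaleR norm_triangle_ineq)
  also have "\<dots> \<le> 1 * norm (X - Y) + 1 * norm (X - Y)"
  proof (intro add_mono mult_right_mono)
    show "\<bar>R / m X\<bar> \<le> 1" using m[of X] assms by (simp add: field_simps)
    have "\<bar>R / m X - R / m Y\<bar> * norm Y = (R / m X) * (norm Y / m Y) * \<bar>m X - m Y\<bar>"
    proof -
      have "R / m X - R / m Y = R / (m X * m Y) * (m Y - m X)"
        using m(1)[of X] m(1)[of Y] by (simp add: field_simps)
      then have "\<bar>R / m X - R / m Y\<bar> = R / (m X * m Y) * \<bar>m X - m Y\<bar>"
        using m(1)[of X] m(1)[of Y] assms by (simp add: abs_mult abs_minus_commute)
      then show ?thesis by simp
    qed
    also have "\<dots> \<le> 1 * 1 * norm (X - Y)"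
      using m[of X] m[of Y] assms \<open>\<bar>m X - m Y\<bar> \<le> norm (X - Y)\<close> by (intro mult_mono) auto
    finally show "\<bar>R / m X - R / m Y\<bar> * norm Y \<le> 1 * norm (X - Y)" by simp
  qed auto
  finally show ?thesis by (simp add: m_def)
qed

section \<open>Existence and uniqueness of the flow\<close>

text \<open>The nearest point of \<open>mat_interval a b\<close> is found by clamping the singular values: each singular value of a matrix in the set is at least as far from \<open>s\<^sub>j\<close> as the clamped value is, and the overlap weights in the distance inequality sum to \<open>2\<close> in every column.\<close>

lemma infdist_mat_interval:
  fixes X :: "'n::finite cmat"
  assumes X: "svd X U s V" and "0 \<le> a" "a \<le> b"
  defines "X' \<equiv> U ** rdiag (\<lambda>i. max a (min b (s i))) ** adj V"
  shows "X' \<in> mat_interval a b" "infdist X (mat_interval a b) = norm (X - X')"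
proof -
  have u: "unitary U" "unitary V" using X by (auto simp: svd_def)
  have "svd X' U (\<lambda>i. max a (min b (s i))) V"
    using X \<open>0 \<le> a\<close> by (auto simp: svd_def X'_def)
  from mat_interval_iff[OF this] show X': "X' \<in> mat_interval a b"
    using \<open>a \<le> b\<close> by auto
  define y where "y i = s i - max a (min b (s i))" for i
  have "X - X' = U ** rdiag y ** adj V"
    using X by (simp add: svd_def X'_def y_def matrix_diff_ldistrib matrix_diff_rdistrib flip: diag_diff)
  then have nX': "(norm (X - X'))\<^sup>2 = (\<Sum>j\<in>UNIV. (y j)\<^sup>2)" using norm_frame_sq[OF u] by simp
  have "norm (X - X') \<le> dist X Y" if Y: "Y \<in> mat_interval a b" for Y
  proof -
    obtain U' s' V' where sY: "svd Y U' s' V'" using svd_exists by blast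
    then have u': "unitary U'" "unitary V'" by (auto simp: svd_def)
    have s': "s' i \<in> {a..b}" for i using Y mat_interval_iff[OF sY] by blast
    let ?w = "\<lambda>i j. (cmod ((adj U' ** U) $ i $ j))\<^sup>2 + (cmod ((adj V' ** V) $ i $ j))\<^sup>2"
    have w: "(\<Sum>i\<in>UNIV. ?w i j) = 2" for j
      unfolding sum.distrib using u u' by (simp add: unitary_col_sum unitary_mult unitary_adj)
    have "2 * (norm (X - X'))\<^sup>2 = (\<Sum>j\<in>UNIV. (\<Sum>i\<in>UNIV. ?w i j) * (y j)\<^sup>2)"
      unfolding w nX' by (simp add: sum_distrib_left)
    also have "\<dots> = (\<Sum>i\<in>UNIV. \<Sum>j\<in>UNIV. ?w i j * (y j)\<^sup>2)"
      unfolding sum_distrib_right by (rule sum.swap)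
    also have "\<dots> \<le> (\<Sum>i\<in>UNIV. \<Sum>j\<in>UNIV. ?w i j * (s j - s' i)\<^sup>2)"
    proof (intro sum_mono mult_left_mono)
      fix i j
      have "\<bar>y j\<bar> \<le> \<bar>s j - s' i\<bar>" using s'[of i] \<open>a \<le> b\<close> by (auto simp: y_def)
      then show "(y j)\<^sup>2 \<le> (s j - s' i)\<^sup>2" by (simp add: abs_le_square_iff)
    qed auto
    also have "\<dots> \<le> 2 * (norm (X - Y))\<^sup>2" by (rule svd_distance_ineq[OF X sY])
    finally have "(norm (X - X'))\<^sup>2 \<le> (norm (X - Y))\<^sup>2" by linarith
    then have "norm (X - X') \<le> norm (X - Y)" by (rule power2_le_imp_le) (rule norm_ge_zero)
    then show ?thesis by (simp add: dist_norm)
  qed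
  moreover have ne: "mat_interval a b \<noteq> ({} :: 'n cmat set)" using X' by blast
  ultimately have "norm (X - X') \<le> infdist X (mat_interval a b)"
    unfolding infdist_notempty[OF ne] by (intro cINF_greatest ne)
  then show "infdist X (mat_interval a b) = norm (X - X')"
    using infdist_le[OF X', of X] by (simp add: dist_norm)
qed

lemma mat_interval_if_infdist_zero:
  fixes X :: "'n::finite cmat"
  assumes "infdist X (mat_interval a b) = 0" "0 \<le> a" "a \<le> b"
  shows "X \<in> mat_interval a b"
proof -
  obtain U s V where X: "svd X U s V" using svd_exists by blast
  show ?thesis using infdist_mat_interval[OF X assms(2,3)] assms(1) by simp
qed

text \<open>A singular value above \<open>b\<close> sees the maximal values of \<open>f\<close> and \<open>g\<close>, one below \<open>a\<close> the minimal ones; in both cases every term of the pairing has the favourable sign.\<close>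

lemma flow_inward:
  fixes X :: "'n::finite cmat"
  assumes X: "svd X U s V" and "0 \<le> a" "a \<le> b"
    and f: "\<And>x y. x \<ge> b \<Longrightarrow> f y \<le> f x" "\<And>x y. x \<le> a \<Longrightarrow> f x \<le> f y"
    and g: "\<And>x y. x \<ge> b \<Longrightarrow> g y \<le> g x" "\<And>x y. x \<le> a \<Longrightarrow> g x \<le> g y"
  shows "(X - U ** rdiag (\<lambda>i. max a (min b (s i))) ** adj V) \<bullet> commutator (phi_mat f g X) X \<le> 0"
proof -
  have u: "unitary U" "unitary V" and s: "\<And>i. 0 \<le> s i" and eq: "X = U ** rdiag s ** adj V"
    using X by (auto simp: svd_def)
  define y where "y i = s i - max a (min b (s i))" for i
  have X': "X - U ** rdiag (\<lambda>i. max a (min b (s i))) ** adj V = U ** rdiag y ** adj V"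
    using eq by (simp add: y_def matrix_diff_ldistrib matrix_diff_rdistrib flip: diag_diff)
  have sign: "y j * s j * (h (s i) - h (s j)) \<le> 0"
    if h: "\<And>x y. x \<ge> b \<Longrightarrow> h y \<le> h x" "\<And>x y. x \<le> a \<Longrightarrow> h x \<le> h y" for h :: "real \<Rightarrow> real" and i j
  proof -
    consider "y j = 0" | "s j \<ge> b" "y j \<ge> 0" | "s j \<le> a" "y j \<le> 0"
      using \<open>a \<le> b\<close> by (cases "b \<le> s j"; cases "s j \<le> a") (auto simp: y_def)
    then show ?thesis
    proof cases
      case 2
      then show ?thesis using h(1)[of "s j" "s i"] s[of j] by (intro mult_nonneg_nonpos mult_nonneg_nonneg) auto
    next
      case 3
      then show ?thesis using h(2)[of "s j" "s i"] s[of j] by (intro mult_nonpos_nonneg mult_nonpos_nonneg) auto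
    qed simp
  qed
  show ?thesis
    unfolding X' commutator_frame_inner[OF u svd_phi_mat[OF X] eq]
  proof (intro sum_nonpos mult_nonneg_nonpos)
    fix i j
    show "y j * s j * (f (s i) - f (s j)) + y i * s i * (g (s j) - g (s i)) \<le> 0"
      using sign[of f, OF f] sign[of g, OF g] by (meson add_nonpos_nonpos)
  qed auto
qed

text \<open>The squared distance to \<open>mat_interval a b\<close> has the squared distance to the nearest point of the present moment as a contact function. The factor \<open>r\<close> admits fields that were truncated radially.\<close>

lemma mat_interval_invariant:
  fixes X :: "real \<Rightarrow> 'n::finite cmat"
  assumes "0 \<le> a" "a \<le> b"
    and f: "\<And>x y. x \<ge> b \<Longrightarrow> f y \<le> f x" "\<And>x y. x \<le> a \<Longrightarrow> f x \<le> f y"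
    and g: "\<And>x y. x \<ge> b \<Longrightarrow> g y \<le> g x" "\<And>x y. x \<le> a \<Longrightarrow> g x \<le> g y"
    and X: "\<And>t. 0 \<le> t \<Longrightarrow> (X has_vector_derivative r t *\<^sub>R commutator (phi_mat f g (X t)) (X t)) (at t within {0..})"
    and r: "\<And>t. 0 \<le> t \<Longrightarrow> 0 \<le> r t"
    and "X 0 \<in> mat_interval a b" "0 \<le> t"
  shows "X t \<in> mat_interval a b"
proof -
  define K where "K = (mat_interval a b :: 'n cmat set)"
  define d where "d t = (infdist (X t) K)\<^sup>2" for t
  have X_cont: "continuous_on {0..} X"
    unfolding continuous_on_eq_continuous_within using X has_vector_derivative_continuous by force
  have "d t \<le> d 0"
  proof (rule contact_function_decreasing)
    show "continuous_on {0..} d"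
      unfolding d_def by (intro continuous_intros continuous_on_infdist X_cont)
    fix t :: real assume t: "0 \<le> t"
    obtain U s V where svd: "svd (X t) U s V" using svd_exists by blast
    define X' where "X' = U ** rdiag (\<lambda>i. max a (min b (s i))) ** adj V"
    define q where "q s = (X s - X') \<bullet> (X s - X')" for s
    define D where "D = 2 * ((X t - X') \<bullet> (r t *\<^sub>R commutator (phi_mat f g (X t)) (X t)))"
    have X': "X' \<in> K" "infdist (X t) K = norm (X t - X')"
      unfolding X'_def K_def using infdist_mat_interval[OF svd \<open>0 \<le> a\<close> \<open>a \<le> b\<close>] by auto
    have "q t = d t" by (simp add: q_def d_def X' power2_norm_eq_inner)
    moreover have "d s \<le> q s" for s
      unfolding d_def q_def power2_norm_eq_inner[symmetric]
      using infdist_le[OF X'(1), of "X s"] by (intro power_mono) (auto simp: dist_norm infdist_nonneg)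
    moreover have "D \<le> 0"
      using flow_inward[OF svd \<open>0 \<le> a\<close> \<open>a \<le> b\<close> f g] r[OF t] by (simp add: D_def X'_def mult_nonneg_nonpos)
    moreover have "(q has_real_derivative D) (at t within {0..})"
    proof -
      have "((\<lambda>s. X s - X') has_vector_derivative r t *\<^sub>R commutator (phi_mat f g (X t)) (X t) - 0) (at t within {0..})"
        by (intro has_vector_derivative_diff X[OF t] has_vector_derivative_const)
      then have "((\<lambda>s. X s - X') has_derivative (\<lambda>h. h *\<^sub>R (r t *\<^sub>R commutator (phi_mat f g (X t)) (X t)))) (at t within {0..})"
        by (simp only: has_vector_derivative_def diff_zero)
      from has_derivative_inner[OF this this] show ?thesis
        unfolding has_field_derivative_def q_def D_def
        by (rule has_derivative_eq_rhs) (auto simp: inner_commute)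
    qed
    ultimately show "\<exists>q D. q t = d t \<and> (\<forall>s\<ge>0. d s \<le> q s) \<and> D \<le> 0 \<and> (q has_real_derivative D) (at t within {0..})"
      by blast
  qed (rule \<open>0 \<le> t\<close>)
  also have "d 0 = 0" using assms by (simp add: d_def K_def)
  finally have "infdist (X t) K = 0" by (simp add: d_def)
  then show ?thesis using assms mat_interval_if_infdist_zero unfolding K_def by blast
qed

text \<open>Besides existence and uniqueness, this records what the linear equation for the similarity transformation needs to know about its coefficient.\<close>

theorem phi_flow_solution:
  fixes T :: "'n::finite cmat"
  assumes "0 \<le> a" "a \<le> b" and mono: "mono_on {a..b} \<phi>1" "mono_on {a..b} \<phi>2"
    and lip: "\<And>x y. x \<in> {a..b} \<Longrightarrow> y \<in> {a..b} \<Longrightarrow> \<bar>\<phi>1 x - \<phi>1 y\<bar> \<le> L * \<bar>x - y\<bar>"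
       "\<And>x y. x \<in> {a..b} \<Longrightarrow> y \<in> {a..b} \<Longrightarrow> \<bar>\<phi>2 x - \<phi>2 y\<bar> \<le> L * \<bar>x - y\<bar>"
    and T: "T \<in> mat_interval a b"
  shows "\<exists>X. flow_solution a b \<phi>1 \<phi>2 T X \<and> (\<forall>t\<ge>0. phi_flow a b \<phi>1 \<phi>2 t T = X t) \<and>
     continuous_on {0..} (\<lambda>t. phi_mat \<phi>1 \<phi>2 (X t)) \<and> bounded ((\<lambda>t. phi_mat \<phi>1 \<phi>2 (X t)) ` {0..})"
proof -
  \<comment> \<open>Constant extensions keep \<open>\<phi>\<^sub>1\<close> and \<open>\<phi>\<^sub>2\<close> monotone and Lipschitz and make them bounded.\<close>
  define c where "c x = max a (min b x)" for x
  have c: "c x \<in> {a..b}" "x \<in> {a..b} \<Longrightarrow> c x = x" "\<bar>c x - c y\<bar> \<le> \<bar>x - y\<bar>" for x y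
    using \<open>a \<le> b\<close> by (auto simp: c_def)
  define K where "K = (mat_interval a b :: 'n cmat set)"
  define f where "f x = \<phi>1 (c x)" for x
  define g where "g x = \<phi>2 (c x)" for x
  define L' where "L' = max L 0"
  have "L * \<bar>c x - c y\<bar> \<le> L' * \<bar>x - y\<bar>" for x y
    unfolding L'_def by (intro mult_mono) (auto simp: c)
  then have lip': "\<bar>f x - f y\<bar> \<le> L' * \<bar>x - y\<bar>" "\<bar>g x - g y\<bar> \<le> L' * \<bar>x - y\<bar>" for x y
    unfolding f_def g_def using lip c(1) by (meson order_trans)+
  define B where "B = \<bar>\<phi>1 a\<bar> + \<bar>\<phi>1 b\<bar> + \<bar>\<phi>2 a\<bar> + \<bar>\<phi>2 b\<bar>"
  have ends: "a \<in> {a..b}" "b \<in> {a..b}" using \<open>a \<le> b\<close> by auto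
  have between: "\<phi>1 a \<le> f x" "f x \<le> \<phi>1 b" "\<phi>2 a \<le> g x" "g x \<le> \<phi>2 b" for x
    using mono_onD[OF mono(1) ends(1) c(1)[of x]] mono_onD[OF mono(1) c(1)[of x] ends(2)]
      mono_onD[OF mono(2) ends(1) c(1)[of x]] mono_onD[OF mono(2) c(1)[of x] ends(2)] c(1)[of x]
    by (auto simp: f_def g_def)
  have B: "\<bar>f x\<bar> \<le> B" "\<bar>g x\<bar> \<le> B" for x
    using between[of x] by (auto simp: B_def)
  define M where "M = 2 * CARD('n) * B"
  have M: "norm (phi_mat f g X) \<le> M" for X :: "'n cmat"
    unfolding M_def using B by (intro phi_mat_norm_le) auto
  have M0: "0 \<le> M" using M norm_ge_zero order_trans by blast
  have phi_lip: "norm (phi_mat f g X - phi_mat f g Y) \<le> 4 * L' * norm (X - Y)" for X Y :: "'n cmat"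
    using lip' by (intro phi_mat_lipschitz) (auto simp: L'_def)
  \<comment> \<open>The ball of radius \<open>R\<close> contains \<open>mat_interval a b\<close>, so that the truncation is invisible there.\<close>
  define R where "R = CARD('n) * b + 1"
  have "R > 0" unfolding R_def using assms(1,2) by (intro add_nonneg_pos) auto
  define \<rho> where "\<rho> X = R / max R (norm X)" for X :: "'n cmat"
  have \<rho>: "norm (\<rho> X *\<^sub>R X) \<le> R" "0 \<le> \<rho> X" for X
    using \<open>R > 0\<close> by (auto simp: \<rho>_def field_simps)
  define F where "F X = commutator (phi_mat f g X) (\<rho> X *\<^sub>R X)" for X
  define C where "C = 8 * L' * R + 4 * M + 1"
  have C: "C > 0" using \<open>R > 0\<close> M0 by (simp add: C_def L'_def add_nonneg_pos)
  have F_lip: "norm (F X - F Y) \<le> C * norm (X - Y)" for X Y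
  proof -
    have "F X - F Y = commutator (phi_mat f g X - phi_mat f g Y) (\<rho> X *\<^sub>R X)
        + commutator (phi_mat f g Y) (\<rho> X *\<^sub>R X - \<rho> Y *\<^sub>R Y)"
      unfolding F_def commutator_diff_left commutator_diff_right by simp
    then have "norm (F X - F Y) \<le> norm (commutator (phi_mat f g X - phi_mat f g Y) (\<rho> X *\<^sub>R X))
        + norm (commutator (phi_mat f g Y) (\<rho> X *\<^sub>R X - \<rho> Y *\<^sub>R Y))"
      by (metis norm_triangle_ineq)
    also have "\<dots> \<le> 2 * norm (phi_mat f g X - phi_mat f g Y) * norm (\<rho> X *\<^sub>R X)
       + 2 * norm (phi_mat f g Y) * norm (\<rho> X *\<^sub>R X - \<rho> Y *\<^sub>R Y)"
      by (intro add_mono norm_commutator_le)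
    also have "\<dots> \<le> 2 * (4 * L' * norm (X - Y)) * R + 2 * M * (2 * norm (X - Y))"
      using \<rho> M phi_lip M0 \<open>R > 0\<close> radial_retraction_lipschitz[OF \<open>R > 0\<close>, of X Y]
      by (intro add_mono mult_mono) (auto simp: \<rho>_def L'_def)
    also have "\<dots> \<le> C * norm (X - Y)"
    proof -
      have "2 * (4 * L' * n) * R + 2 * M * (2 * n) \<le> C * n" if "0 \<le> n" for n
        using that by (simp add: C_def algebra_simps)
      from this[OF norm_ge_zero] show ?thesis .
    qed
    finally show ?thesis .
  qed
  have F_cont: "continuous_on S F" for S
    by (rule lipschitz_on_continuous_on[of C])
       (use C F_lip in \<open>auto simp: lipschitz_on_def dist_norm\<close>)
  have F_comp: "continuous_on {0..} (\<lambda>t. F (x t))" if "continuous_on {0..} x" for x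
    using continuous_on_compose2[OF F_cont[of UNIV] that] by simp
  obtain X where X0: "X 0 = T"
      and X: "\<And>t. 0 \<le> t \<Longrightarrow> (X has_vector_derivative F (X t)) (at t within {0..})"
    using global_lipschitz_ode[of "\<lambda>t. F" C "norm (F 0)" T, OF F_comp] C F_lip by auto
  have XK: "X t \<in> K" if "0 \<le> t" for t
    unfolding K_def
  proof (rule mat_interval_invariant[of a b f g X "\<lambda>t. \<rho> (X t)"])
    show "f y \<le> f x" "g y \<le> g x" if "b \<le> x" for x y
      using between(2,4)[of y] that \<open>a \<le> b\<close> by (auto simp: f_def g_def c_def)
    show "f x \<le> f y" "g x \<le> g y" if "x \<le> a" for x y
      using between(1,3)[of y] that \<open>a \<le> b\<close> by (auto simp: f_def g_def c_def min_def split: if_splits)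
    show "(X has_vector_derivative \<rho> (X t) *\<^sub>R commutator (phi_mat f g (X t)) (X t)) (at t within {0..})" if "0 \<le> t" for t
      using X[OF that] by (simp add: F_def commutator_scaleR_right)
  qed (use assms that \<rho> X0 in auto)
  have F_K: "F Y = commutator (phi_mat \<phi>1 \<phi>2 Y) Y" if "Y \<in> K" for Y
  proof -
    have "norm Y \<le> R" using mat_interval_norm_le[of Y a b] that by (simp add: K_def R_def)
    then have "\<rho> Y = 1" using \<open>R > 0\<close> by (simp add: \<rho>_def)
    moreover have "phi_mat f g Y = phi_mat \<phi>1 \<phi>2 Y"
      using that c by (intro phi_mat_cong[of Y a b]) (auto simp: K_def f_def g_def)
    ultimately show ?thesis by (simp add: F_def)
  qed
  have sol: "flow_solution a b \<phi>1 \<phi>2 T X"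
    unfolding flow_solution_def using X0 X XK F_K by (auto simp: K_def)
  have "phi_flow a b \<phi>1 \<phi>2 t T = X t" if t: "0 \<le> t" for t
    unfolding phi_flow_def
  proof (rule the_equality)
    fix Y assume "\<exists>Z. flow_solution a b \<phi>1 \<phi>2 T Z \<and> Y = Z t"
    then obtain Z where Z: "flow_solution a b \<phi>1 \<phi>2 T Z" "Y = Z t" by blast
    then have "(Z has_vector_derivative F (Z t)) (at t within {0..})" if "0 \<le> t" for t
      using that F_K[of "Z t"] unfolding flow_solution_def K_def by auto
    moreover have "Z 0 = X 0" using Z(1) X0 by (simp add: flow_solution_def)
    ultimately show "Y = X t"
      using ode_unique[of Z "\<lambda>t. F" X C t] X F_lip t Z(2) by auto
  qed (use sol in blast)
  moreover have phi_eq: "phi_mat \<phi>1 \<phi>2 (X t) = phi_mat f g (X t)" if "0 \<le> t" for t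
    using XK[OF that] c by (intro phi_mat_cong[of _ a b]) (auto simp: K_def f_def g_def)
  moreover have "continuous_on {0..} (\<lambda>t. phi_mat \<phi>1 \<phi>2 (X t))"
  proof -
    have "continuous_on UNIV (phi_mat f g :: 'n cmat \<Rightarrow> 'n cmat)"
      by (rule lipschitz_on_continuous_on[of "4 * L'"])
         (use phi_lip in \<open>auto simp: lipschitz_on_def dist_norm L'_def\<close>)
    moreover have "continuous_on {0..} X"
      unfolding continuous_on_eq_continuous_within using X has_vector_derivative_continuous by force
    ultimately have "continuous_on {0..} (\<lambda>t. phi_mat f g (X t))"
      by (rule continuous_on_compose2) auto
    then show ?thesis using phi_eq by (subst continuous_on_cong[OF refl]) auto
  qed
  moreover have "bounded ((\<lambda>t. phi_mat \<phi>1 \<phi>2 (X t)) ` {0..})"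
    using M phi_eq by (intro boundedI[of _ M]) auto
  ultimately show ?thesis using sol by blast
qed

section \<open>Similarity orbits and polynomials of a matrix\<close>

lemma similarity_orbit_iff:
  fixes A T :: "'n::finite cmat"
  shows "A \<in> similarity_orbit T \<longleftrightarrow> (\<exists>q p. q ** p = mat 1 \<and> p ** q = mat 1 \<and> A = q ** T ** p)"
proof
  assume "A \<in> similarity_orbit T"
  then obtain g where "invertible g" "A = g ** T ** matrix_inv g" by (auto simp: similarity_orbit_def)
  moreover from this(1) have "g ** matrix_inv g = mat 1 \<and> matrix_inv g ** g = mat 1"
    unfolding invertible_def matrix_inv_def by (rule someI_ex)
  ultimately show "\<exists>q p. q ** p = mat 1 \<and> p ** q = mat 1 \<and> A = q ** T ** p" by blast
next
  assume "\<exists>q p. q ** p = mat 1 \<and> p ** q = mat 1 \<and> A = q ** T ** p"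
  then obtain q p where qp: "q ** p = mat 1" "p ** q = mat 1" "A = q ** T ** p" by blast
  then have inv: "invertible q" by (auto simp: invertible_def)
  then have "q ** matrix_inv q = mat 1 \<and> matrix_inv q ** q = mat 1"
    unfolding invertible_def matrix_inv_def by (rule someI_ex)
  then have "matrix_inv q = p" by (metis qp(2) matrix_mul_assoc matrix_mul_lid matrix_mul_rid)
  then show "A \<in> similarity_orbit T" using qp(3) inv by (auto simp: similarity_orbit_def)
qed

lemma similarity_orbit_trans:
  assumes "A \<in> similarity_orbit B" "B \<in> similarity_orbit C"
  shows "A \<in> similarity_orbit C"
proof -
  obtain q p where 1: "q ** p = mat 1" "p ** q = mat 1" "A = q ** B ** p"
    using assms(1) similarity_orbit_iff by blast
  obtain q' p' where 2: "q' ** p' = mat 1" "p' ** q' = mat 1" "B = q' ** C ** p'"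
    using assms(2) similarity_orbit_iff by blast
  have "(q ** q') ** (p' ** p) = q ** (q' ** p') ** p" "(p' ** p) ** (q ** q') = p' ** (p ** q) ** q'"
    by (simp_all add: matrix_mul_assoc)
  then have "(q ** q') ** (p' ** p) = mat 1" "(p' ** p) ** (q ** q') = mat 1"
    using 1 2 by simp_all
  moreover have "A = (q ** q') ** C ** (p' ** p)" using 1 2 by (simp add: matrix_mul_assoc)
  ultimately show ?thesis using similarity_orbit_iff by blast
qed

lemma similarity_orbit_sym: "A \<in> similarity_orbit B \<Longrightarrow> B \<in> similarity_orbit A"
proof -
  assume "A \<in> similarity_orbit B"
  then obtain q p where 1: "q ** p = mat 1" "p ** q = mat 1" "A = q ** B ** p"
    using similarity_orbit_iff by blast
  then have "B = p ** A ** q" by (metis matrix_mul_assoc matrix_mul_lid matrix_mul_rid)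
  with 1 show ?thesis using similarity_orbit_iff by blast
qed

text \<open>If \<open>g' = A g\<close> and \<open>h' = - h A\<close> start at the identity, then \<open>hg\<close> and \<open>hXg\<close> are constant, so \<open>h = g\<^sup>-\<^sup>1\<close> and \<open>X = g X(0) g\<^sup>-\<^sup>1\<close>.\<close>

theorem isospectral_flow:
  fixes X A :: "real \<Rightarrow> 'n::finite cmat"
  assumes X: "\<And>t. 0 \<le> t \<Longrightarrow> (X has_vector_derivative commutator (A t) (X t)) (at t within {0..})"
    and A: "continuous_on {0..} A" "bounded (A ` {0..})" and "0 \<le> t"
  shows "X t \<in> similarity_orbit (X 0)"
proof -
  obtain M where M: "\<And>t. 0 \<le> t \<Longrightarrow> norm (A t) \<le> M"
    using A(2) unfolding bounded_iff by auto
  define L where "L = \<bar>M\<bar> + 1"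
  have L: "0 < L" "\<And>t. 0 \<le> t \<Longrightarrow> norm (A t) \<le> L" using M by (force simp: L_def)+
  have lip: "norm (A t) * norm B \<le> L * norm B" if "0 \<le> t" for t and B :: "'n cmat"
    using L(2)[OF that] by (intro mult_right_mono) auto
  have "\<exists>g. g 0 = mat 1 \<and> (\<forall>t\<ge>0. (g has_vector_derivative A t ** g t) (at t within {0..}))"
  proof (rule global_lipschitz_ode[of "\<lambda>t g. A t ** g" L 0])
    show "norm (A t ** x - A t ** y) \<le> L * norm (x - y)" if "0 \<le> t" for t and x y :: "'n cmat"
      using norm_matrix_mult_le[of "A t" "x - y"] lip[OF that, of "x - y"] by (simp add: matrix_diff_ldistrib)
    show "norm (A t ** 0) \<le> 0" for t
      using norm_matrix_mult_le[of "A t" 0] by simp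
  qed (use A(1) L in \<open>auto intro: matrix_mult_continuous_on\<close>)
  then obtain g where g: "g 0 = mat 1" "\<And>t. 0 \<le> t \<Longrightarrow> (g has_vector_derivative A t ** g t) (at t within {0..})"
    by blast
  have "\<exists>h. h 0 = mat 1 \<and> (\<forall>t\<ge>0. (h has_vector_derivative - (h t ** A t)) (at t within {0..}))"
  proof (rule global_lipschitz_ode[of "\<lambda>t h. - (h ** A t)" L 0])
    show "norm (- (x ** A t) - - (y ** A t)) \<le> L * norm (x - y)" if "0 \<le> t" for t and x y :: "'n cmat"
      using norm_matrix_mult_le[of "y - x" "A t"] lip[OF that, of "x - y"]
      by (simp add: matrix_diff_rdistrib norm_minus_commute mult.commute)
    show "norm (- (0 ** A t)) \<le> 0" for t
      using norm_matrix_mult_le[of 0 "A t"] by simp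
  qed (use A(1) L in \<open>auto intro!: matrix_mult_continuous_on continuous_intros\<close>)
  then obtain h where h: "h 0 = mat 1" "\<And>t. 0 \<le> t \<Longrightarrow> (h has_vector_derivative - (h t ** A t)) (at t within {0..})"
    by blast
  have minus_mult: "- (B :: 'n cmat) ** C = - (B ** C)" for B C :: "'n cmat"
    by (simp add: vec_eq_iff matrix_matrix_mult_def sum_negf)
  have hg: "((\<lambda>t. h t ** g t) has_vector_derivative 0) (at t within {0..})" if "t \<in> {0..}" for t
    using matrix_mult_has_vector_derivative[OF h(2) g(2), of t] that
    by (simp add: minus_mult matrix_mul_assoc)
  have hXg: "((\<lambda>t. h t ** X t ** g t) has_vector_derivative 0) (at t within {0..})" if "t \<in> {0..}" for t
    using matrix_mult_has_vector_derivative[OF matrix_mult_has_vector_derivative[OF h(2) X] g(2), of t] that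
    by (simp add: minus_mult matrix_mul_assoc commutator_def matrix_diff_ldistrib matrix_diff_rdistrib
       matrix_add_ldistrib matrix_add_rdistrib)
  obtain c where "\<And>t. 0 \<le> t \<Longrightarrow> h t ** g t = c"
    using has_vector_derivative_zero_constant[of "{0..}", OF _ hg] by auto
  with g(1) h(1) \<open>0 \<le> t\<close> have 1: "h t ** g t = mat 1" by (metis order_refl matrix_mul_lid)
  then have 2: "g t ** h t = mat 1" using matrix_left_right_inverse by blast
  obtain c' where "\<And>t. 0 \<le> t \<Longrightarrow> h t ** X t ** g t = c'"
    using has_vector_derivative_zero_constant[of "{0..}", OF _ hXg] by auto
  with g(1) h(1) \<open>0 \<le> t\<close> have "h t ** X t ** g t = X 0" by (metis order_refl matrix_mul_lid matrix_mul_rid)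
  then have "X 0 \<in> similarity_orbit (X t)" unfolding similarity_orbit_iff using 1 2 by metis
  then show ?thesis by (rule similarity_orbit_sym)
qed

text \<open>Horner's scheme; matrices of this type do not form a ring instance to which \<open>poly\<close> would apply.\<close>

definition matrix_poly :: "complex poly \<Rightarrow> 'n::finite cmat \<Rightarrow> 'n cmat" where
  "matrix_poly p X = fold_coeffs (\<lambda>a M. mat a + X ** M) p 0"

lemma matrix_mult_zero [simp]: "(A :: 'n::finite cmat) ** 0 = 0" "0 ** A = 0"
  by (simp_all add: vec_eq_iff matrix_matrix_mult_def)

lemma matrix_poly_0 [simp]: "matrix_poly 0 X = 0"
  by (simp add: matrix_poly_def)

lemma matrix_poly_pCons: "matrix_poly (pCons a p) X = mat a + X ** matrix_poly p X"
  by (cases "p = 0 \<and> a = 0") (auto simp: matrix_poly_def vec_eq_iff mat_def)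

lemma matrix_poly_continuous: "continuous_on S (matrix_poly p)"
  by (induction p rule: pCons_induct)
     (simp_all add: matrix_poly_pCons[abs_def] matrix_poly_0[abs_def] continuous_on_const
        continuous_on_add matrix_mult_continuous_on continuous_on_id)

lemma matrix_poly_bounded:
  "\<exists>K\<ge>0. \<forall>X :: 'n::finite cmat. norm X \<le> R \<longrightarrow> norm (matrix_poly p X) \<le> K"
proof -
  have "compact (matrix_poly p ` cball (0 :: 'n cmat) R)"
    by (intro compact_continuous_image matrix_poly_continuous compact_cball)
  then obtain K where "\<forall>X\<in>cball (0 :: 'n cmat) R. norm (matrix_poly p X) \<le> K"
    by (auto dest!: compact_imp_bounded simp: bounded_iff)
  then show ?thesis by (intro exI[of _ "max K 0"]) (auto simp: le_max_iff_disj)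
qed

lemma matrix_poly_conj:
  assumes "q ** t = mat 1" "t ** q = mat 1"
  shows "matrix_poly p (q ** X ** t) = q ** matrix_poly p X ** (t :: 'n::finite cmat)"
proof (induction p rule: pCons_induct)
  case (pCons a p)
  have "q ** mat a ** t = mat a" using assms by (metis mat_central matrix_mul_assoc matrix_mul_rid)
  moreover have "q ** X ** t ** (q ** M ** t) = q ** (X ** M) ** t" for M
  proof -
    have "q ** X ** t ** (q ** M ** t) = q ** X ** (t ** q) ** M ** t" by (simp add: matrix_mul_assoc)
    then show ?thesis by (simp add: assms matrix_mul_assoc)
  qed
  ultimately show ?case
    by (simp add: matrix_poly_pCons pCons matrix_add_ldistrib matrix_add_rdistrib)
qed simp

lemma matrix_poly_diag: "matrix_poly p (diag d) = diag (\<lambda>i. poly p (d i))"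
proof (induction p rule: pCons_induct)
  case 0 show ?case by (simp add: diag_def vec_eq_iff)
next
  case (pCons a p)
  then show ?case by (simp add: matrix_poly_pCons mat_eq_diag diag_mult_diag diag_add)
qed

text \<open>Commutators are derivations, so on bounded sets a matrix that almost commutes with \<open>X\<close> almost commutes with every polynomial in \<open>X\<close>, with a constant that does not depend on the matrix.\<close>

lemma commutator_matrix_poly_le:
  "\<exists>C\<ge>0. \<forall>X B :: 'n::finite cmat. norm X \<le> R \<longrightarrow> norm (commutator B (matrix_poly p X)) \<le> C * norm (commutator B X)"
proof (induction p rule: pCons_induct)
  case 0 show ?case by (intro exI[of _ 0]) (simp add: commutator_def)
next
  case (pCons a p)
  then obtain C where C: "C \<ge> 0"
    "\<And>X B :: 'n cmat. norm X \<le> R \<Longrightarrow> norm (commutator B (matrix_poly p X)) \<le> C * norm (commutator B X)" by blast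
  obtain K where K: "K \<ge> 0" "\<And>X :: 'n cmat. norm X \<le> R \<Longrightarrow> norm (matrix_poly p X) \<le> K"
    using matrix_poly_bounded by blast
  have "norm (commutator B (matrix_poly (pCons a p) X)) \<le> (K + \<bar>R\<bar> * C) * norm (commutator B X)"
    if X: "norm X \<le> R" for X B :: "'n cmat"
  proof -
    let ?M = "matrix_poly p X"
    have "commutator B (matrix_poly (pCons a p) X) = commutator B X ** ?M + X ** commutator B ?M"
      by (simp add: matrix_poly_pCons commutator_def matrix_add_ldistrib matrix_add_rdistrib
          matrix_diff_ldistrib matrix_diff_rdistrib mat_central matrix_mul_assoc)
    then have "norm (commutator B (matrix_poly (pCons a p) X)) \<le> norm (commutator B X) * norm ?M + norm X * norm (commutator B ?M)"
      by (metis add_mono norm_matrix_mult_le norm_triangle_le)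
    also have "\<dots> \<le> norm (commutator B X) * K + \<bar>R\<bar> * (C * norm (commutator B X))"
      using X C K by (intro add_mono mult_mono) (auto intro: mult_nonneg_nonneg)
    also have "\<dots> = (K + \<bar>R\<bar> * C) * norm (commutator B X)" by (simp only: ring_distribs mult_ac)
    finally show ?thesis .
  qed
  then show ?case using C K by (intro exI[of _ "K + \<bar>R\<bar> * C"]) auto
qed

lemma lagrange_interpolation:
  fixes h :: "complex \<Rightarrow> complex"
  assumes "finite S"
  shows "\<exists>p. \<forall>x\<in>S. poly p x = h x"
proof -
  define e where "e x = (\<Prod>y\<in>S - {x}. smult (1 / (x - y)) [:- y, 1:])" for x
  have e: "poly (e x) z = (if z = x then 1 else 0)" if "z \<in> S" for x z
  proof (cases "z = x")
    case False
    then have "z \<in> S - {x}" using that by simp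
    then show ?thesis using False assms unfolding e_def poly_prod by (auto intro!: prod_zero bexI[of _ z])
  qed (auto simp: e_def poly_prod simp flip: diff_divide_distrib split: if_splits intro!: prod.neutral)
  have "poly (\<Sum>x\<in>S. smult (h x) (e x)) z = h z" if "z \<in> S" for z
    using that assms by (simp add: poly_sum e if_distrib cong: if_cong)
  then show ?thesis by blast
qed

section \<open>Spectral projections of a diagonalizable matrix\<close>

text \<open>An interpolation polynomial of the indicator of \<open>l\<close> on the eigenvalues \<open>d i\<close>. Defining the spectral projection as a polynomial makes it continuous in the matrix and bounded on bounded sets.\<close>

definition spectral_poly :: "('n::finite \<Rightarrow> complex) \<Rightarrow> complex \<Rightarrow> complex poly" where
  "spectral_poly d l = (SOME p. \<forall>x\<in>range d. poly p x = (if x = l then 1 else 0))"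

definition spectral_proj :: "('n::finite \<Rightarrow> complex) \<Rightarrow> complex \<Rightarrow> 'n cmat \<Rightarrow> 'n cmat" where
  "spectral_proj d l = matrix_poly (spectral_poly d l)"

lemma poly_spectral_poly: "poly (spectral_poly d l) (d i) = (if d i = l then 1 else 0)"
proof -
  have "\<exists>p. \<forall>x\<in>range d. poly p x = (if x = l then 1 else 0)"
    by (rule lagrange_interpolation) simp
  then have "\<forall>x\<in>range d. poly (spectral_poly d l) x = (if x = l then 1 else 0)"
    unfolding spectral_poly_def by (rule someI_ex)
  then show ?thesis by simp
qed

lemma norm_mat_mult: "norm (mat c ** (A :: 'n::finite cmat)) = cmod c * norm A"
proof -
  have "(norm (mat c ** A))\<^sup>2 = (cmod c * norm A)\<^sup>2"
    unfolding power_mult_distrib matrix_norm_sq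
    by (simp add: mat_mult_entry norm_mult power_mult_distrib sum_distrib_left)
  then show ?thesis by (simp add: power2_eq_iff_nonneg)
qed

lemma conjugate_mult:
  assumes "p ** q = mat 1"
  shows "(q ** D ** p) ** (q ** E ** p) = q ** (D ** E) ** (p :: 'n::finite cmat)"
proof -
  have "(q ** D ** p) ** (q ** E ** p) = q ** D ** (p ** q) ** E ** p" by (simp add: matrix_mul_assoc)
  then show ?thesis by (simp add: assms matrix_mul_assoc)
qed

lemmas matrix_sum_ldistrib = bounded_bilinear.sum_right[OF bounded_bilinear_matrix_mult]

lemmas matrix_sum_rdistrib = bounded_bilinear.sum_left[OF bounded_bilinear_matrix_mult]

lemma sum_diag: "(\<Sum>l\<in>S. diag (f l)) = diag (\<lambda>i. \<Sum>l\<in>S. f l i)"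
  by (simp add: vec_eq_iff diag_def)

lemma inner_mat_1: "A \<bullet> mat 1 = Re (trace A)"
  by (simp add: matrix_inner_entries trace_def mat_def if_distrib cong: if_cong)

lemma spectral_resolution:
  fixes d :: "'n::finite \<Rightarrow> complex"
  assumes "X \<in> similarity_orbit (diag d)"
  defines "P \<equiv> \<lambda>l. spectral_proj d l X"
  shows "P l ** P m = (if l = m then P l else 0)"
    and "X ** P l = mat l ** P l" and "P l ** X = mat l ** P l"
    and "(\<Sum>l\<in>range d. P l) = mat 1"
    and "(\<Sum>l\<in>range d. mat l ** P l) = X"
    and "P l \<bullet> mat 1 = (\<Sum>i\<in>UNIV. if d i = l then 1 else 0)"
proof -
  obtain q p where qp: "q ** p = mat 1" "p ** q = mat 1" and X: "X = q ** diag d ** p"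
    using assms(1) similarity_orbit_iff by blast
  have P: "P l = q ** diag (\<lambda>i. if d i = l then 1 else 0) ** p" for l
    unfolding P_def spectral_proj_def X
    by (simp add: matrix_poly_conj[OF qp] matrix_poly_diag poly_spectral_poly)
  have lP: "mat l ** P l = q ** diag (\<lambda>i. if d i = l then l else 0) ** p" for l
  proof -
    have "mat l ** P l = q ** (mat l ** diag (\<lambda>i. if d i = l then 1 else 0)) ** p"
      unfolding P by (simp only: matrix_mul_assoc mat_central[of l q])
    moreover have "(\<lambda>i. l * (if d i = l then 1 else 0)) = (\<lambda>i. if d i = l then l else 0)" by auto
    ultimately show ?thesis by (simp add: mat_eq_diag diag_mult_diag)
  qed
  have zero: "diag (\<lambda>i. 0) = (0 :: 'n cmat)" by (simp add: vec_eq_iff diag_def)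
  show "P l ** P m = (if l = m then P l else 0)"
  proof -
    have "(\<lambda>i. (if d i = l then 1 else 0) * (if d i = m then 1 else 0)) = (\<lambda>i. if l = m \<and> d i = l then 1 else 0 :: complex)"
      by auto
    then show ?thesis
      unfolding P conjugate_mult[OF qp(2)] diag_mult_diag by (cases "l = m") (simp_all add: zero)
  qed
  show "X ** P l = mat l ** P l" "P l ** X = mat l ** P l"
  proof -
    have "(\<lambda>i. d i * (if d i = l then 1 else 0)) = (\<lambda>i. if d i = l then l else 0)"
      "(\<lambda>i. (if d i = l then 1 else 0) * d i) = (\<lambda>i. if d i = l then l else 0)" by auto
    then show "X ** P l = mat l ** P l" "P l ** X = mat l ** P l"
      unfolding lP unfolding P X conjugate_mult[OF qp(2)] diag_mult_diag by simp_all
  qed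
  show "(\<Sum>l\<in>range d. P l) = mat 1"
    unfolding P matrix_sum_ldistrib[symmetric] matrix_sum_rdistrib[symmetric] sum_diag
    by (simp add: qp(1) flip: mat_eq_diag)
  show "(\<Sum>l\<in>range d. mat l ** P l) = X"
    unfolding lP matrix_sum_ldistrib[symmetric] matrix_sum_rdistrib[symmetric] sum_diag X by simp
  have "trace (P l) = trace (diag (\<lambda>i. if d i = l then 1 else 0) :: 'n cmat)"
    unfolding P by (metis matrix_mul_assoc matrix_mul_lid qp(2) trace_mul_sym)
  also have "\<dots> = (\<Sum>i\<in>UNIV. if d i = l then 1 else 0)" by (simp add: trace_def diag_def)
  finally have "Re (trace (P l)) = (\<Sum>i\<in>UNIV. Re (if d i = l then 1 else 0))" by simp
  also have "\<dots> = (\<Sum>i\<in>UNIV. if d i = l then 1 else 0)" by (intro sum.cong refl) simp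
  finally show "P l \<bullet> mat 1 = (\<Sum>i\<in>UNIV. if d i = l then 1 else 0)" by (simp only: inner_mat_1)
qed

text \<open>Both sides reduce to \<open>\<parallel>PP\<^sup>* - P\<parallel>\<^sup>2\<close>: half the squared norm of the commutator equals it, and \<open>P - P\<^sup>*\<close> is the sum of \<open>P - PP\<^sup>*\<close> and minus its adjoint.\<close>

lemma idempotent_adj_diff:
  fixes P :: "'n::finite cmat"
  assumes "P ** P = P"
  shows "(norm (P - adj P))\<^sup>2 \<le> 2 * (norm (commutator (adj P) P))\<^sup>2"
proof -
  let ?Q = "P ** adj P"
  define x where "x = P \<bullet> (?Q ** P)"
  define y where "y = P \<bullet> P"
  have 1: "(adj P ** P) \<bullet> (adj P ** P) = x" "?Q \<bullet> ?Q = x" "(adj P ** P) \<bullet> ?Q = y" "?Q \<bullet> P = y"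
    using inner_mult_left_adj[of "adj P" P "adj P ** P"] inner_mult_right_adj[of P "adj P" ?Q]
      inner_mult_left_adj[of "adj P" P ?Q] inner_mult_right_adj[of P P P] inner_mult_right_adj[of P "adj P" P] assms
    by (simp_all add: x_def y_def matrix_mul_assoc)
  have comm: "(norm (commutator (adj P) P))\<^sup>2 = 2 * (x - y)"
    unfolding power2_norm_eq_inner commutator_def
    using 1 by (simp add: inner_diff_left inner_diff_right inner_commute)
  have half: "(norm (?Q - P))\<^sup>2 = x - y"
    unfolding power2_norm_eq_inner
    using 1 by (simp add: inner_diff_left inner_diff_right inner_commute y_def)
  have "norm (P - adj P) \<le> norm (P - ?Q) + norm (?Q - adj P)"
    using norm_triangle_ineq[of "P - ?Q" "?Q - adj P"] by simp
  also have "norm (?Q - adj P) = norm (?Q - P)"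
  proof -
    have "?Q - adj P = adj (?Q - P)" by (simp add: adj_diff adj_mult)
    then show ?thesis by simp
  qed
  finally have "norm (P - adj P) \<le> 2 * norm (?Q - P)" by (simp add: norm_minus_commute)
  then have "(norm (P - adj P))\<^sup>2 \<le> (2 * norm (?Q - P))\<^sup>2" by (intro power_mono) auto
  then show ?thesis using comm half by (simp only: power_mult_distrib) simp
qed

lemma commutator_adj_swap: "norm (commutator (adj A) B) = norm (commutator (adj B) A)"
proof -
  have "commutator (adj A) B = adj (commutator (adj B) A)"
    by (simp add: commutator_def adj_diff adj_mult)
  then show ?thesis by simp
qed

lemma idempotent_adj_norm:
  fixes P :: "'n::finite cmat"
  assumes "P ** P = P"
  shows "(norm P)\<^sup>2 - P \<bullet> mat 1 = (norm (P - adj P))\<^sup>2 / 2"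
proof -
  have "P \<bullet> mat 1 = P \<bullet> adj P"
    using inner_mult_right_adj[of P P "mat 1"] assms by simp
  moreover have "adj P \<bullet> adj P = P \<bullet> P" by (rule inner_adj_adj)
  ultimately show ?thesis
    unfolding power2_norm_eq_inner by (simp add: inner_diff_left inner_diff_right inner_commute)
qed

text \<open>For annihilating idempotents, \<open>P\<^sup>*Q = (P\<^sup>* - P)Q\<close> and \<open>QP\<^sup>* = Q(P\<^sup>* - P)\<close>. Inserting idempotent factors brings both products into the inner product, which is therefore quadratic in \<open>P - P\<^sup>*\<close>.\<close>

lemma cross_term_le:
  fixes P Q :: "'n::finite cmat"
  assumes P: "P ** P = P" and Q: "Q ** Q = Q" and PQ: "P ** Q = 0" "Q ** P = 0"
    and k: "norm P \<le> k" "norm Q \<le> k"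
  shows "\<bar>(mat l ** P) \<bullet> (mat m ** Q)\<bar> \<le> cmod l * cmod m * k ^ 3 * (norm (P - adj P))\<^sup>2"
proof -
  define e where "e = norm (P - adj P)"
  have k0: "0 \<le> k" using k(1) norm_ge_zero order_trans by blast
  have "mat l ** P = P ** (mat l ** P) ** P"
    by (metis P mat_central matrix_mul_assoc)
  then have "(mat l ** P) \<bullet> (mat m ** Q) = (mat l ** P) \<bullet> (adj P ** ((mat m ** Q) ** adj P))"
    using inner_mult_right_adj[of "P ** (mat l ** P)" P "mat m ** Q"]
      inner_mult_left_adj[of P "mat l ** P" "(mat m ** Q) ** adj P"] by simp
  also have "adj P ** ((mat m ** Q) ** adj P) = mat m ** ((adj P ** Q) ** (Q ** adj P))"
    by (metis Q mat_central matrix_mul_assoc)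
  also have "(adj P ** Q) ** (Q ** adj P) = (adj P - P) ** Q ** (Q ** (adj P - P))"
    using PQ by (simp add: matrix_diff_ldistrib matrix_diff_rdistrib)
  finally have "\<bar>(mat l ** P) \<bullet> (mat m ** Q)\<bar> \<le> norm (mat l ** P) * norm (mat m ** ((adj P - P) ** Q ** (Q ** (adj P - P))))"
    by (metis Cauchy_Schwarz_ineq2)
  also have "\<dots> \<le> (cmod l * k) * (cmod m * ((e * k) * (k * e)))"
    unfolding norm_mat_mult e_def norm_minus_commute[of P]
    using k k0
    by (intro mult_mono order.refl order.trans[OF norm_matrix_mult_le]) auto
  finally show ?thesis by (simp add: e_def power3_eq_cube power2_eq_square mult_ac)
qed

text \<open>The bounds for single polynomials, made uniform over a finite family.\<close>

lemma matrix_poly_bounds_uniform: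
  fixes p :: "complex \<Rightarrow> complex poly"
  assumes "finite S"
  obtains k C where "0 \<le> k" "0 \<le> C"
    "\<And>l (X :: 'n::finite cmat). l \<in> S \<Longrightarrow> norm X \<le> R \<Longrightarrow> norm (matrix_poly (p l) X) \<le> k"
    "\<And>l (X :: 'n cmat) B. l \<in> S \<Longrightarrow> norm X \<le> R \<Longrightarrow> norm (commutator B (matrix_poly (p l) X)) \<le> C * norm (commutator B X)"
proof -
  have "\<exists>k. 0 \<le> k \<and> (\<forall>l\<in>S. \<forall>X :: 'n cmat. norm X \<le> R \<longrightarrow> norm (matrix_poly (p l) X) \<le> k)"
    using assms
  proof (induction S rule: finite_induct)
    case (insert l S)
    then obtain k where k: "0 \<le> k" "\<forall>l\<in>S. \<forall>X :: 'n cmat. norm X \<le> R \<longrightarrow> norm (matrix_poly (p l) X) \<le> k" by blast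
    obtain k' where "\<forall>X :: 'n cmat. norm X \<le> R \<longrightarrow> norm (matrix_poly (p l) X) \<le> k'"
      using matrix_poly_bounded by blast
    with k show ?case by (intro exI[of _ "max k k'"]) (auto simp: le_max_iff_disj)
  qed auto
  then obtain k where k: "0 \<le> k" "\<forall>l\<in>S. \<forall>X :: 'n cmat. norm X \<le> R \<longrightarrow> norm (matrix_poly (p l) X) \<le> k" by blast
  have "\<exists>C. 0 \<le> C \<and> (\<forall>l\<in>S. \<forall>(X :: 'n cmat) B. norm X \<le> R \<longrightarrow> norm (commutator B (matrix_poly (p l) X)) \<le> C * norm (commutator B X))"
    using assms
  proof (induction S rule: finite_induct)
    case (insert l S)
    then obtain C where C: "0 \<le> C" "\<And>l (X :: 'n cmat) B. l \<in> S \<Longrightarrow> norm X \<le> R \<Longrightarrow> norm (commutator B (matrix_poly (p l) X)) \<le> C * norm (commutator B X)" by blast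
    obtain C' where C': "0 \<le> C'" "\<And>(X :: 'n cmat) B. norm X \<le> R \<Longrightarrow> norm (commutator B (matrix_poly (p l) X)) \<le> C' * norm (commutator B X)"
      using commutator_matrix_poly_le by blast
    have "C * z \<le> (C + C') * z" "C' * z \<le> (C + C') * z" if "0 \<le> z" for z
      using that C C' by (auto intro!: mult_right_mono)
    then have "norm (commutator B (matrix_poly (p l') X)) \<le> (C + C') * norm (commutator B X)"
      if "l' \<in> insert l S" "norm X \<le> R" for l' and X B :: "'n cmat"
      using that C(2)[of l' X B] C'(2)[of X B] order_trans norm_ge_zero by (metis insertE)
    then show ?case using C C' by (intro exI[of _ "C + C'"]) auto
  qed auto
  then obtain C where "0 \<le> C" "\<forall>l\<in>S. \<forall>(X :: 'n cmat) B. norm X \<le> R \<longrightarrow> norm (commutator B (matrix_poly (p l) X)) \<le> C * norm (commutator B X)" by blast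
  with k show ?thesis using that[of k C] by blast
qed

text \<open>Expand \<open>\<parallel>X\<parallel>\<^sup>2\<close> with \<open>X = \<Sum>l P\<^sub>l\<close>: by \<open>idempotent_adj_norm\<close> and \<open>cross_term_le\<close>, the diagonal terms exceed \<open>\<bar>l\<bar>\<^sup>2 tr P\<^sub>l\<close> by a multiple of \<open>\<parallel>P\<^sub>l - P\<^sub>l\<^sup>*\<parallel>\<^sup>2\<close>, and the other terms are bounded by such multiples. Passing twice from \<open>X\<close> to polynomials in \<open>X\<close> bounds \<open>[P\<^sub>l\<^sup>*, P\<^sub>l]\<close> by \<open>[X\<^sup>*, X]\<close>.\<close>

theorem energy_gap:
  fixes d :: "'n::finite \<Rightarrow> complex"
  shows "\<exists>C\<ge>0. \<forall>X\<in>similarity_orbit (diag d). norm X \<le> R \<longrightarrow>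
    \<bar>(norm X)\<^sup>2 - (\<Sum>i\<in>UNIV. (cmod (d i))\<^sup>2)\<bar> \<le> C * (norm (commutator (adj X) X))\<^sup>2"
proof -
  let ?S = "range d"
  obtain k C where k0: "0 \<le> k" "0 \<le> C"
    and k: "\<And>l (X :: 'n cmat). l \<in> ?S \<Longrightarrow> norm X \<le> R \<Longrightarrow> norm (spectral_proj d l X) \<le> k"
    and C: "\<And>l (X :: 'n cmat) B. l \<in> ?S \<Longrightarrow> norm X \<le> R \<Longrightarrow> norm (commutator B (spectral_proj d l X)) \<le> C * norm (commutator B X)"
    using matrix_poly_bounds_uniform[of ?S R "spectral_poly d"] unfolding spectral_proj_def by auto
  \<comment> \<open>The factor \<open>2 * C ^ 4\<close> comes from \<open>\<parallel>P\<^sub>l - P\<^sub>l\<^sup>*\<parallel>\<^sup>2 \<le> 2 * C ^ 4 * \<parallel>[X\<^sup>*, X]\<parallel>\<^sup>2\<close>, proved as \<open>dist\<close> below.\<close>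
  define A where "A l m = (if l = m then (cmod l)\<^sup>2 / 2 else cmod l * cmod m * k ^ 3) * (2 * C ^ 4)" for l m
  have A0: "0 \<le> A l m" for l m using k0 by (simp add: A_def)
  have "\<bar>(norm X)\<^sup>2 - (\<Sum>i\<in>UNIV. (cmod (d i))\<^sup>2)\<bar> \<le> (\<Sum>l\<in>?S. \<Sum>m\<in>?S. A l m) * (norm (commutator (adj X) X))\<^sup>2"
    if X: "X \<in> similarity_orbit (diag d)" "norm X \<le> R" for X
  proof -
    define D where "D = norm (commutator (adj X) X)"
    define P where "P l = spectral_proj d l X" for l
    note res = spectral_resolution[OF X(1), folded P_def]
    define mu where "mu l = (\<Sum>i\<in>UNIV. if d i = l then 1 else 0 :: real)" for l
    have idem: "P l ** P l = P l" for l using res(1)[of l l] by simp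
    have dist: "(norm (P l - adj (P l)))\<^sup>2 \<le> 2 * C ^ 4 * D\<^sup>2" if "l \<in> ?S" for l
    proof -
      have "norm (commutator (adj (P l)) (P l)) \<le> C * norm (commutator (adj (P l)) X)"
        using C[OF that X(2)] by (simp add: P_def)
      also have "\<dots> \<le> C * (C * D)"
        unfolding commutator_adj_swap[of "P l" X]
        using C[OF that X(2), of "adj X"] k0 by (intro mult_left_mono) (simp_all add: P_def D_def)
      finally have "(norm (commutator (adj (P l)) (P l)))\<^sup>2 \<le> (C * (C * D))\<^sup>2" by (intro power_mono) auto
      moreover have "(C * (C * D))\<^sup>2 = C ^ 4 * D\<^sup>2" by (simp add: power_mult_distrib power4_eq_xxxx power2_eq_square)
      ultimately show ?thesis using idempotent_adj_diff[OF idem, of l] by linarith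
    qed
    define G where "G l m = (mat l ** P l) \<bullet> (mat m ** P m) - (if l = m then (cmod l)\<^sup>2 * mu l else 0)" for l m
    have G: "\<bar>G l m\<bar> \<le> A l m * D\<^sup>2" if lm: "l \<in> ?S" "m \<in> ?S" for l m
    proof (cases "l = m")
      case True
      have "G l m = (cmod l)\<^sup>2 * ((norm (P l))\<^sup>2 - P l \<bullet> mat 1)"
        using True by (simp add: G_def power2_norm_eq_inner[symmetric] norm_mat_mult power_mult_distrib res(6) mu_def right_diff_distrib)
      also have "\<dots> = (cmod l)\<^sup>2 / 2 * (norm (P l - adj (P l)))\<^sup>2"
        unfolding idempotent_adj_norm[OF idem] by simp
      finally have G_eq: "G l m = (cmod l)\<^sup>2 / 2 * (norm (P l - adj (P l)))\<^sup>2" .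
      also have "\<dots> \<le> (cmod l)\<^sup>2 / 2 * (2 * C ^ 4 * D\<^sup>2)" by (intro mult_left_mono dist lm) auto
      finally have "G l m \<le> A l m * D\<^sup>2" using True by (simp add: A_def mult_ac)
      moreover have "0 \<le> G l m" unfolding G_eq by simp
      ultimately show ?thesis by simp
    next
      case False
      have "\<bar>G l m\<bar> \<le> cmod l * cmod m * k ^ 3 * (norm (P l - adj (P l)))\<^sup>2"
        using cross_term_le[OF idem idem, of l m k l m] res(1)[of l m] res(1)[of m l] False k[OF lm(1) X(2)] k[OF lm(2) X(2)]
        by (simp add: G_def P_def)
      also have "\<dots> \<le> cmod l * cmod m * k ^ 3 * (2 * C ^ 4 * D\<^sup>2)"
        using k0 by (intro mult_left_mono dist lm) auto
      finally show ?thesis using False by (simp add: A_def mult_ac)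
    qed
    have "(norm X)\<^sup>2 = (\<Sum>l\<in>?S. mat l ** P l) \<bullet> (\<Sum>m\<in>?S. mat m ** P m)"
      unfolding res(5) power2_norm_eq_inner ..
    also have "\<dots> = (\<Sum>l\<in>?S. \<Sum>m\<in>?S. (mat l ** P l) \<bullet> (mat m ** P m))"
      by (simp only: inner_sum_left inner_sum_right) (rule sum.swap)
    finally have 1: "(norm X)\<^sup>2 = (\<Sum>l\<in>?S. \<Sum>m\<in>?S. (mat l ** P l) \<bullet> (mat m ** P m))" .
    have "(\<Sum>l\<in>?S. \<Sum>m\<in>?S. if l = m then (cmod l)\<^sup>2 * mu l else 0) = (\<Sum>l\<in>?S. (cmod l)\<^sup>2 * mu l)"
      by (intro sum.cong refl) simp
    also have "\<dots> = (\<Sum>l\<in>?S. \<Sum>i\<in>UNIV. if d i = l then (cmod l)\<^sup>2 else 0)"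
      unfolding mu_def sum_distrib_left by (intro sum.cong refl) simp
    also have "\<dots> = (\<Sum>i\<in>UNIV. \<Sum>l\<in>?S. if d i = l then (cmod l)\<^sup>2 else 0)" by (rule sum.swap)
    also have "\<dots> = (\<Sum>i\<in>UNIV. (cmod (d i))\<^sup>2)" by (intro sum.cong refl) simp
    finally have 2: "(\<Sum>l\<in>?S. \<Sum>m\<in>?S. if l = m then (cmod l)\<^sup>2 * mu l else 0) = (\<Sum>i\<in>UNIV. (cmod (d i))\<^sup>2)" .
    have "(norm X)\<^sup>2 - (\<Sum>i\<in>UNIV. (cmod (d i))\<^sup>2) = (\<Sum>l\<in>?S. \<Sum>m\<in>?S. G l m)"
      unfolding G_def sum_subtractf 1 2 ..
    also have "\<bar>\<dots>\<bar> \<le> (\<Sum>l\<in>?S. \<Sum>m\<in>?S. A l m * D\<^sup>2)"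
      by (intro order.trans[OF sum_abs] sum_mono G)
    also have "\<dots> = (\<Sum>l\<in>?S. \<Sum>m\<in>?S. A l m) * D\<^sup>2" by (simp only: sum_distrib_right)
    finally show ?thesis by (simp only: D_def)
  qed
  moreover have "0 \<le> (\<Sum>l\<in>?S. \<Sum>m\<in>?S. A l m)" by (intro sum_nonneg A0)
  ultimately show ?thesis by blast
qed

text \<open>The polynomial \<open>Y\<close> in \<open>X\<close> that inverts the nonzero eigenvalues satisfies \<open>XYX = X\<close>. In the singular frame this forces the diagonal entry of \<open>Y\<close> at a singular value \<open>s \<noteq> 0\<close> to be \<open>1/s\<close>, and \<open>Y\<close> is bounded.\<close>

theorem singular_value_gap:
  fixes d :: "'n::finite \<Rightarrow> complex"
  shows "\<exists>\<delta>>0. \<forall>X\<in>similarity_orbit (diag d). norm X \<le> R \<longrightarrow>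
    (\<forall>U s V i. svd X U s V \<longrightarrow> s i = 0 \<or> \<delta> \<le> s i)"
proof -
  \<comment> \<open>At the eigenvalue \<open>0\<close> the convention \<open>inverse 0 = 0\<close> keeps \<open>l * inverse l * l = l\<close> valid.\<close>
  obtain p where p: "\<And>i. poly p (d i) = inverse (d i)"
    using lagrange_interpolation[of "range d" inverse] by auto
  obtain K where K: "K \<ge> 0" "\<And>X :: 'n cmat. norm X \<le> R \<Longrightarrow> norm (matrix_poly p X) \<le> K"
    using matrix_poly_bounded by blast
  have "s i = 0 \<or> 1 / (K + 1) \<le> s i"
    if X: "X \<in> similarity_orbit (diag d)" "norm X \<le> R" "svd X U s V" for X U s V i
  proof -
    obtain q t where qt: "q ** t = mat 1" "t ** q = mat 1" and Xq: "X = q ** diag d ** t"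
      using X(1) similarity_orbit_iff by blast
    define Y where "Y = matrix_poly p X"
    have Y: "Y = q ** diag (\<lambda>i. inverse (d i)) ** t"
      unfolding Y_def Xq by (simp add: matrix_poly_conj[OF qt] matrix_poly_diag p)
    have "X ** Y ** X = q ** diag (\<lambda>i. d i * inverse (d i) * d i) ** t"
      unfolding Y Xq conjugate_mult[OF qt(2)] diag_mult_diag ..
    also have "(\<lambda>i. d i * inverse (d i) * d i) = d"
    proof
      show "d i * inverse (d i) * d i = d i" for i by (cases "d i = 0") auto
    qed
    finally have XYX: "X ** Y ** X = X" by (simp add: Xq)
    have u: "unitary U" "unitary V" and s0: "0 \<le> s i" and XU: "X = U ** rdiag s ** adj V"
      using X(3) by (auto simp: svd_def)
    define M where "M = adj V ** Y ** U"
    have frame: "adj U ** X ** V = rdiag s"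
      using u unfolding XU by (simp add: unitary_cancel flip: matrix_mul_assoc)
    have "adj U ** (X ** Y ** X) ** V = rdiag s ** M ** rdiag s"
      using u unfolding XU M_def by (simp add: unitary_cancel flip: matrix_mul_assoc)
    then have "rdiag s ** M ** rdiag s = rdiag s" by (simp add: XYX frame)
    from arg_cong[OF this, of "\<lambda>A. A $ i $ i"]
    have "s i * M $ i $ i * s i = s i"
      by (simp add: matrix_mult_diag diag_mult_matrix) (simp add: diag_def)
    then have "s i = 0 \<or> s i * M $ i $ i = 1" by auto
    then show ?thesis
    proof
      assume "s i * M $ i $ i = 1"
      then have "s i * cmod (M $ i $ i) = 1" using s0 by (metis norm_mult norm_of_real norm_one abs_of_nonneg)
      moreover have "cmod (M $ i $ i) \<le> norm M" using Finite_Cartesian_Product.norm_nth_le[of "M $ i" i] Finite_Cartesian_Product.norm_nth_le[of M i] by linarith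
      moreover have "norm M = norm Y"
        using u by (simp add: M_def norm_unitary_mult_left norm_unitary_mult_right unitary_adj)
      moreover have "norm Y \<le> K" using K X by (simp add: Y_def)
      ultimately have "1 \<le> s i * (K + 1)"
        using mult_left_mono[of "cmod (M $ i $ i)" "K + 1" "s i"] s0 by linarith
      then show ?thesis using K(1) by (simp add: pos_divide_le_eq)
    qed simp
  qed
  then show ?thesis using K(1) by (intro exI[of _ "1 / (K + 1)"]) auto
qed

lemma det_tendsto:
  fixes S :: "real \<Rightarrow> 'n::finite cmat"
  assumes "(S \<longlongrightarrow> A) F"
  shows "((\<lambda>t. det (S t)) \<longlongrightarrow> det A) F"
  unfolding det_def using assms by (intro tendsto_intros)

text \<open>The matrices \<open>\<Sum>\<^sub>l P\<^sub>l(N) P\<^sub>l(X(t))\<close> intertwine \<open>N\<close> and \<open>X(t)\<close> because the relations \<open>X P\<^sub>l(X) = l P\<^sub>l(X)\<close> pass to the limit, and they tend to the identity, so they are eventually invertible.\<close>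

theorem diagonalizable_orbit_closed:
  fixes d :: "'n::finite \<Rightarrow> complex" and X :: "real \<Rightarrow> 'n cmat"
  assumes lim: "(X \<longlongrightarrow> N) at_top" and orb: "\<And>t. 0 \<le> t \<Longrightarrow> X t \<in> similarity_orbit (diag d)"
  shows "N \<in> similarity_orbit (diag d)"
proof -
  let ?S = "range d" let ?P = "spectral_proj d"
  have ev: "eventually (\<lambda>t. X t \<in> similarity_orbit (diag d)) at_top"
    using orb eventually_ge_at_top[of 0] by (rule eventually_mono[rotated]) auto
  have P_lim: "((\<lambda>t. ?P l (X t)) \<longlongrightarrow> ?P l N) at_top" for l
    unfolding spectral_proj_def
    by (rule continuous_on_tendsto_compose[OF matrix_poly_continuous[of UNIV] lim]) simp_all
  have NP: "N ** ?P l N = mat l ** ?P l N" for l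
  proof (rule tendsto_unique)
    show "((\<lambda>t. X t ** ?P l (X t)) \<longlongrightarrow> N ** ?P l N) at_top" by (intro matrix_mult_tendsto lim P_lim)
    have "((\<lambda>t. mat l ** ?P l (X t)) \<longlongrightarrow> mat l ** ?P l N) at_top" by (intro matrix_mult_tendsto tendsto_const P_lim)
    then show "((\<lambda>t. X t ** ?P l (X t)) \<longlongrightarrow> mat l ** ?P l N) at_top"
      by (rule Lim_transform_eventually) (use ev in \<open>eventually_elim, simp add: spectral_resolution(2)\<close>)
  qed simp
  define S where "S t = (\<Sum>l\<in>?S. ?P l N ** ?P l (X t))" for t
  have "(\<Sum>l\<in>?S. ?P l N ** ?P l N) = mat 1"
  proof (rule tendsto_unique)
    show "((\<lambda>t. \<Sum>l\<in>?S. ?P l (X t) ** ?P l (X t)) \<longlongrightarrow> (\<Sum>l\<in>?S. ?P l N ** ?P l N)) at_top"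
      by (intro tendsto_sum matrix_mult_tendsto P_lim)
    show "((\<lambda>t. \<Sum>l\<in>?S. ?P l (X t) ** ?P l (X t)) \<longlongrightarrow> mat 1) at_top"
      by (rule Lim_transform_eventually[OF tendsto_const])
         (use ev in \<open>eventually_elim, simp add: spectral_resolution(1,4)\<close>)
  qed simp
  moreover have "(S \<longlongrightarrow> (\<Sum>l\<in>?S. ?P l N ** ?P l N)) at_top"
    unfolding S_def by (intro tendsto_sum matrix_mult_tendsto P_lim tendsto_const)
  ultimately have "((\<lambda>t. det (S t)) \<longlongrightarrow> 1) at_top" using det_tendsto[of S "mat 1"] by simp
  then have "eventually (\<lambda>t. det (S t) \<noteq> 0) at_top" by (rule tendsto_imp_eventually_ne) simp
  with eventually_ge_at_top[of 0] have "eventually (\<lambda>t. 0 \<le> t \<and> det (S t) \<noteq> 0) at_top"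
    by eventually_elim simp
  then obtain t where t: "0 \<le> t" "det (S t) \<noteq> 0" using eventually_happens by force
  then obtain B where B: "S t ** B = mat 1" "B ** S t = mat 1"
    using invertible_det_nz[of "S t"] unfolding invertible_def by blast
  have "N ** S t = (\<Sum>l\<in>?S. (mat l ** ?P l N) ** ?P l (X t))"
    by (simp add: S_def matrix_sum_ldistrib matrix_mul_assoc NP)
  also have "\<dots> = (\<Sum>l\<in>?S. ?P l N ** (mat l ** ?P l (X t)))"
    by (metis (no_types, lifting) mat_central matrix_mul_assoc)
  also have "\<dots> = S t ** X t"
    unfolding S_def matrix_sum_rdistrib
    by (simp add: spectral_resolution(3)[OF orb[OF t(1)]] flip: matrix_mul_assoc)
  finally have "N = S t ** X t ** B" by (metis B(1) matrix_mul_assoc matrix_mul_rid)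
  then have "N \<in> similarity_orbit (X t)" unfolding similarity_orbit_iff using B by blast
  then show ?thesis using similarity_orbit_trans orb[OF t(1)] by blast
qed

section \<open>Convergence of trajectories that dissipate energy\<close>

text \<open>The energy gap \<open>e\<close> cannot become negative: its decay would then be bounded away from \<open>0\<close> and carry it to \<open>-\<infinity>\<close>. Hence \<open>0 \<le> e \<le> e(0) exp(-2\<gamma>t)\<close> with \<open>2\<gamma> = c/C\<close>. The speed is controlled by \<open>D\<close>, but the dissipation only by \<open>D\<^sup>2\<close>; weighting the energy with \<open>exp(\<gamma>t)\<close> and using \<open>2D \<le> D\<^sup>2 exp(\<gamma>t) + exp(-\<gamma>t)\<close> gives a scalar function \<open>\<Psi>\<close> of size \<open>exp(-\<gamma>t)\<close> whose increments dominate the displacement.\<close>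

lemma gradient_like_convergence:
  fixes X X' :: "real \<Rightarrow> 'a::euclidean_space" and e e' D :: "real \<Rightarrow> real"
  assumes e: "\<And>t. 0 \<le> t \<Longrightarrow> (e has_real_derivative e' t) (at t within {0..})"
    and diss: "\<And>t. 0 \<le> t \<Longrightarrow> e' t \<le> - c * (D t)\<^sup>2"
    and loj: "\<And>t. 0 \<le> t \<Longrightarrow> \<bar>e t\<bar> \<le> C * (D t)\<^sup>2"
    and low: "\<And>t. 0 \<le> t \<Longrightarrow> B \<le> e t"
    and X: "\<And>t. 0 \<le> t \<Longrightarrow> (X has_vector_derivative X' t) (at t within {0..})"
    and speed: "\<And>t. 0 \<le> t \<Longrightarrow> norm (X' t) \<le> K * D t"
    and pos: "0 < c" "0 < C" "0 < K"
  shows "\<exists>N A \<gamma>. 0 < A \<and> 0 < \<gamma> \<and> (\<forall>t\<ge>0. norm (X t - N) \<le> A * exp (- \<gamma> * t))"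
    and "0 < \<eta> \<Longrightarrow> 0 \<le> t0 \<Longrightarrow> \<exists>t\<ge>t0. (D t)\<^sup>2 < \<eta>"
proof -
  show freq: "\<exists>t\<ge>t0. (D t)\<^sup>2 < \<eta>" if "0 < \<eta>" "0 \<le> t0" for \<eta> t0
  proof (rule ccontr)
    assume "\<not> ?thesis"
    then have D: "\<And>t. t0 \<le> t \<Longrightarrow> \<eta> \<le> (D t)\<^sup>2" by force
    define t1 where "t1 = t0 + (\<bar>e t0\<bar> + \<bar>B\<bar> + 1) / (c * \<eta>)"
    have "t0 \<le> t1" using pos that by (simp add: t1_def)
    have "e t1 + c * \<eta> * t1 \<le> e t0 + c * \<eta> * t0"
    proof (rule antimono_if_deriv_nonpos_halfline[where f = "\<lambda>t. e t + c * \<eta> * t" and f' = "\<lambda>t. e' t + c * \<eta>"])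
      show "((\<lambda>t. e t + c * \<eta> * t) has_real_derivative e' t + c * \<eta>) (at t within {0..})" if "0 \<le> t" for t
        using e[OF that] by (auto intro!: derivative_eq_intros)
      show "e' t + c * \<eta> \<le> 0" if "t0 \<le> t" for t
        using diss[of t] mult_left_mono[OF D[OF that], of c] that \<open>0 \<le> t0\<close> pos by linarith
    qed fact+
    moreover have "c * \<eta> * t1 - c * \<eta> * t0 = \<bar>e t0\<bar> + \<bar>B\<bar> + 1"
      using pos that by (simp add: t1_def field_simps)
    ultimately show False using low[of t1] \<open>t0 \<le> t1\<close> \<open>0 \<le> t0\<close> by linarith
  qed
  have e'_neg: "e' t \<le> 0" if "0 \<le> t" for t
    using diss[OF that] pos by (smt (verit) mult_nonneg_nonneg zero_le_power2 mult_minus_left)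
  have e_nonneg: "0 \<le> e t" if t: "0 \<le> t" for t
  proof (rule ccontr)
    assume neg: "\<not> 0 \<le> e t"
    then obtain u where u: "u \<ge> t" "(D u)\<^sup>2 < - e t / C"
      using freq[of "- e t / C" t] t pos by (auto simp: field_simps)
    have "e u \<le> e t" by (rule antimono_if_deriv_nonpos_halfline[OF e]) (use e'_neg t u in auto)
    moreover have "\<bar>e u\<bar> \<le> C * (D u)\<^sup>2" using loj t u by simp
    moreover have "C * (D u)\<^sup>2 < - e t" using u pos by (simp add: field_simps)
    ultimately show False using neg by linarith
  qed
  define \<gamma> where "\<gamma> = c / (2 * C)"
  have \<gamma>: "0 < \<gamma>" "2 * \<gamma> * C = c" using pos by (simp_all add: \<gamma>_def)
  have \<gamma>e: "2 * \<gamma> * e t \<le> c * (D t)\<^sup>2" if "0 \<le> t" for t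
  proof -
    have "2 * \<gamma> * e t \<le> 2 * \<gamma> * (C * (D t)\<^sup>2)"
      using loj[OF that] \<gamma> by (intro mult_left_mono) auto
    also have "\<dots> = c * (D t)\<^sup>2" using \<gamma>(2) by (simp add: mult.assoc[symmetric])
    finally show ?thesis .
  qed
  have decay: "e t \<le> e 0 * exp (- (2 * \<gamma>) * t)" if t: "0 \<le> t" for t
  proof -
    have "e t * exp (2 * \<gamma> * t) \<le> e 0 * exp (2 * \<gamma> * 0)"
    proof (rule antimono_if_deriv_nonpos_halfline[where f = "\<lambda>t. e t * exp (2 * \<gamma> * t)" and f' = "\<lambda>t. exp (2 * \<gamma> * t) * (e' t + 2 * \<gamma> * e t)"])
      show "((\<lambda>t. e t * exp (2 * \<gamma> * t)) has_real_derivative exp (2 * \<gamma> * t) * (e' t + 2 * \<gamma> * e t)) (at t within {0..})"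
        if "0 \<le> t" for t
        using e[OF that] by (auto intro!: derivative_eq_intros simp: algebra_simps)
      show "exp (2 * \<gamma> * t) * (e' t + 2 * \<gamma> * e t) \<le> 0" if "0 \<le> t" for t
        using diss[OF that] \<gamma>e[OF that] by (intro mult_nonneg_nonpos) auto
    qed (use t in auto)
    then show ?thesis by (simp add: exp_minus field_simps)
  qed
  \<comment> \<open>The coefficients make both halves of the derivative of \<open>\<Psi>\<close> carry the factor \<open>K / 2\<close>.\<close>
  define a b where "a = K / c" and "b = K / (2 * \<gamma>)"
  have ab: "0 < a" "0 < b" "a * c = K" "2 * b * \<gamma> = K" using pos \<gamma> by (simp_all add: a_def b_def)
  define \<Psi> where "\<Psi> t = - a * e t * exp (\<gamma> * t) - b * exp (- \<gamma> * t)" for t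
  define \<Psi>' where "\<Psi>' t = a * exp (\<gamma> * t) * (- e' t - \<gamma> * e t) + b * \<gamma> * exp (- \<gamma> * t)" for t
  have \<Psi>: "(\<Psi> has_real_derivative \<Psi>' t) (at t within {0..})" if "0 \<le> t" for t
    unfolding \<Psi>_def \<Psi>'_def using e[OF that] by (auto intro!: derivative_eq_intros simp: algebra_simps)
  have dom: "norm (X' t) \<le> \<Psi>' t" if t: "0 \<le> t" for t
  proof -
    let ?E = "exp (\<gamma> * t)" and ?F = "exp (- \<gamma> * t)"
    have EF: "?E * ?F = 1" by (simp add: exp_minus)
    have "0 \<le> (D t * ?E - 1)\<^sup>2 * ?F" by simp
    also have "\<dots> = (D t)\<^sup>2 * ?E * (?E * ?F) - 2 * D t * (?E * ?F) + ?F"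
      by (simp only: power2_eq_square algebra_simps)
    finally have amgm: "2 * D t \<le> (D t)\<^sup>2 * ?E + ?F" unfolding EF by simp
    have "c / 2 * (D t)\<^sup>2 \<le> - e' t - \<gamma> * e t" using diss[OF t] \<gamma>e[OF t] by simp
    then have "a * ?E * (c / 2 * (D t)\<^sup>2) \<le> a * ?E * (- e' t - \<gamma> * e t)"
      using ab by (intro mult_left_mono) auto
    moreover have "a * ?E * (c / 2 * (D t)\<^sup>2) = K / 2 * ((D t)\<^sup>2 * ?E)" by (simp add: ab(3)[symmetric])
    moreover have "b * \<gamma> * ?F = K / 2 * ?F" by (simp add: ab(4)[symmetric])
    ultimately have "K / 2 * ((D t)\<^sup>2 * ?E) + K / 2 * ?F \<le> \<Psi>' t"
      unfolding \<Psi>'_def by linarith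
    moreover have "K * D t \<le> K / 2 * ((D t)\<^sup>2 * ?E) + K / 2 * ?F"
      using mult_left_mono[OF amgm, of "K / 2"] pos by (simp add: algebra_simps)
    ultimately show ?thesis using speed[OF t] by linarith
  qed
  define A where "A = a * e 0 + b"
  have A: "0 < A" using ab e_nonneg[of 0] by (simp add: A_def add_nonneg_pos)
  have \<Psi>_low: "- A * exp (- \<gamma> * t) \<le> \<Psi> t" if t: "0 \<le> t" for t
  proof -
    have "a * (e t * exp (\<gamma> * t)) \<le> a * (e 0 * exp (- (2 * \<gamma>) * t) * exp (\<gamma> * t))"
      using decay[OF t] ab by (intro mult_left_mono mult_right_mono) auto
    also have "\<dots> = a * e 0 * exp (- \<gamma> * t)"
      by (simp add: mult.assoc algebra_simps flip: exp_add)
    finally show ?thesis by (simp add: \<Psi>_def A_def algebra_simps)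
  qed
  have \<Psi>_neg: "\<Psi> t \<le> 0" if "0 \<le> t" for t
  proof -
    have "0 \<le> a * e t * exp (\<gamma> * t)" "0 \<le> b * exp (- \<gamma> * t)" using ab e_nonneg[OF that] by simp_all
    then show ?thesis by (simp add: \<Psi>_def)
  qed
  have cauchy: "norm (X t - X s) \<le> A * exp (- \<gamma> * s)" if st: "0 \<le> s" "s \<le> t" for s t
  proof (cases "s = t")
    case False
    have cont: "continuous_on {0..} X" "continuous_on {0..} \<Psi>"
      unfolding continuous_on_eq_continuous_within using X \<Psi>
      by (force intro: has_vector_derivative_continuous DERIV_continuous)+
    have "norm (X t - X s) \<le> \<Psi> t - \<Psi> s"
    proof (rule differentiable_bound_general)
      fix r assume r: "s < r" "r < t"
      then have at: "at r within {0..} = at r" using st by (intro at_within_interior) auto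
      show "(X has_vector_derivative X' r) (at r)" using X[of r] r st at by simp
      show "(\<Psi> has_vector_derivative \<Psi>' r) (at r)" using \<Psi>[of r] r st at
        by (simp add: has_real_derivative_iff_has_vector_derivative)
      show "norm (X' r) \<le> \<Psi>' r" using dom r st by simp
    qed (use st False in \<open>auto intro: continuous_on_subset[OF cont(1)] continuous_on_subset[OF cont(2)]\<close>)
    then show ?thesis using \<Psi>_low[of s] \<Psi>_neg[of t] st by simp
  qed (use A in auto)
  have exp_lim: "(\<lambda>n. A * exp (- \<gamma> * real n)) \<longlonglongrightarrow> 0"
  proof -
    have "(\<lambda>n. A * exp (- \<gamma>) ^ n) \<longlonglongrightarrow> A * 0"
      using \<gamma> by (intro tendsto_mult_left LIMSEQ_power_zero) simp
    then show ?thesis by (simp add: exp_of_nat_mult[symmetric] mult.commute)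
  qed
  have "Cauchy (\<lambda>n. X (real n))"
  proof (rule metric_CauchyI)
    fix r :: real assume "0 < r"
    then have "eventually (\<lambda>n. A * exp (- \<gamma> * real n) < r / 2) sequentially"
      using exp_lim by (intro order_tendstoD(2)) auto
    then obtain M where M: "A * exp (- \<gamma> * real M) < r / 2" by (auto simp: eventually_sequentially)
    have "dist (X (real m)) (X (real n)) < r" if "M \<le> m" "M \<le> n" for m n
      using cauchy[of M m] cauchy[of M n] M that dist_triangle_half_r[of "X (real M)" "X (real m)" r "X (real n)"]
      by (auto simp: dist_norm norm_minus_commute)
    then show "\<exists>M. \<forall>m\<ge>M. \<forall>n\<ge>M. dist (X (real m)) (X (real n)) < r" by blast
  qed
  then obtain N where N: "(\<lambda>n. X (real n)) \<longlonglongrightarrow> N"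
    using Cauchy_convergent convergent_def by blast
  have "norm (X t - N) \<le> A * exp (- \<gamma> * t)" if t: "0 \<le> t" for t
  proof (rule tendsto_upperbound)
    show "((\<lambda>n. norm (X t - X (real n))) \<longlongrightarrow> norm (X t - N)) sequentially"
      by (intro tendsto_intros N)
    show "eventually (\<lambda>n. norm (X t - X (real n)) \<le> A * exp (- \<gamma> * t)) sequentially"
      using eventually_ge_at_top[of "nat \<lceil>t\<rceil>"]
      by eventually_elim (use cauchy t in \<open>simp add: norm_minus_commute nat_ceiling_le_eq\<close>)
  qed simp
  then show "\<exists>N A \<gamma>. 0 < A \<and> 0 < \<gamma> \<and> (\<forall>t\<ge>0. norm (X t - N) \<le> A * exp (- \<gamma> * t))"
    using A \<gamma> by blast
qed

section \<open>Energy dissipation along the flow\<close>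

lemma C1_lipschitz:
  fixes \<phi> :: "real \<Rightarrow> real"
  assumes "\<And>x. x \<in> {a..b} \<Longrightarrow> (\<phi> has_real_derivative \<phi>' x) (at x within {a..b})"
    and "continuous_on {a..b} \<phi>'"
  shows "\<exists>L\<ge>0. \<forall>x\<in>{a..b}. \<forall>y\<in>{a..b}. \<bar>\<phi> x - \<phi> y\<bar> \<le> L * \<bar>x - y\<bar>"
proof -
  have "compact (\<phi>' ` {a..b})" by (intro compact_continuous_image assms) auto
  then obtain L where "\<forall>z\<in>{a..b}. \<bar>\<phi>' z\<bar> \<le> L" by (auto dest!: compact_imp_bounded simp: bounded_iff)
  then have L: "\<bar>\<phi>' z\<bar> \<le> max L 0" if "z \<in> {a..b}" for z using that by (auto simp: le_max_iff_disj)
  have "\<bar>\<phi> x - \<phi> y\<bar> \<le> max L 0 * \<bar>x - y\<bar>" if "x \<in> {a..b}" "y \<in> {a..b}" for x y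
    using field_differentiable_bound[of "{a..b}" \<phi> \<phi>' "max L 0" x y] assms(1) L that by auto
  then show ?thesis by (intro exI[of _ "max L 0"]) auto
qed

text \<open>The difference of the two sides without the \<open>k\<close> term is the integral of \<open>\<Theta>'(z) = (z\<^sup>2 - y\<^sup>2) f'(z) + (x\<^sup>2 - z\<^sup>2) g'(z)\<close> over \<open>[y, x]\<close>, which is nonnegative. On the part where \<open>z\<^sup>2 \<ge> (x\<^sup>2 + y\<^sup>2)/2\<close> the second weight is the smaller one, so the integrand is at least \<open>k (x\<^sup>2 - z\<^sup>2)\<close>. Only this part, which stays away from \<open>0\<close>, needs a lower bound for \<open>f' + g'\<close>.\<close>

lemma pair_ineq_ordered:
  fixes f g H f' g' :: "real \<Rightarrow> real"
  assumes "0 \<le> y" "y \<le> x" "x \<le> b" "0 \<le> k"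
    and f: "\<And>z. y \<le> z \<Longrightarrow> z \<le> x \<Longrightarrow> (f has_real_derivative f' z) (at z within {y..x})"
    and g: "\<And>z. y \<le> z \<Longrightarrow> z \<le> x \<Longrightarrow> (g has_real_derivative g' z) (at z within {y..x})"
    and H: "\<And>z. y \<le> z \<Longrightarrow> z \<le> x \<Longrightarrow> (H has_real_derivative z\<^sup>2 * (f' z - g' z)) (at z within {y..x})"
    and nonneg: "\<And>z. y < z \<Longrightarrow> z < x \<Longrightarrow> 0 \<le> f' z" "\<And>z. y < z \<Longrightarrow> z < x \<Longrightarrow> 0 \<le> g' z"
    and k: "\<And>z. y < z \<Longrightarrow> z < x \<Longrightarrow> x\<^sup>2 \<le> 2 * z\<^sup>2 \<Longrightarrow> k \<le> f' z + g' z"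
  shows "y\<^sup>2 * (f x - f y) + x\<^sup>2 * (g y - g x) \<le> H x - H y - k / (16 * (b + 1)) * (x\<^sup>2 - y\<^sup>2)\<^sup>2"
proof -
  define \<Theta> where "\<Theta> z = H z - y\<^sup>2 * f z + x\<^sup>2 * g z" for z
  define \<Theta>' where "\<Theta>' z = (z\<^sup>2 - y\<^sup>2) * f' z + (x\<^sup>2 - z\<^sup>2) * g' z" for z
  have D: "(\<Theta> has_real_derivative \<Theta>' z) (at z within {y..x})" if "y \<le> z" "z \<le> x" for z
    unfolding \<Theta>_def \<Theta>'_def using f[OF that] g[OF that] H[OF that]
    by (auto intro!: derivative_eq_intros simp: algebra_simps)
  have D': "DERIV \<Theta> z :> \<Theta>' z" if "y < z" "z < x" for z
    using D[of z] that at_within_interior[of z "{y..x}"] by simp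
  have cont: "continuous_on {y..x} \<Theta>"
    unfolding continuous_on_eq_continuous_within using D by (meson DERIV_continuous atLeastAtMost_iff)
  \<comment> \<open>Beyond \<open>m\<close> the weight \<open>x\<^sup>2 - z\<^sup>2\<close> is the smaller one.\<close>
  define m where "m = sqrt ((x\<^sup>2 + y\<^sup>2) / 2)"
  have m2: "m\<^sup>2 = (x\<^sup>2 + y\<^sup>2) / 2" by (simp add: m_def)
  have sq: "y\<^sup>2 \<le> x\<^sup>2" using assms by (intro power_mono) auto
  have m: "y \<le> m" "m \<le> x" "0 \<le> m"
    unfolding m_def using assms(1,2) sq by (auto intro!: real_le_rsqrt real_le_lsqrt)
  have "\<Theta> y \<le> \<Theta> m"
  proof (rule DERIV_nonneg_imp_increasing_open[OF m(1)])
    fix z assume z: "y < z" "z < m"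
    then have "y\<^sup>2 \<le> z\<^sup>2" "z\<^sup>2 \<le> x\<^sup>2" using m assms by (auto intro!: power_mono)
    then have "0 \<le> \<Theta>' z" unfolding \<Theta>'_def using nonneg[of z] z m by (intro add_nonneg_nonneg mult_nonneg_nonneg) auto
    then show "\<exists>d. DERIV \<Theta> z :> d \<and> 0 \<le> d" using D'[of z] z m by auto
  qed (rule continuous_on_subset[OF cont], use m in auto)
  \<comment> \<open>Since \<open>z \<le> b + 1\<close>, the bound \<open>k (x\<^sup>2 - z\<^sup>2)\<close> dominates a multiple of \<open>2z (x\<^sup>2 - z\<^sup>2)\<close>, which is the
    derivative of \<open>- (x\<^sup>2 - z\<^sup>2)\<^sup>2 / 2\<close>.\<close>
  moreover have "\<Theta> m + k / (4 * (b + 1)) * (x\<^sup>2 - m\<^sup>2)\<^sup>2 \<le> \<Theta> x + k / (4 * (b + 1)) * (x\<^sup>2 - x\<^sup>2)\<^sup>2"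
  proof (rule DERIV_nonneg_imp_increasing_open[OF m(2)])
    fix z assume z: "m < z" "z < x"
    have zs: "m\<^sup>2 \<le> z\<^sup>2" "z\<^sup>2 \<le> x\<^sup>2" using m assms z by (auto intro!: power_mono)
    let ?d = "\<Theta>' z - k / (b + 1) * z * (x\<^sup>2 - z\<^sup>2)"
    have "(x\<^sup>2 - z\<^sup>2) * f' z \<le> (z\<^sup>2 - y\<^sup>2) * f' z"
      using zs m2 nonneg(1)[of z] z m by (intro mult_right_mono) auto
    then have "(x\<^sup>2 - z\<^sup>2) * (f' z + g' z) \<le> \<Theta>' z" by (simp add: \<Theta>'_def algebra_simps)
    moreover have "(x\<^sup>2 - z\<^sup>2) * k \<le> (x\<^sup>2 - z\<^sup>2) * (f' z + g' z)"
    proof (intro mult_left_mono k)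
      have "x\<^sup>2 \<le> 2 * m\<^sup>2" by (simp add: m2)
      then show "x\<^sup>2 \<le> 2 * z\<^sup>2" using zs by linarith
    qed (use z m zs in auto)
    moreover have "k / (b + 1) * z * (x\<^sup>2 - z\<^sup>2) \<le> k * (x\<^sup>2 - z\<^sup>2)"
    proof (intro mult_right_mono)
      have "z / (b + 1) \<le> 1" using z m assms by (simp add: field_simps)
      then show "k / (b + 1) * z \<le> k" using mult_left_mono[of "z / (b + 1)" 1 k] assms(4) by simp
    qed (use zs in auto)
    ultimately have "0 \<le> ?d" by (simp add: mult.commute)
    moreover have "DERIV (\<lambda>z. \<Theta> z + k / (4 * (b + 1)) * (x\<^sup>2 - z\<^sup>2)\<^sup>2) z :> ?d"
    proof -
      have deriv: "DERIV (\<lambda>z. \<Theta> z + r * (x\<^sup>2 - z\<^sup>2)\<^sup>2) z :> \<Theta>' z - 4 * r * z * (x\<^sup>2 - z\<^sup>2)" for r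
        using D'[of z] z m by (auto intro!: derivative_eq_intros simp: algebra_simps)
      have "4 * (k / (4 * r)) = k / r" for r by simp
      with deriv[of "k / (4 * (b + 1))"] show ?thesis by (simp only:)
    qed
    ultimately show "\<exists>d. DERIV (\<lambda>z. \<Theta> z + k / (4 * (b + 1)) * (x\<^sup>2 - z\<^sup>2)\<^sup>2) z :> d \<and> 0 \<le> d" by blast
  qed (intro continuous_intros continuous_on_subset[OF cont], use m in auto)
  moreover have "k / (4 * (b + 1)) * (x\<^sup>2 - m\<^sup>2)\<^sup>2 = k / (16 * (b + 1)) * (x\<^sup>2 - y\<^sup>2)\<^sup>2"
  proof -
    have "x\<^sup>2 - m\<^sup>2 = (x\<^sup>2 - y\<^sup>2) / 2" by (simp add: m2 field_simps)
    moreover have "k / (4 * r) * (w / 2)\<^sup>2 = k / (16 * r) * w\<^sup>2" for r w by (simp add: power_divide)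
    ultimately show ?thesis by (simp only:)
  qed
  ultimately have "\<Theta> y + k / (16 * (b + 1)) * (x\<^sup>2 - y\<^sup>2)\<^sup>2 \<le> \<Theta> x" by simp
  then show ?thesis by (simp add: \<Theta>_def algebra_simps)
qed

text \<open>The case \<open>x < y\<close> is the ordered case with \<open>\<phi>\<^sub>1\<close> and \<open>\<phi>\<^sub>2\<close> exchanged and \<open>H\<close> replaced by \<open>-H\<close>. If the larger argument is at least \<open>\<delta>\<close>, then the points where a lower bound of \<open>\<phi>\<^sub>1' + \<phi>\<^sub>2'\<close> is used lie above \<open>\<delta>/2\<close>, where compactness provides it.\<close>

lemma pair_ineq:
  fixes a b \<delta> :: real and \<phi>1 \<phi>2 \<phi>1' \<phi>2' :: "real \<Rightarrow> real"
  assumes "0 \<le> a" "a \<le> b" "0 < \<delta>"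
    and d1: "\<And>x. x \<in> {a..b} \<Longrightarrow> (\<phi>1 has_real_derivative \<phi>1' x) (at x within {a..b})"
    and d2: "\<And>x. x \<in> {a..b} \<Longrightarrow> (\<phi>2 has_real_derivative \<phi>2' x) (at x within {a..b})"
    and c1: "continuous_on {a..b} \<phi>1'" and c2: "continuous_on {a..b} \<phi>2'"
    and mono: "mono_on {a..b} \<phi>1" "mono_on {a..b} \<phi>2"
    and pos: "\<And>x. x \<in> {a..b} - {0} \<Longrightarrow> \<phi>1' x + \<phi>2' x > 0"
  shows "\<exists>\<kappa>>0. \<exists>H. \<forall>x\<in>{a..b}. \<forall>y\<in>{a..b}. (x = 0 \<or> \<delta> \<le> x) \<longrightarrow> (y = 0 \<or> \<delta> \<le> y) \<longrightarrow>
    y\<^sup>2 * (\<phi>1 x - \<phi>1 y) + x\<^sup>2 * (\<phi>2 y - \<phi>2 x) \<le> H x - H y - \<kappa> * (x\<^sup>2 - y\<^sup>2)\<^sup>2"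
proof -
  define J where "J = {max a (\<delta> / 2)..b}"
  have J: "J \<subseteq> {a..b} - {0}" using \<open>0 < \<delta>\<close> by (auto simp: J_def)
  have "\<exists>k>0. \<forall>z\<in>J. k \<le> \<phi>1' z + \<phi>2' z"
  proof (cases "J = {}")
    case False
    have "continuous_on J (\<lambda>z. \<phi>1' z + \<phi>2' z)"
      using J by (intro continuous_intros continuous_on_subset[OF c1] continuous_on_subset[OF c2]) auto
    with False obtain z where "z \<in> J" "\<forall>w\<in>J. \<phi>1' z + \<phi>2' z \<le> \<phi>1' w + \<phi>2' w"
      using continuous_attains_inf[of J "\<lambda>z. \<phi>1' z + \<phi>2' z"] by (auto simp: J_def)
    then show ?thesis using pos[of z] J by blast
  qed (auto intro: exI[of _ 1])
  then obtain k where k: "0 < k" "\<And>z. z \<in> J \<Longrightarrow> k \<le> \<phi>1' z + \<phi>2' z" by blast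
  have "continuous_on {a..b} (\<lambda>z. z\<^sup>2 * (\<phi>1' z - \<phi>2' z))" by (intro continuous_intros c1 c2)
  then obtain H where H: "\<And>z. z \<in> {a..b} \<Longrightarrow> (H has_real_derivative z\<^sup>2 * (\<phi>1' z - \<phi>2' z)) (at z within {a..b})"
    by (rule antiderivative_continuous) (auto simp: has_real_derivative_iff_has_vector_derivative)
  have deriv_nonneg: "0 \<le> \<phi>' z"
    if "mono_on {a..b} \<phi>" "\<And>x. x \<in> {a..b} \<Longrightarrow> (\<phi> has_real_derivative \<phi>' x) (at x within {a..b})" "a < z" "z < b"
    for \<phi> \<phi>' :: "real \<Rightarrow> real" and z
    using mono_on_imp_deriv_nonneg[OF that(1), of "\<phi>' z" z] that(2)[of z] that(3,4) at_within_interior[of z "{a..b}"] by simp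
  define \<kappa> where "\<kappa> = k / (16 * (b + 1))"
  have "\<kappa> > 0" using k assms by (simp add: \<kappa>_def)
  have near: "z \<in> J" if "\<delta> \<le> x" "x\<^sup>2 \<le> 2 * z\<^sup>2" "a \<le> z" "z \<le> b" for x z
  proof -
    have "0 \<le> z" using that assms by simp
    have "(\<delta> / 2)\<^sup>2 \<le> \<delta>\<^sup>2 / 2" by (simp add: power_divide)
    also have "\<dots> \<le> x\<^sup>2 / 2" using that(1) \<open>0 < \<delta>\<close> by (intro divide_right_mono power_mono) auto
    also have "\<dots> \<le> z\<^sup>2" using that(2) by simp
    finally have "\<delta> / 2 \<le> z" by (rule power2_le_imp_le) fact
    then show ?thesis using that by (simp add: J_def)
  qed
  have "y\<^sup>2 * (\<phi>1 x - \<phi>1 y) + x\<^sup>2 * (\<phi>2 y - \<phi>2 x) \<le> H x - H y - \<kappa> * (x\<^sup>2 - y\<^sup>2)\<^sup>2"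
    if xy: "x \<in> {a..b}" "y \<in> {a..b}" "x = 0 \<or> \<delta> \<le> x" "y = 0 \<or> \<delta> \<le> y" for x y
  proof -
    consider "x = y" | "y < x" | "x < y" by linarith
    then show ?thesis
    proof cases
      case 2
      then have "\<delta> \<le> x" using xy assms by auto
      have sub: "{y..x} \<subseteq> {a..b}" using xy by auto
      show ?thesis unfolding \<kappa>_def
      proof (rule pair_ineq_ordered[where f' = \<phi>1' and g' = \<phi>2'])
        show "0 \<le> \<phi>1' z" "0 \<le> \<phi>2' z" if "y < z" "z < x" for z
          using deriv_nonneg[OF mono(1) d1, of z] deriv_nonneg[OF mono(2) d2, of z] that xy by auto
        show "k \<le> \<phi>1' z + \<phi>2' z" if "y < z" "z < x" "x\<^sup>2 \<le> 2 * z\<^sup>2" for z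
          using near[OF \<open>\<delta> \<le> x\<close> that(3)] that xy by (intro k) auto
      qed (use 2 xy assms k in \<open>auto intro!: has_field_derivative_subset[OF d1 sub] has_field_derivative_subset[OF d2 sub] has_field_derivative_subset[OF H sub]\<close>)
    next
      case 3
      then have "\<delta> \<le> y" using xy assms by auto
      have sub: "{x..y} \<subseteq> {a..b}" using xy by auto
      have H': "((\<lambda>z. - H z) has_real_derivative z\<^sup>2 * (\<phi>2' z - \<phi>1' z)) (at z within {x..y})" if "x \<le> z" "z \<le> y" for z
        using DERIV_minus[OF has_field_derivative_subset[OF H sub], of z] that xy by (auto simp: algebra_simps)
      have "x\<^sup>2 * (\<phi>2 y - \<phi>2 x) + y\<^sup>2 * (\<phi>1 x - \<phi>1 y) \<le> - H y - - H x - k / (16 * (b + 1)) * (y\<^sup>2 - x\<^sup>2)\<^sup>2"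
      proof (rule pair_ineq_ordered[where f' = \<phi>2' and g' = \<phi>1' and H = "\<lambda>z. - H z"])
        show "0 \<le> \<phi>2' z" "0 \<le> \<phi>1' z" if "x < z" "z < y" for z
          using deriv_nonneg[OF mono(1) d1, of z] deriv_nonneg[OF mono(2) d2, of z] that xy by auto
        show "k \<le> \<phi>2' z + \<phi>1' z" if "x < z" "z < y" "y\<^sup>2 \<le> 2 * z\<^sup>2" for z
          using near[OF \<open>\<delta> \<le> y\<close> that(3)] that xy k(2)[of z] by auto
      qed (use 3 xy assms k H' in \<open>auto intro!: has_field_derivative_subset[OF d1 sub] has_field_derivative_subset[OF d2 sub]\<close>)
      then show ?thesis by (simp add: \<kappa>_def power2_commute[of "y\<^sup>2"])
    qed simp
  qed
  then show ?thesis using \<open>\<kappa> > 0\<close> by blast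
qed

lemma svd_adj_commutator:
  "svd X U s V \<Longrightarrow> commutator (adj X) X = V ** rdiag (\<lambda>i. (s i)\<^sup>2) ** adj V - U ** rdiag (\<lambda>i. (s i)\<^sup>2) ** adj U"
  unfolding commutator_def using svd_adj_mult_self[of X U s V] svd_adj_mult_self[of "adj X" V s U] svd_adj[of X U s V]
  by simp

text \<open>Summing the pair inequality against the doubly stochastic weights removes the potential \<open>H\<close>, and the remaining sum is the squared norm of \<open>X\<^sup>*X - XX\<^sup>*\<close>.\<close>

lemma energy_dissipation:
  fixes X :: "'n::finite cmat"
  assumes X: "svd X U s V"
    and pair: "\<And>i j. (s j)\<^sup>2 * (f (s i) - f (s j)) + (s i)\<^sup>2 * (g (s j) - g (s i))
       \<le> H (s i) - H (s j) - \<kappa> * ((s i)\<^sup>2 - (s j)\<^sup>2)\<^sup>2"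
  shows "X \<bullet> commutator (phi_mat f g X) X \<le> - \<kappa> * (norm (commutator (adj X) X))\<^sup>2"
proof -
  have u: "unitary U" "unitary V" and eq: "X = U ** rdiag s ** adj V" using X by (auto simp: svd_def)
  let ?w = "\<lambda>i j. (cmod ((adj V ** U) $ i $ j))\<^sup>2"
  have W: "unitary (adj V ** U)" using u by (intro unitary_mult unitary_adj)
  have D: "(norm (commutator (adj X) X))\<^sup>2 = (\<Sum>i\<in>UNIV. \<Sum>j\<in>UNIV. ?w i j * ((s i)\<^sup>2 - (s j)\<^sup>2)\<^sup>2)"
    unfolding svd_adj_commutator[OF X] norm_minus_commute[of "V ** _ ** _"] frame_diff_same[OF u(2,1)]
    by (simp add: power2_commute)
  have telescope: "(\<Sum>i\<in>UNIV. \<Sum>j\<in>UNIV. ?w i j * (H (s i) - H (s j))) = 0"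
  proof -
    have "(\<Sum>i\<in>UNIV. \<Sum>j\<in>UNIV. ?w i j * H (s i)) = (\<Sum>i\<in>UNIV. H (s i))"
      using unitary_row_sum[OF W] by (simp add: sum_distrib_right[symmetric])
    moreover have "(\<Sum>i\<in>UNIV. \<Sum>j\<in>UNIV. ?w i j * H (s j)) = (\<Sum>j\<in>UNIV. H (s j))"
      using unitary_col_sum[OF W] by (subst sum.swap) (simp add: sum_distrib_right[symmetric])
    ultimately show ?thesis by (simp add: right_diff_distrib sum_subtractf)
  qed
  have "X \<bullet> commutator (phi_mat f g X) X = (\<Sum>i\<in>UNIV. \<Sum>j\<in>UNIV. ?w i j *
       (s j * s j * (f (s i) - f (s j)) + s i * s i * (g (s j) - g (s i))))"
    using commutator_frame_inner[OF u svd_phi_mat[OF X] eq, of s] eq by simp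
  also have "\<dots> \<le> (\<Sum>i\<in>UNIV. \<Sum>j\<in>UNIV. ?w i j * (H (s i) - H (s j) - \<kappa> * ((s i)\<^sup>2 - (s j)\<^sup>2)\<^sup>2))"
    using pair by (intro sum_mono mult_left_mono) (auto simp: power2_eq_square)
  also have "\<dots> = (\<Sum>i\<in>UNIV. \<Sum>j\<in>UNIV. ?w i j * (H (s i) - H (s j)))
      - \<kappa> * (\<Sum>i\<in>UNIV. \<Sum>j\<in>UNIV. ?w i j * ((s i)\<^sup>2 - (s j)\<^sup>2)\<^sup>2)"
    by (simp add: right_diff_distrib sum_subtractf sum_distrib_left mult_ac)
  finally show ?thesis unfolding telescope D by simp
qed

lemma hermitian_parts_diff_le:
  fixes X :: "'n::finite cmat"
  assumes X: "svd X U s V" and "0 \<le> c"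
    and h: "\<And>i j. \<bar>h (s i) - h (s j)\<bar> \<le> c * \<bar>(s i)\<^sup>2 - (s j)\<^sup>2\<bar>"
  shows "norm (V ** rdiag (\<lambda>i. h (s i)) ** adj V - U ** rdiag (\<lambda>i. h (s i)) ** adj U) \<le> c * norm (commutator (adj X) X)"
proof (rule power2_le_imp_le)
  have u: "unitary U" "unitary V" using X by (auto simp: svd_def)
  let ?w = "\<lambda>i j. (cmod ((adj U ** V) $ i $ j))\<^sup>2"
  have "(norm (V ** rdiag (\<lambda>i. h (s i)) ** adj V - U ** rdiag (\<lambda>i. h (s i)) ** adj U))\<^sup>2
      = (\<Sum>i\<in>UNIV. \<Sum>j\<in>UNIV. ?w i j * (h (s j) - h (s i))\<^sup>2)"
    by (rule frame_diff_same[OF u])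
  also have "\<dots> \<le> (\<Sum>i\<in>UNIV. \<Sum>j\<in>UNIV. ?w i j * (c\<^sup>2 * ((s j)\<^sup>2 - (s i)\<^sup>2)\<^sup>2))"
  proof (intro sum_mono mult_left_mono)
    fix i j
    have "\<bar>h (s j) - h (s i)\<bar>\<^sup>2 \<le> (c * \<bar>(s j)\<^sup>2 - (s i)\<^sup>2\<bar>)\<^sup>2" by (intro power_mono h) auto
    then show "(h (s j) - h (s i))\<^sup>2 \<le> c\<^sup>2 * ((s j)\<^sup>2 - (s i)\<^sup>2)\<^sup>2" by (simp add: power_mult_distrib)
  qed auto
  also have "\<dots> = c\<^sup>2 * (norm (commutator (adj X) X))\<^sup>2"
    unfolding svd_adj_commutator[OF X] frame_diff_same[OF u] by (simp add: sum_distrib_left mult_ac)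
  finally show "(norm (V ** rdiag (\<lambda>i. h (s i)) ** adj V - U ** rdiag (\<lambda>i. h (s i)) ** adj U))\<^sup>2
     \<le> (c * norm (commutator (adj X) X))\<^sup>2" by (simp add: power_mult_distrib)
qed (use \<open>0 \<le> c\<close> in simp)

text \<open>Since \<open>X h(\<bar>X\<bar>) = h(\<bar>X\<^sup>*\<bar>) X\<close>, the vector field only involves the differences \<open>h(\<bar>X\<bar>) - h(\<bar>X\<^sup>*\<bar>)\<close> for \<open>h = f\<close> and \<open>h = g\<close>.\<close>

lemma flow_speed_le:
  fixes X :: "'n::finite cmat"
  assumes X: "svd X U s V" and "0 \<le> c"
    and f: "\<And>i j. \<bar>f (s i) - f (s j)\<bar> \<le> c * \<bar>(s i)\<^sup>2 - (s j)\<^sup>2\<bar>"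
    and g: "\<And>i j. \<bar>g (s i) - g (s j)\<bar> \<le> c * \<bar>(s i)\<^sup>2 - (s j)\<^sup>2\<bar>"
  shows "norm (commutator (phi_mat f g X) X) \<le> 2 * c * norm X * norm (commutator (adj X) X)"
proof -
  have u: "unitary U" "unitary V" and eq: "X = U ** rdiag s ** adj V" using X by (auto simp: svd_def)
  define A where "A h = V ** rdiag (\<lambda>i. h (s i)) ** adj V" for h :: "real \<Rightarrow> real"
  define B where "B h = U ** rdiag (\<lambda>i. h (s i)) ** adj U" for h :: "real \<Rightarrow> real"
  have swap: "X ** A h = B h ** X" for h
    unfolding eq A_def B_def using u
    by (simp add: unitary_cancel flip: matrix_mul_assoc) (simp add: matrix_mul_assoc diag_mult_diag mult.commute)
  have "commutator (phi_mat f g X) X = A f ** X - X ** A f - (B g ** X - X ** B g)"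
    unfolding svd_phi_mat[OF X] commutator_def A_def B_def
    by (simp add: matrix_diff_ldistrib matrix_diff_rdistrib)
  also have "\<dots> = (A f - B f) ** X - X ** (A g - B g)"
    by (simp add: swap[symmetric] matrix_diff_ldistrib matrix_diff_rdistrib)
  finally have "norm (commutator (phi_mat f g X) X) \<le> norm ((A f - B f) ** X) + norm (X ** (A g - B g))"
    by (simp add: norm_triangle_ineq4)
  also have "\<dots> \<le> norm (A f - B f) * norm X + norm X * norm (A g - B g)"
    by (intro add_mono norm_matrix_mult_le)
  also have "\<dots> \<le> (c * norm (commutator (adj X) X)) * norm X + norm X * (c * norm (commutator (adj X) X))"
    unfolding A_def B_def
    by (intro add_mono mult_right_mono mult_left_mono hermitian_parts_diff_le[OF X \<open>0 \<le> c\<close>] f g) auto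
  finally show ?thesis by (simp add: mult_ac)
qed

section \<open>Convergence of the flow\<close>

theorem theorem3p7:
  fixes a b :: real and \<phi>1 \<phi>2 \<phi>1' \<phi>2' :: "real \<Rightarrow> real" and T :: "complex ^ 'n::finite ^ 'n"
  assumes "0 \<le> a" and "a \<le> b"
    and "\<And>x. x \<in> {a..b} \<Longrightarrow> (\<phi>1 has_real_derivative \<phi>1' x) (at x within {a..b})"
    and "\<And>x. x \<in> {a..b} \<Longrightarrow> (\<phi>2 has_real_derivative \<phi>2' x) (at x within {a..b})"
    and "continuous_on {a..b} \<phi>1'" and "continuous_on {a..b} \<phi>2'"
    and "mono_on {a..b} \<phi>1" and "mono_on {a..b} \<phi>2"
    and "strict_mono_on {a..b} (\<lambda>x. \<phi>1 x + \<phi>2 x)"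
    and "\<And>x. x \<in> {a..b} - {0} \<Longrightarrow> \<phi>1' x + \<phi>2' x > 0"
    and "T \<in> mat_interval a b" and "diagonalizable T"
  shows "\<exists>N C c. N \<in> similarity_orbit T \<and> normal_matrix N \<and> C > 0 \<and> c > 0 \<and>
           (\<forall>t\<ge>0. norm (phi_flow a b \<phi>1 \<phi>2 t T - N) \<le> C * exp (- c * t))"
proof -
  obtain L1 where L1: "0 \<le> L1" "\<And>x y. x \<in> {a..b} \<Longrightarrow> y \<in> {a..b} \<Longrightarrow> \<bar>\<phi>1 x - \<phi>1 y\<bar> \<le> L1 * \<bar>x - y\<bar>"
    using C1_lipschitz[OF assms(3,5)] by blast
  obtain L2 where L2: "0 \<le> L2" "\<And>x y. x \<in> {a..b} \<Longrightarrow> y \<in> {a..b} \<Longrightarrow> \<bar>\<phi>2 x - \<phi>2 y\<bar> \<le> L2 * \<bar>x - y\<bar>"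
    using C1_lipschitz[OF assms(4,6)] by blast
  define L where "L = L1 + L2"
  have L0: "0 \<le> L" using L1(1) L2(1) by (simp add: L_def)
  have L: "\<bar>\<phi>1 x - \<phi>1 y\<bar> \<le> L * \<bar>x - y\<bar>" "\<bar>\<phi>2 x - \<phi>2 y\<bar> \<le> L * \<bar>x - y\<bar>" if "x \<in> {a..b}" "y \<in> {a..b}" for x y
    using L1(2)[OF that] L2(2)[OF that] mult_right_mono[of L1 L "\<bar>x - y\<bar>"] mult_right_mono[of L2 L "\<bar>x - y\<bar>"] L1(1) L2(1)
    by (auto simp: L_def)
  obtain X where sol: "flow_solution a b \<phi>1 \<phi>2 T X" and flow: "\<And>t. 0 \<le> t \<Longrightarrow> phi_flow a b \<phi>1 \<phi>2 t T = X t"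
    and gen: "continuous_on {0..} (\<lambda>t. phi_mat \<phi>1 \<phi>2 (X t))" "bounded ((\<lambda>t. phi_mat \<phi>1 \<phi>2 (X t)) ` {0..})"
    using phi_flow_solution[OF assms(1,2,7,8) L assms(11)] by blast
  have X0: "X 0 = T" and XI: "\<And>t. 0 \<le> t \<Longrightarrow> X t \<in> mat_interval a b"
    and X: "\<And>t. 0 \<le> t \<Longrightarrow> (X has_vector_derivative commutator (phi_mat \<phi>1 \<phi>2 (X t)) (X t)) (at t within {0..})"
    using sol by (auto simp: flow_solution_def)
  obtain d where d: "diag d \<in> similarity_orbit T" using assms(12) by (auto simp: diagonalizable_def)
  have orbit: "X t \<in> similarity_orbit (diag d)" if "0 \<le> t" for t
    using isospectral_flow[OF X gen that] similarity_orbit_sym[OF d] X0 similarity_orbit_trans by blast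
  define R where "R = CARD('n) * b + 1"
  have R: "norm (X t) \<le> R" "0 < R" if "0 \<le> t" for t
    using mat_interval_norm_le[OF XI[OF that]] assms(1,2) by (auto simp: R_def intro: add_nonneg_pos)
  obtain \<delta> where \<delta>: "0 < \<delta>" "\<And>X U s V i. X \<in> similarity_orbit (diag d) \<Longrightarrow> norm X \<le> R \<Longrightarrow> svd X U s V \<Longrightarrow> s i = 0 \<or> \<delta> \<le> s i"
    using singular_value_gap[of d R] by blast
  obtain C where C: "0 \<le> C" "\<And>X. X \<in> similarity_orbit (diag d) \<Longrightarrow> norm X \<le> R \<Longrightarrow>
      \<bar>(norm X)\<^sup>2 - (\<Sum>i\<in>UNIV. (cmod (d i))\<^sup>2)\<bar> \<le> C * (norm (commutator (adj X) X))\<^sup>2"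
    using energy_gap[of d R] by blast
  obtain \<kappa> H where \<kappa>: "0 < \<kappa>" and pair: "\<And>x y. x \<in> {a..b} \<Longrightarrow> y \<in> {a..b} \<Longrightarrow> x = 0 \<or> \<delta> \<le> x \<Longrightarrow> y = 0 \<or> \<delta> \<le> y \<Longrightarrow>
     y\<^sup>2 * (\<phi>1 x - \<phi>1 y) + x\<^sup>2 * (\<phi>2 y - \<phi>2 x) \<le> H x - H y - \<kappa> * (x\<^sup>2 - y\<^sup>2)\<^sup>2"
    using pair_ineq[OF assms(1,2) \<delta>(1) assms(3-8,10)] by blast
  define D where "D t = norm (commutator (adj (X t)) (X t))" for t
  define E where "E = (\<Sum>i\<in>UNIV. (cmod (d i))\<^sup>2)"
  define e where "e t = X t \<bullet> X t - E" for t
  define e' where "e' t = 2 * (X t \<bullet> commutator (phi_mat \<phi>1 \<phi>2 (X t)) (X t))" for t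
  \<comment> \<open>For singular values that are \<open>0\<close> or at least \<open>\<delta>\<close>, differences of singular values are bounded by
    differences of their squares divided by \<open>\<delta>\<close>; hence the factor \<open>L / \<delta>\<close>.\<close>
  define K where "K = 2 * (L / \<delta>) * R + 1"
  have K: "0 < K" using L0 \<delta> R(2)[of 0] by (simp add: K_def add_nonneg_pos)
  have e: "(e has_real_derivative e' t) (at t within {0..})" if "0 \<le> t" for t
  proof -
    have "(X has_derivative (\<lambda>h. h *\<^sub>R commutator (phi_mat \<phi>1 \<phi>2 (X t)) (X t))) (at t within {0..})"
      using X[OF that] by (simp add: has_vector_derivative_def)
    from has_derivative_diff[OF has_derivative_inner[OF this this] has_derivative_const[of E]] show ?thesis
      unfolding has_field_derivative_def e_def[abs_def] e'_def
      by (rule has_derivative_eq_rhs) (auto simp: inner_commute)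
  qed
  have key: "e' t \<le> - (2 * \<kappa>) * (D t)\<^sup>2" "norm (commutator (phi_mat \<phi>1 \<phi>2 (X t)) (X t)) \<le> K * D t"
    if t: "0 \<le> t" for t
  proof -
    obtain U s V where svd: "svd (X t) U s V" using svd_exists by blast
    have s: "s i \<in> {a..b}" for i using XI[OF t] mat_interval_iff[OF svd] by blast
    have gap: "s i = 0 \<or> \<delta> \<le> s i" for i using \<delta>(2)[OF orbit[OF t] R(1)[OF t] svd] .
    have "X t \<bullet> commutator (phi_mat \<phi>1 \<phi>2 (X t)) (X t) \<le> - \<kappa> * (D t)\<^sup>2"
      unfolding D_def by (rule energy_dissipation[OF svd, where H = H]) (intro pair s gap)
    then show "e' t \<le> - (2 * \<kappa>) * (D t)\<^sup>2" by (simp add: e'_def)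
    have diff: "\<bar>h (s i) - h (s j)\<bar> \<le> L / \<delta> * \<bar>(s i)\<^sup>2 - (s j)\<^sup>2\<bar>"
      if h: "\<And>x y. x \<in> {a..b} \<Longrightarrow> y \<in> {a..b} \<Longrightarrow> \<bar>h x - h y\<bar> \<le> L * \<bar>x - y\<bar>" for h i j
    proof -
      have nn: "0 \<le> s i" "0 \<le> s j" using svd by (auto simp: svd_def)
      have "\<delta> * \<bar>s i - s j\<bar> \<le> \<bar>s i + s j\<bar> * \<bar>s i - s j\<bar>"
      proof (cases "s i = s j")
        case False
        then have "\<delta> \<le> s i + s j" using gap[of i] gap[of j] nn by auto
        then show ?thesis by (intro mult_right_mono) auto
      qed simp
      also have "\<dots> = \<bar>(s i)\<^sup>2 - (s j)\<^sup>2\<bar>" by (simp add: abs_mult[symmetric] power2_eq_square algebra_simps)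
      finally have "\<bar>s i - s j\<bar> \<le> \<bar>(s i)\<^sup>2 - (s j)\<^sup>2\<bar> / \<delta>" using \<delta>(1) by (simp add: pos_le_divide_eq mult.commute)
      then have "L * \<bar>s i - s j\<bar> \<le> L * (\<bar>(s i)\<^sup>2 - (s j)\<^sup>2\<bar> / \<delta>)" using L0 by (rule mult_left_mono)
      then show ?thesis using h[OF s s, of i j] by simp
    qed
    have "norm (commutator (phi_mat \<phi>1 \<phi>2 (X t)) (X t)) \<le> 2 * (L / \<delta>) * norm (X t) * D t"
      unfolding D_def using L0 \<delta>(1) by (intro flow_speed_le[OF svd] diff L) auto
    also have "\<dots> \<le> K * D t"
      unfolding K_def using L0 \<delta>(1) R(1)[OF t]
      by (intro mult_right_mono order.trans[OF mult_left_mono[OF R(1)[OF t]]]) (auto simp: D_def)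
    finally show "norm (commutator (phi_mat \<phi>1 \<phi>2 (X t)) (X t)) \<le> K * D t" .
  qed
  have loj: "\<bar>e t\<bar> \<le> (C + 1) * (D t)\<^sup>2" if "0 \<le> t" for t
  proof -
    have "\<bar>e t\<bar> \<le> C * (D t)\<^sup>2"
      using C(2)[OF orbit[OF that] R(1)[OF that]] by (simp add: e_def D_def E_def power2_norm_eq_inner)
    then show ?thesis unfolding ring_distribs using zero_le_power2[of "D t"] by linarith
  qed
  have low: "- E \<le> e t" for t by (simp add: e_def)
  have pos: "0 < 2 * \<kappa>" "0 < C + 1" using \<kappa> C(1) by auto
  note conv = gradient_like_convergence[OF e key(1) loj low X key(2) pos K]
  obtain N A \<gamma> where A: "0 < A" "0 < \<gamma>" and N: "\<And>t. 0 \<le> t \<Longrightarrow> norm (X t - N) \<le> A * exp (- \<gamma> * t)"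
    using conv(1) by blast
  have lim: "(X \<longlongrightarrow> N) at_top"
  proof -
    have "((\<lambda>t. A * exp (- \<gamma> * t)) \<longlongrightarrow> 0) at_top"
      using A by real_asymp
    moreover have "eventually (\<lambda>t. norm (X t - N) \<le> A * exp (- \<gamma> * t)) at_top"
      using eventually_ge_at_top[of 0] by eventually_elim (rule N)
    ultimately have "((\<lambda>t. X t - N) \<longlongrightarrow> 0) at_top" by (rule Lim_null_comparison[rotated])
    then show ?thesis by (simp add: LIM_zero_iff)
  qed
  have "N \<in> similarity_orbit T"
    using diagonalizable_orbit_closed[OF lim orbit] d similarity_orbit_trans by blast
  moreover have "normal_matrix N"
  proof (rule ccontr)
    assume "\<not> normal_matrix N"
    then have pos: "0 < (norm (commutator (adj N) N))\<^sup>2" by (simp add: normal_matrix_def commutator_def)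
    have "((\<lambda>t. (D t)\<^sup>2) \<longlongrightarrow> (norm (commutator (adj N) N))\<^sup>2) at_top"
      unfolding D_def commutator_def
      by (intro tendsto_intros matrix_mult_tendsto lim bounded_linear.tendsto[OF bounded_linear_adj])
    then have "eventually (\<lambda>t. (norm (commutator (adj N) N))\<^sup>2 / 2 < (D t)\<^sup>2) at_top"
      by (rule order_tendstoD) (use pos in simp)
    then obtain t0 where "\<And>t. t0 \<le> t \<Longrightarrow> (norm (commutator (adj N) N))\<^sup>2 / 2 < (D t)\<^sup>2"
      by (auto simp: eventually_at_top_linorder)
    moreover obtain t where "max t0 0 \<le> t" "(D t)\<^sup>2 < (norm (commutator (adj N) N))\<^sup>2 / 2"
      using conv(2)[of "(norm (commutator (adj N) N))\<^sup>2 / 2" "max t0 0"] pos by auto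
    ultimately show False by (metis max.boundedE not_less_iff_gr_or_eq)
  qed
  ultimately show ?thesis using A N flow by metis
qed

end
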